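(* Let $A$ be an abelian topological group (Hausdorff) and let $\mathcal F$ be the set of all continuous group homomorphisms $A\to\mathbb T$; $\mathcal F$ is an abelian group under pointwise multiplication. Let $M=(A,+,-,0,f)_{f\in\mathcal F}$ be the continuous-logic structure described in the context, let $M^*=(A^*,+^*,-^*,0^*,f^* )_{f\in\mathcal F}$ be a saturated elementary extension of $M$, and let $S_{\mathcal F}(M)$ be the space of $\mathcal F$-types with the operation $+^*$ and topology defined in the context. Then: (i) the operation $+^*$, together with the type-space topology, makes $S_{\mathcal F}(M)$ a compact abelian topological group; (ii) the map sending $p\in S_{\mathcal F}(M)$ to the homomorphism $\mathcal F\to\mathbb T$, $f\mapsto f^*(p)$, is an isomorphism of topological groups from $S_{\mathcal F}(M)$ onto the Pontryagin dual of $\mathcal F$, where $\mathcal F$ is regarded as a discrete group (i.e. onto the group of all homomorphisms $\mathcal F\to\mathbb T$ with the topology of pointwise convergence, induced from $\mathbb T^{\mathcal F}$); (iii) the map $j:A\to S_{\mathcal F}(M)$, $a\mapsto \mathrm{tp}_{\mathcal F}(a)$, is a continuous homomorphism, and $j:A\to S_{\mathcal F}(M)$ is isomorphic to the Bohr compactification $\iota:A\to bA$ of $A$.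
   Context: $\mathbb T$ is the circle group $\{z\in\mathbb C:|z|=1\}$, written multiplicatively. All topological spaces and groups are Hausdorff. $M$ is viewed as a structure in continuous logic (in the sense of Ben Yaacov–Berenstein–Henson–Usvyatsov): $+,-,0$ are function symbols, equality is a $\{0,1\}$-valued formula, each $f\in\mathcal F$ is a $\mathbb C$-valued predicate symbol interpreted as $f$, connectives are continuous functions $\mathbb C^n\to\mathbb C$, and quantifiers are $\sup_x|\cdot|$ and $\inf_x|\cdot|$. In the saturated elementary extension $M^*$, $f^*:A^*\to\mathbb T$ denotes the interpretation of the symbol for $f$ (it is a homomorphism). The $\mathcal F$-type of $a\in A^*$, $\mathrm{tp}_{\mathcal F}(a)$, is the information consisting of the values $f^*(a)$ for $f\in\mathcal F$; $S_{\mathcal F}(M)$ is the set of $\mathcal F$-types of elements of $A^*$. For $p\in S_{\mathcal F}(M)$, $f^*(p)$ denotes $f^*(a)$ for any $a$ realizing $p$. The topology on $S_{\mathcal F}(M)$ is the coarsest making all maps $p\mapsto f^*(p)$ ($f\in\mathcal F$) continuous; equivalently, basic closed sets are the sets of types satisfying $u(f_1(x),\dots,f_n(x))=r$ for $f_i\in\mathcal F$, $u:\mathbb C^n\to\mathbb C$ continuous, $r\in\mathbb C$. For $p,q\in S_{\mathcal F}(M)$, $p+^*q:=\mathrm{tp}_{\mathcal F}(a+^*b)$ where $a$ realizes $p$ and $b$ realizes $q$ (well defined since $f^*(a+^*b)=f^*(a)f^*(b)$). The Bohr compactification of a topological group $G$ is a continuous homomorphism $\iota:G\to bG$ into a compact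 group which is universal: for every continuous homomorphism $g:G\to D$ into a compact group $D$ there is a unique continuous homomorphism $h:bG\to D$ with $g=h\circ\iota$. *)

theory Defs
  imports "HOL-Analysis.Analysis" "HOL-Algebra.Group"
begin

unbundle cardinal_syntax

section \<open>Topological groups\<close>

definition topological_group :: "('a, 'm) monoid_scheme \<Rightarrow> 'a topology \<Rightarrow> bool" where
  "topological_group G T \<longleftrightarrow>
     group G \<and> topspace T = carrier G \<and> Hausdorff_space T \<and>
     continuous_map (prod_topology T T) T (\<lambda>(x, y). x \<otimes>\<^bsub>G\<^esub> y) \<and>
     continuous_map T T (\<lambda>x. inv\<^bsub>G\<^esub> x)"

definition compact_group :: "('a, 'm) monoid_scheme \<Rightarrow> 'a topology \<Rightarrow> bool" where
  "compact_group G T \<longleftrightarrow> topological_group G T \<and> compact_space T"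

definition continuous_hom ::
  "('a, 'm) monoid_scheme \<Rightarrow> 'a topology \<Rightarrow> ('b, 'n) monoid_scheme \<Rightarrow> 'b topology \<Rightarrow> ('a \<Rightarrow> 'b) set" where
  "continuous_hom G T H U = {h \<in> hom G H. continuous_map T U h}"

definition topological_iso ::
  "('a, 'm) monoid_scheme \<Rightarrow> 'a topology \<Rightarrow> ('b, 'n) monoid_scheme \<Rightarrow> 'b topology \<Rightarrow> ('a \<Rightarrow> 'b) set" where
  "topological_iso G T H U = {h \<in> iso G H. homeomorphic_map T U h}"

definition circle_group :: "complex monoid" where
  "circle_group = \<lparr>carrier = {z. cmod z = 1}, mult = (*), one = 1\<rparr>"

definition circle_topology :: "complex topology" where
  "circle_topology = top_of_set {z. cmod z = 1}"

text \<open>Functions defined only on a carrier are represented by extensional functions, so that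
  equality of such maps is equality of HOL functions.\<close>

definition characters :: "('a, 'm) monoid_scheme \<Rightarrow> 'a topology \<Rightarrow> ('a \<Rightarrow> complex) set" where
  "characters G T = continuous_hom G T circle_group circle_topology \<inter> extensional (carrier G)"

definition character_group :: "('a, 'm) monoid_scheme \<Rightarrow> 'a topology \<Rightarrow> ('a \<Rightarrow> complex) monoid" where
  "character_group G T =
     \<lparr>carrier = characters G T,
      mult = (\<lambda>f g. \<lambda>x\<in>carrier G. f x * g x),
      one = (\<lambda>x\<in>carrier G. 1)\<rparr>"

text \<open>The topology of pointwise convergence; for a discrete group this is the topology of the
  Pontryagin dual.\<close>

definition pointwise_topology ::
  "('a, 'm) monoid_scheme \<Rightarrow> 'a topology \<Rightarrow> ('a \<Rightarrow> complex) topology" where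
  "pointwise_topology G T =
     subtopology (product_topology (\<lambda>_. circle_topology) (carrier G)) (characters G T)"

text \<open>HOL cannot quantify over types inside a formula, so the type of the elements of the compact
  test groups is a parameter; the full universal property is the conjunction over all types
  \<open>'d\<close>. The test groups need not be abelian.\<close>

definition bohr_compactification ::
  "'d itself \<Rightarrow> ('a, 'm) monoid_scheme \<Rightarrow> 'a topology \<Rightarrow>
   ('b, 'n) monoid_scheme \<Rightarrow> 'b topology \<Rightarrow> ('a \<Rightarrow> 'b) \<Rightarrow> bool" where
  "bohr_compactification _ G T B U \<iota> \<longleftrightarrow>
     compact_group B U \<and> \<iota> \<in> continuous_hom G T B U \<and>
     (\<forall>(D :: 'd monoid) V g. compact_group D V \<and> g \<in> continuous_hom G T D V \<longrightarrow>
        (\<exists>!h. h \<in> continuous_hom B U D V \<inter> extensional (carrier B) \<and>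
              (\<forall>a\<in>carrier G. g a = h (\<iota> a))))"

section \<open>Continuous logic\<close>

text \<open>Terms and formulas in the function symbols \<open>+, -, 0\<close>, predicate symbols from \<open>'f\<close> and
  additional constants (parameters) from \<open>'c\<close>. \<open>Conn u [\<phi>\<^sub>0, \<dots>, \<phi>\<^sub>n\<^sub>-\<^sub>1]\<close> applies the connective
  \<open>u\<close>, a continuous function on the power of the complex plane with index set \<open>{..<n}\<close>.\<close>

datatype (pars_trm: 'c) trm = Var nat | Par 'c | Zero | Plus "'c trm" "'c trm" | Neg "'c trm"

datatype (pars: 'c, preds: 'f) fm =
    Eq "'c trm" "'c trm"
  | Pred 'f "'c trm"
  | Conn "(nat \<Rightarrow> complex) \<Rightarrow> complex" "('c, 'f) fm list"
  | SupAbs nat "('c, 'f) fm"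
  | InfAbs nat "('c, 'f) fm"

fun fv_trm :: "'c trm \<Rightarrow> nat set" where
  "fv_trm (Var i) = {i}"
| "fv_trm (Par c) = {}"
| "fv_trm Zero = {}"
| "fv_trm (Plus s t) = fv_trm s \<union> fv_trm t"
| "fv_trm (Neg t) = fv_trm t"

fun fv :: "('c, 'f) fm \<Rightarrow> nat set" where
  "fv (Eq s t) = fv_trm s \<union> fv_trm t"
| "fv (Pred f t) = fv_trm t"
| "fv (Conn u \<phi>s) = (\<Union>\<phi>\<in>set \<phi>s. fv \<phi>)"
| "fv (SupAbs i \<phi>) = fv \<phi> - {i}"
| "fv (InfAbs i \<phi>) = fv \<phi> - {i}"

fun continuous_connectives :: "('c, 'f) fm \<Rightarrow> bool" where
  "continuous_connectives (Eq s t) = True"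
| "continuous_connectives (Pred f t) = True"
| "continuous_connectives (Conn u \<phi>s) =
     (continuous_map (product_topology (\<lambda>_. euclidean) {..<length \<phi>s}) euclidean u \<and>
      (\<forall>\<phi>\<in>set \<phi>s. continuous_connectives \<phi>))"
| "continuous_connectives (SupAbs i \<phi>) = continuous_connectives \<phi>"
| "continuous_connectives (InfAbs i \<phi>) = continuous_connectives \<phi>"

text \<open>Formulas with predicate symbols in \<open>F\<close> and parameters in \<open>B\<close>.\<close>

definition formulas :: "'f set \<Rightarrow> 'c set \<Rightarrow> ('c, 'f) fm set" where
  "formulas F B = {\<phi>. preds \<phi> \<subseteq> F \<and> pars \<phi> \<subseteq> B \<and> continuous_connectives \<phi>}"

record ('c, 'f) cl_structure =
  univ :: "'c set"
  plus_op :: "'c \<Rightarrow> 'c \<Rightarrow> 'c"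
  neg_op :: "'c \<Rightarrow> 'c"
  zero_op :: 'c
  interp :: "'f \<Rightarrow> 'c \<Rightarrow> complex"

text \<open>As always in continuous logic, predicates are bounded; otherwise the quantifiers would not be
  defined. The metric is discrete, so there is no uniform continuity requirement.\<close>

definition is_structure :: "'f set \<Rightarrow> ('c, 'f) cl_structure \<Rightarrow> bool" where
  "is_structure F N \<longleftrightarrow>
     zero_op N \<in> univ N \<and>
     (\<forall>x\<in>univ N. neg_op N x \<in> univ N) \<and>
     (\<forall>x\<in>univ N. \<forall>y\<in>univ N. plus_op N x y \<in> univ N) \<and>
     (\<forall>f\<in>F. bounded (interp N f ` univ N))"

primrec eval_trm :: "('c, 'f) cl_structure \<Rightarrow> 'c trm \<Rightarrow> (nat \<Rightarrow> 'c) \<Rightarrow> 'c" where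
  "eval_trm N (Var i) v = v i"
| "eval_trm N (Par c) v = c"
| "eval_trm N Zero v = zero_op N"
| "eval_trm N (Plus s t) v = plus_op N (eval_trm N s v) (eval_trm N t v)"
| "eval_trm N (Neg t) v = neg_op N (eval_trm N t v)"

text \<open>Equality is the discrete metric: it has the value \<open>0\<close> when it holds and \<open>1\<close> otherwise.\<close>

primrec eval_fm :: "('c, 'f) cl_structure \<Rightarrow> ('c, 'f) fm \<Rightarrow> (nat \<Rightarrow> 'c) \<Rightarrow> complex" where
  "eval_fm N (Eq s t) v = (if eval_trm N s v = eval_trm N t v then 0 else 1)"
| "eval_fm N (Pred f t) v = interp N f (eval_trm N t v)"
| "eval_fm N (Conn u \<phi>s) v = u (\<lambda>i\<in>{..<length \<phi>s}. (map (eval_fm N) \<phi>s ! i) v)"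
| "eval_fm N (SupAbs i \<phi>) v = complex_of_real (SUP x\<in>univ N. cmod (eval_fm N \<phi> (v(i := x))))"
| "eval_fm N (InfAbs i \<phi>) v = complex_of_real (INF x\<in>univ N. cmod (eval_fm N \<phi> (v(i := x))))"

definition elementary_extension ::
  "'f set \<Rightarrow> ('c, 'f) cl_structure \<Rightarrow> ('c, 'f) cl_structure \<Rightarrow> bool" where
  "elementary_extension F M N \<longleftrightarrow>
     is_structure F M \<and> is_structure F N \<and> univ M \<subseteq> univ N \<and>
     (\<forall>\<phi>\<in>formulas F {}. \<forall>v. range v \<subseteq> univ M \<longrightarrow> eval_fm N \<phi> v = eval_fm M \<phi> v)"

text \<open>A formula \<open>\<phi>\<close> also stands for the condition \<open>\<phi> = 0\<close>; a condition \<open>\<phi> = r\<close> is obtained by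
  composing with the connective \<open>z \<mapsto> z - r\<close>.\<close>

definition satisfiable :: "('c, 'f) cl_structure \<Rightarrow> ('c, 'f) fm set \<Rightarrow> bool" where
  "satisfiable N \<Gamma> \<longleftrightarrow> (\<exists>v. range v \<subseteq> univ N \<and> (\<forall>\<phi>\<in>\<Gamma>. eval_fm N \<phi> v = 0))"

definition saturated :: "'k rel \<Rightarrow> 'f set \<Rightarrow> ('c, 'f) cl_structure \<Rightarrow> bool" where
  "saturated \<kappa> F N \<longleftrightarrow>
     (\<forall>B n \<Gamma>. B \<subseteq> univ N \<and> |B| <o \<kappa> \<and>
        \<Gamma> \<subseteq> {\<phi> \<in> formulas F B. fv \<phi> \<subseteq> {..<n}} \<and>
        (\<forall>\<Gamma>\<^sub>0. finite \<Gamma>\<^sub>0 \<and> \<Gamma>\<^sub>0 \<subseteq> \<Gamma> \<longrightarrow> satisfiable N \<Gamma>\<^sub>0)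
        \<longrightarrow> satisfiable N \<Gamma>)"

definition character_structure ::
  "('a, 'm) monoid_scheme \<Rightarrow> ('a, 'a \<Rightarrow> complex) cl_structure" where
  "character_structure A =
     \<lparr>univ = carrier A, plus_op = mult A, neg_op = m_inv A, zero_op = one A, interp = (\<lambda>f. f)\<rparr>"

section \<open>The space of types\<close>

definition tp :: "'f set \<Rightarrow> ('c, 'f) cl_structure \<Rightarrow> 'c \<Rightarrow> ('f \<Rightarrow> complex)" where
  "tp F N a = (\<lambda>f\<in>F. interp N f a)"

definition types :: "'f set \<Rightarrow> ('c, 'f) cl_structure \<Rightarrow> ('f \<Rightarrow> complex) set" where
  "types F N = tp F N ` univ N"

text \<open>The descriptions below determine the value because it does not depend on the realizations.\<close>

definition type_eval :: "'f set \<Rightarrow> ('c, 'f) cl_structure \<Rightarrow> 'f \<Rightarrow> ('f \<Rightarrow> complex) \<Rightarrow> complex" where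
  "type_eval F N f p = (THE z. \<exists>a\<in>univ N. tp F N a = p \<and> z = interp N f a)"

definition type_plus ::
  "'f set \<Rightarrow> ('c, 'f) cl_structure \<Rightarrow> ('f \<Rightarrow> complex) \<Rightarrow> ('f \<Rightarrow> complex) \<Rightarrow> ('f \<Rightarrow> complex)" where
  "type_plus F N p q =
     (THE r. \<exists>a\<in>univ N. \<exists>b\<in>univ N. tp F N a = p \<and> tp F N b = q \<and> r = tp F N (plus_op N a b))"

definition type_group :: "'f set \<Rightarrow> ('c, 'f) cl_structure \<Rightarrow> ('f \<Rightarrow> complex) monoid" where
  "type_group F N =
     \<lparr>carrier = types F N, mult = type_plus F N, one = tp F N (zero_op N)\<rparr>"

definition type_topology :: "'f set \<Rightarrow> ('c, 'f) cl_structure \<Rightarrow> ('f \<Rightarrow> complex) topology" where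
  "type_topology F N =
     topology_generated_by {{p \<in> types F N. type_eval F N f p \<in> W} |f W. f \<in> F \<and> open W}"

end

theory Submission
  imports Defs
begin

text \<open>By saturation a homomorphism from the group of characters to the circle is a type as soon as it
  is a pointwise limit of evaluations at elements of \<open>A\<close>, and every homomorphism is such a limit:
  weighting an invariant mean on the abelian group \<open>A\<close> with Fejer kernels produces a point at which
  finitely many characters take almost the prescribed values.

  For the universal property, let \<open>K\<close> be the closure of the image of \<open>A\<close> in a compact group. The graph
  of the required map relates a homomorphism \<open>p\<close> to the \<open>k \<in> K\<close> with \<open>\<psi>(k) = p(\<psi> \<circ> g)\<close> for all characters
  \<open>\<psi>\<close> of \<open>K\<close>. It is closed, hence it only remains to separate the points of \<open>K\<close> by characters. Let \<open>\<theta>\<close> be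
  the autocorrelation of a continuous function \<open>g - g(a \<cdot>)\<close> on \<open>K\<close>. The mean of \<open>\<theta>p\<close> is an upper
  semicontinuous affine function of \<open>p\<close> on the compact set of normalised positive definite functions
  of the discrete group \<open>K\<close>, therefore it is maximal at an extreme point, and extreme points are
  multiplicative. A multiplicative \<open>p\<close> with nonzero mean of \<open>\<theta>p\<close> inherits continuity from \<open>\<theta>\<close> and
  satisfies \<open>p(a) \<noteq> 1\<close>.\<close>

section \<open>Invariant means\<close>

text \<open>Separating the points of \<open>K\<close> is usually a matter of Haar measure and
  spectral theory. The only integral used here is a finitely additive mean on all bounded functions
  of the abstract group, which compactness provides for every abelian group. Its defect shapes the
  argument: it does not commute with pointwise limits, so p \<mapsto> M(\<theta>p) need not be
  continuous in the product topology. For positive definite integrands, however, the mean is an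
  infimum of expressions in finitely many values, and this gives exactly the half of continuity that
  a maximum requires. The autocorrelation \<theta> is chosen because the products \<theta>p stay
  positive definite and because \<theta> divided by \<theta>(1) is itself a competitor with positive
  value, so the maximum is not zero. The competition runs over functions on the discrete group;
  continuity is no constraint there and is recovered afterwards.\<close>

definition mean_on :: "'a set \<Rightarrow> (('a \<Rightarrow> real) \<Rightarrow> real) \<Rightarrow> bool" where
  "mean_on C M \<longleftrightarrow>
     (\<forall>f g. bounded (f ` C) \<longrightarrow> bounded (g ` C) \<longrightarrow> M (\<lambda>x. f x + g x) = M f + M g) \<and>
     (\<forall>c f. bounded (f ` C) \<longrightarrow> M (\<lambda>x. c * f x) = c * M f) \<and>
     (\<forall>c f. bounded (f ` C) \<longrightarrow> (\<forall>x\<in>C. f x \<le> c) \<longrightarrow> M f \<le> c)"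

definition invariant_mean :: "('a, 'm) monoid_scheme \<Rightarrow> (('a \<Rightarrow> real) \<Rightarrow> real) \<Rightarrow> bool" where
  "invariant_mean G M \<longleftrightarrow> mean_on (carrier G) M \<and>
     (\<forall>a\<in>carrier G. \<forall>f. bounded (f ` carrier G) \<longrightarrow> M (\<lambda>x. f (a \<otimes>\<^bsub>G\<^esub> x)) = M f)"

section \<open>Bounded functions on a set\<close>

lemma bounded_imageI: "(\<And>x. x \<in> C \<Longrightarrow> norm (f x) \<le> B) \<Longrightarrow> bounded (f ` C)"
  by (auto simp: bounded_iff)

lemma bounded_image_add:
  fixes f g :: "'a \<Rightarrow> 'b::real_normed_vector"
  assumes "bounded (f ` C)" "bounded (g ` C)"
  shows "bounded ((\<lambda>x. f x + g x) ` C)"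
  using bounded_plus_comp[OF assms] .

lemma bounded_image_diff:
  fixes f g :: "'a \<Rightarrow> 'b::real_normed_vector"
  assumes "bounded (f ` C)" "bounded (g ` C)"
  shows "bounded ((\<lambda>x. f x - g x) ` C)"
  using bounded_minus_comp[OF assms] .

lemma bounded_image_mult:
  fixes f g :: "'a \<Rightarrow> 'b::real_normed_algebra"
  assumes "bounded (f ` C)" "bounded (g ` C)"
  shows "bounded ((\<lambda>x. f x * g x) ` C)"
proof -
  obtain a where a: "\<And>x. x \<in> C \<Longrightarrow> norm (f x) \<le> a" using assms(1) by (auto simp: bounded_iff)
  obtain b where b: "\<And>x. x \<in> C \<Longrightarrow> norm (g x) \<le> b" using assms(2) by (auto simp: bounded_iff)
  show ?thesis
  proof (rule bounded_imageI)
    fix x assume x: "x \<in> C"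
    have "norm (f x * g x) \<le> norm (f x) * norm (g x)" by (rule norm_mult_ineq)
    also have "\<dots> \<le> a * b"
      using a[OF x] b[OF x] order_trans[OF norm_ge_zero a[OF x]] by (intro mult_mono) auto
    finally show "norm (f x * g x) \<le> a * b" .
  qed
qed

lemma bounded_image_const: "bounded ((\<lambda>x. c :: 'b::real_normed_vector) ` C)"
  by (rule bounded_imageI[of _ _ "norm c"]) simp

lemma bounded_image_uminus:
  fixes f :: "'a \<Rightarrow> 'b::real_normed_vector"
  assumes "bounded (f ` C)"
  shows "bounded ((\<lambda>x. - f x) ` C)"
  using bounded_image_diff[OF bounded_image_const[of 0] assms] by simp

lemma bounded_image_sum:
  fixes f :: "'i \<Rightarrow> 'a \<Rightarrow> 'b::real_normed_vector"
  assumes "\<And>i. i \<in> I \<Longrightarrow> bounded (f i ` C)"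
  shows "bounded ((\<lambda>x. \<Sum>i\<in>I. f i x) ` C)"
  using assms
  by (induction I rule: infinite_finite_induct) (auto intro: bounded_image_const bounded_image_add)

lemma bounded_image_power:
  fixes f :: "'a \<Rightarrow> 'b::real_normed_algebra_1"
  assumes "bounded (f ` C)"
  shows "bounded ((\<lambda>x. f x ^ n) ` C)"
  by (induction n) (auto intro: bounded_image_const bounded_image_mult assms)

lemma bounded_image_Re: "bounded (f ` C) \<Longrightarrow> bounded ((\<lambda>x. Re (f x)) ` C)"
  by (auto simp: bounded_iff intro: order_trans[OF abs_Re_le_cmod])

lemma bounded_image_Im: "bounded (f ` C) \<Longrightarrow> bounded ((\<lambda>x. Im (f x)) ` C)"
  by (auto simp: bounded_iff intro: order_trans[OF abs_Im_le_cmod])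

lemma bounded_image_compose:
  "bounded (f ` C) \<Longrightarrow> (\<And>x. x \<in> C \<Longrightarrow> s x \<in> C) \<Longrightarrow> bounded ((\<lambda>x. f (s x)) ` C)"
  by (rule bounded_subset[of "f ` C"]) auto

lemma bounded_image_of_real: "bounded (f ` C) \<Longrightarrow> bounded ((\<lambda>x. of_real (f x)::complex) ` C)"
  by (auto simp: bounded_iff)

locale mean =
  fixes C :: "'a set" and M :: "('a \<Rightarrow> real) \<Rightarrow> real"
  assumes mean_on: "mean_on C M"
begin

lemma add: "bounded (f ` C) \<Longrightarrow> bounded (g ` C) \<Longrightarrow> M (\<lambda>x. f x + g x) = M f + M g"
  and scale: "bounded (f ` C) \<Longrightarrow> M (\<lambda>x. c * f x) = c * M f"
  and upper: "bounded (f ` C) \<Longrightarrow> (\<And>x. x \<in> C \<Longrightarrow> f x \<le> c) \<Longrightarrow> M f \<le> c"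
  using mean_on unfolding mean_on_def by blast+

lemma uminus: "bounded (f ` C) \<Longrightarrow> M (\<lambda>x. - f x) = - M f"
  using scale[of f "-1"] by simp

lemma diff: "bounded (f ` C) \<Longrightarrow> bounded (g ` C) \<Longrightarrow> M (\<lambda>x. f x - g x) = M f - M g"
  using add[of f "\<lambda>x. - g x"] uminus[of g] bounded_image_uminus[of g] by simp

lemma lower: "bounded (f ` C) \<Longrightarrow> (\<And>x. x \<in> C \<Longrightarrow> c \<le> f x) \<Longrightarrow> c \<le> M f"
  using upper[of "\<lambda>x. - f x" "-c"] uminus[of f] bounded_image_uminus[of f] by simp

lemma const: "M (\<lambda>x. c) = c"
  using upper[OF bounded_image_const, of c c] lower[OF bounded_image_const, of c c] by simp

lemma mono:
  assumes "bounded (f ` C)" "bounded (g ` C)" "\<And>x. x \<in> C \<Longrightarrow> f x \<le> g x"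
  shows "M f \<le> M g"
  using lower[OF bounded_image_diff[OF assms(2,1)], of 0] assms diff[OF assms(2,1)] by simp

text \<open>The functional acts on all functions of the type. That only the values on
  \<open>C\<close> matter is a consequence of \<open>mono\<close>, whose premise inspects no other
  points.\<close>

lemma cong:
  assumes "bounded (f ` C)" "\<And>x. x \<in> C \<Longrightarrow> f x = g x"
  shows "M f = M g"
proof -
  have "bounded (g ` C)" using assms by (metis image_cong)
  then show ?thesis using mono[of f g] mono[of g f] assms by force
qed

lemma abs_le: "bounded (f ` C) \<Longrightarrow> (\<And>x. x \<in> C \<Longrightarrow> \<bar>f x\<bar> \<le> c) \<Longrightarrow> \<bar>M f\<bar> \<le> c"
  using upper[of f c] lower[of f "-c"] by (fastforce simp: abs_le_iff)

lemma sum: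
  "(\<And>i. i \<in> I \<Longrightarrow> bounded (f i ` C)) \<Longrightarrow> M (\<lambda>x. \<Sum>i\<in>I. f i x) = (\<Sum>i\<in>I. M (f i))"
  by (induction I rule: infinite_finite_induct) (auto simp: const add bounded_image_sum)

lemma exists_le:
  assumes "bounded (f ` C)" "0 < e"
  shows "\<exists>x\<in>C. f x \<le> M f + e"
proof (rule ccontr)
  assume "\<not> ?thesis"
  then have "M f + e \<le> M f" using lower[OF assms(1), of "M f + e"] by fastforce
  with assms(2) show False by simp
qed

end

lemma mean_on_point:
  assumes "x \<in> C"
  shows "mean_on C (\<lambda>f. f x)"
  using assms by (auto simp: mean_on_def)

text \<open>Averaging over the first n powers of t makes a functional almost invariant under t: a
  shift only exchanges the two end terms, each of weight 1/n. What is needed first is that averaging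
  stays within the means; n > 0 keeps the total weight equal to one.\<close>

lemma (in group) mean_on_average:
  assumes "mean_on (carrier G) M" and t: "t \<in> carrier G" and "n > 0"
  shows "mean_on (carrier G) (\<lambda>f. M (\<lambda>x. (\<Sum>i<n. f (t [^] i \<otimes> x)) / real n))"
proof -
  interpret mean "carrier G" M by unfold_locales (rule assms)
  let ?A = "\<lambda>f x. (\<Sum>i<n. f (t [^] (i::nat) \<otimes> x)) / real n"
  have bs: "bounded ((\<lambda>x. \<Sum>i<n. f (t [^] i \<otimes> x)) ` carrier G)"
    if "bounded (f ` carrier G)" for f :: "_ \<Rightarrow> real"
    using t by (intro bounded_image_sum bounded_image_compose[OF that]) auto
  have b: "bounded (?A f ` carrier G)" if "bounded (f ` carrier G)" for f :: "_ \<Rightarrow> real"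
    using bounded_image_mult[OF bs[OF that] bounded_image_const[of "1 / real n"]] by simp
  have 1: "M (?A (\<lambda>x. f x + g x)) = M (?A f) + M (?A g)"
    if "bounded (f ` carrier G)" "bounded (g ` carrier G)" for f g
    using add[OF b[OF that(1)] b[OF that(2)]] by (simp add: sum.distrib add_divide_distrib)
  have 2: "M (?A (\<lambda>x. c * f x)) = c * M (?A f)" if "bounded (f ` carrier G)" for c f
    using scale[OF b[OF that], of c] by (simp add: sum_distrib_left)
  have 3: "M (?A f) \<le> c" if "bounded (f ` carrier G)" "\<forall>x\<in>carrier G. f x \<le> c" for c f
  proof (rule upper[OF b[OF that(1)]])
    fix x assume x: "x \<in> carrier G"
    have "(\<Sum>i<n. f (t [^] i \<otimes> x)) \<le> (\<Sum>i<n. c)"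
      using that(2) t x by (intro sum_mono) auto
    then show "?A f x \<le> c" using \<open>n > 0\<close> by (simp add: field_simps)
  qed
  show ?thesis unfolding mean_on_def using 1 2 3 by blast
qed

text \<open>For closedness of conditions in a function space that are imposed only under a premise
  independent of the varying function, such as boundedness of an argument.\<close>

lemma closed_Collect_premise: "(P \<Longrightarrow> closed {x. Q x}) \<Longrightarrow> closed {x. P \<longrightarrow> Q x}"
  by (cases P) auto

text \<open>Tychonoff's theorem for the product topology on function types. It is applied to
  functionals in the next theorem and to positive definite functions later.\<close>

lemma compact_box_fun:
  fixes S :: "'i \<Rightarrow> 'b::topological_space set"
  assumes "\<And>i. compact (S i)"
  shows "compact {x. \<forall>i. x i \<in> S i}"
proof -
  have "compactin (product_topology (\<lambda>_::'i. euclidean :: 'b topology) UNIV) (PiE UNIV S)"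
    using assms by (simp add: compactin_PiE)
  moreover have "PiE UNIV S = {x. \<forall>i. x i \<in> S i}" by auto
  ultimately show ?thesis by (simp add: euclidean_product_topology)
qed

text \<open>A Markov-Kakutani argument. Invariance is relaxed to the closed conditions
  \<open>D (t, n)\<close>, each of which an average over powers of t satisfies. Averaging once more
  for another element preserves the conditions already reached because the group is commutative, so
  finitely many of them are compatible. Compactness then yields one functional for all t and n, and
  n tends to infinity.\<close>

theorem (in comm_group) ex_invariant_mean: "\<exists>M. invariant_mean G M"
proof -
  let ?C = "carrier G"
  \<comment> \<open>The supremum norm. The value 0 at unbounded functions forces the functionals in
    \<open>X\<close> to vanish there, so that \<open>X\<close> lies in a compact box although they
    are defined on all functions.\<close>
  define b where "b f = (if bounded (f ` ?C) then SUP x\<in>?C. \<bar>f x\<bar> else 0)" for f :: "'a \<Rightarrow> real"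
  have le_b: "\<bar>f x\<bar> \<le> b f" if "bounded (f ` ?C)" "x \<in> ?C" for f x
  proof -
    have "bdd_above ((\<lambda>x. \<bar>f x\<bar>) ` ?C)"
      using that(1) by (auto simp: bounded_iff bdd_above_def)
    then show ?thesis unfolding b_def using that by (auto intro: cSUP_upper2)
  qed
  define X where "X = {M. mean_on ?C M \<and> (\<forall>f. M f \<in> {- b f..b f})}"
  have closed_mean: "closed {M. mean_on ?C M}"
    unfolding mean_on_def
    by (intro closed_Collect_conj closed_Collect_all closed_Collect_premise closed_Collect_eq
        closed_Collect_le continuous_intros continuous_on_product_coordinates)
  have "compact X"
  proof -
    have "X = {M. \<forall>f. M f \<in> {- b f..b f}} \<inter> {M. mean_on ?C M}" by (auto simp: X_def)
    then show ?thesis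
      using compact_Int_closed[OF compact_box_fun[OF compact_Icc] closed_mean, of "\<lambda>f. - b f" b]
      by simp
  qed
  define D where "D = (\<lambda>(t, n::nat). {M. \<forall>f. bounded (f ` ?C) \<longrightarrow>
      \<bar>M (\<lambda>x. f (t \<otimes> x)) - M f\<bar> \<le> 2 * b f / real n})"
  have closed_D: "closed (D p)" for p
    unfolding D_def
    by (cases p; simp, intro closed_Collect_all closed_Collect_premise closed_Collect_le
        continuous_intros continuous_on_product_coordinates)
  have fin: "\<exists>M. mean_on ?C M \<and> M \<in> \<Inter> (D ` P)" if "finite P" "P \<subseteq> ?C \<times> {0<..}" for P
    using that
  proof (induction P rule: finite_induct)
    case empty
    then show ?case using mean_on_point[OF one_closed] by auto
  next
    case (insert p P)
    obtain t n where p: "p = (t, n)" "t \<in> ?C" "n > 0" using insert.prems by (cases p) auto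
    obtain M where M: "mean_on ?C M" "M \<in> \<Inter> (D ` P)" using insert by auto
    interpret mean ?C M by unfold_locales (rule M)
    let ?A = "\<lambda>f x. (\<Sum>i<n. f (t [^] (i::nat) \<otimes> x)) / real n"
    have bA: "bounded (?A f ` ?C)" and nA: "\<And>x. x \<in> ?C \<Longrightarrow> \<bar>?A f x\<bar> \<le> b f"
      if f: "bounded (f ` ?C)" for f
    proof -
      show nA: "\<bar>?A f x\<bar> \<le> b f" if x: "x \<in> ?C" for x
      proof -
        have "\<bar>\<Sum>i<n. f (t [^] i \<otimes> x)\<bar> \<le> (\<Sum>i<n. b f)"
          using le_b[OF f] x p by (intro order_trans[OF sum_abs] sum_mono) auto
        then show ?thesis using p by (simp add: field_simps)
      qed
      then show "bounded (?A f ` ?C)" by (intro bounded_imageI) auto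
    qed
    have bAle: "b (?A f) \<le> b f" if f: "bounded (f ` ?C)" for f
      unfolding b_def[of "?A f"] using bA[OF f] nA[OF f] by (auto intro!: cSUP_least)
    let ?M = "\<lambda>f. M (?A f)"
    have "?M \<in> D (s, k)" if "(s, k) \<in> P" for s k
    proof -
      have s: "s \<in> ?C" "k > 0" using insert.prems that by auto
      have "\<bar>?M (\<lambda>x. f (s \<otimes> x)) - ?M f\<bar> \<le> 2 * b f / real k" if f: "bounded (f ` ?C)" for f
      proof -
        \<comment> \<open>Commutativity enters here: averaging over powers of t commutes with the
          shift by s, and the estimate of \<open>M\<close> for s is applied to the averaged
          function, whose norm is no larger.\<close>
        have "M (\<lambda>x. ?A f (s \<otimes> x)) = ?M (\<lambda>x. f (s \<otimes> x))"
        proof (rule cong)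
          show "bounded ((\<lambda>x. ?A f (s \<otimes> x)) ` ?C)"
            using bounded_image_compose[OF bA[OF f], of "\<lambda>x. s \<otimes> x"] s by simp
          show "?A f (s \<otimes> x) = ?A (\<lambda>x. f (s \<otimes> x)) x" if "x \<in> ?C" for x
            using that s p by (simp add: m_lcomm)
        qed
        moreover have "\<bar>M (\<lambda>x. ?A f (s \<otimes> x)) - M (?A f)\<bar> \<le> 2 * b (?A f) / real k"
          using M(2) \<open>(s, k) \<in> P\<close> bA[OF f] unfolding D_def by blast
        moreover have "2 * b (?A f) / real k \<le> 2 * b f / real k"
          using bAle[OF f] by (intro divide_right_mono) auto
        ultimately show ?thesis by linarith
      qed
      then show ?thesis unfolding D_def prod.case mem_Collect_eq by blast
    qed
    moreover have "?M \<in> D (t, n)"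
    proof -
      have "\<bar>?M (\<lambda>x. f (t \<otimes> x)) - ?M f\<bar> \<le> 2 * b f / real n" if f: "bounded (f ` ?C)" for f
      proof -
        have ft: "bounded ((\<lambda>x. f (t \<otimes> x)) ` ?C)" using p by (intro bounded_image_compose[OF f]) auto
        have "?M (\<lambda>x. f (t \<otimes> x)) - ?M f = M (\<lambda>x. ?A (\<lambda>x. f (t \<otimes> x)) x - ?A f x)"
          using diff[OF bA[OF ft] bA[OF f]] by simp
        moreover have "\<bar>\<dots>\<bar> \<le> 2 * b f / real n"
        proof (rule abs_le)
          show "bounded ((\<lambda>x. ?A (\<lambda>x. f (t \<otimes> x)) x - ?A f x) ` ?C)"
            by (rule bounded_image_diff[OF bA[OF ft] bA[OF f]])
          fix x assume x: "x \<in> ?C"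
          \<comment> \<open>Telescoping: the shift by t turns each summand into the next
            one.\<close>
          have "(\<Sum>i<n. f (t \<otimes> (t [^] i \<otimes> x))) = (\<Sum>i<n. f (t [^] Suc i \<otimes> x))"
            using p x by (intro sum.cong refl arg_cong[of _ _ f]) (simp add: m_assoc m_lcomm)
          then have "?A (\<lambda>x. f (t \<otimes> x)) x - ?A f x
              = (\<Sum>i<n. f (t [^] Suc i \<otimes> x) - f (t [^] i \<otimes> x)) / real n"
            by (simp add: sum_subtractf diff_divide_distrib)
          also have "\<dots> = (f (t [^] n \<otimes> x) - f x) / real n"
            using sum_lessThan_telescope[of "\<lambda>i. f (t [^] i \<otimes> x)" n] x by simp
          finally show "\<bar>?A (\<lambda>x. f (t \<otimes> x)) x - ?A f x\<bar> \<le> 2 * b f / real n"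
            using le_b[OF f, of x] le_b[OF f, of "t [^] n \<otimes> x"] x p
            by (auto simp: abs_divide intro!: divide_right_mono)
        qed
        ultimately show ?thesis by simp
      qed
      then show ?thesis unfolding D_def prod.case mem_Collect_eq by blast
    qed
    ultimately have "?M \<in> \<Inter> (D ` insert p P)" using p by auto
    then show ?case using mean_on_average[OF M(1) p(2,3)] by blast
  qed
  have "X \<inter> \<Inter> (D ` (?C \<times> {0<..})) \<noteq> {}"
  proof (rule compact_imp_fip[OF \<open>compact X\<close>])
    show "closed T" if "T \<in> D ` (?C \<times> {0<..})" for T using that closed_D by auto
    fix Q assume Q: "finite Q" "Q \<subseteq> D ` (?C \<times> {0<..})"
    then obtain P where P: "finite P" "P \<subseteq> ?C \<times> {0<..}" "Q = D ` P" by (meson finite_subset_image)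
    obtain M where M: "mean_on ?C M" "M \<in> \<Inter> (D ` P)" using fin[OF P(1,2)] by blast
    interpret mean ?C M by unfold_locales (rule M)
    \<comment> \<open>The induction controls nothing at unbounded arguments; resetting the values
      there moves the functional into \<open>X\<close>.\<close>
    let ?M = "\<lambda>f. if bounded (f ` ?C) then M f else 0"
    have "mean_on ?C ?M"
      using M(1) unfolding mean_on_def
      by (simp add: bounded_image_add bounded_image_mult bounded_image_const)
    moreover have "?M f \<in> {- b f..b f}" for f
      using abs_le[of f "b f"] le_b[of f] by (auto simp: abs_le_iff b_def)
    moreover have "?M \<in> D p" if pP: "p \<in> P" for p
    proof -
      obtain t n where p: "p = (t, n)" "t \<in> ?C" using P(2) pP by (cases p) auto
      then have "bounded ((\<lambda>x. f (t \<otimes> x)) ` ?C)" if "bounded (f ` ?C)" for f :: "_ \<Rightarrow> real"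
        using p by (intro bounded_image_compose[OF that]) auto
      then show ?thesis using M(2) pP unfolding p D_def by auto
    qed
    ultimately have "?M \<in> X \<inter> \<Inter> Q" unfolding X_def P(3) by blast
    then show "X \<inter> \<Inter> Q \<noteq> {}" by blast
  qed
  then obtain M where M: "M \<in> X" "\<And>p. p \<in> ?C \<times> {0<..} \<Longrightarrow> M \<in> D p" by blast
  have "M (\<lambda>x. f (t \<otimes> x)) = M f" if t: "t \<in> ?C" and f: "bounded (f ` ?C)" for t f
  proof -
    have le: "\<bar>M (\<lambda>x. f (t \<otimes> x)) - M f\<bar> \<le> 2 * b f / real n" if "n > 0" for n
      using M(2)[of "(t, n)"] t f that by (auto simp: D_def)
    have "(\<lambda>n. 2 * b f / real n) \<longlonglongrightarrow> 0" by (rule lim_const_over_n)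
    then have "\<bar>M (\<lambda>x. f (t \<otimes> x)) - M f\<bar> \<le> 0"
      by (rule tendsto_lowerbound) (auto intro!: eventually_sequentiallyI[of 1] le)
    then show ?thesis by simp
  qed
  then show ?thesis using M(1) unfolding X_def invariant_mean_def by blast
qed

locale comm_group_mean = comm_group G for G (structure) +
  fixes M :: "('a \<Rightarrow> real) \<Rightarrow> real"
  assumes invariant_mean: "invariant_mean G M"
begin

sublocale mean "carrier G" M
  using invariant_mean by unfold_locales (simp add: invariant_mean_def)

lemma shift:
  assumes "a \<in> carrier G" "bounded (f ` carrier G)"
  shows "M (\<lambda>x. f (a \<otimes> x)) = M f"
  using invariant_mean assms unfolding invariant_mean_def by blast

end

section \<open>Approximation of homomorphisms by points\<close>

text \<open>Weighting the mean with the product of the Fejer kernels \<open>\<bar>\<Sum>j<k. z\<^sub>i\<^sup>j\<bar>\<^sup>2\<close> concentrates it near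
  the points where all \<open>z\<^sub>i\<close> are close to \<open>1\<close>. The mean of the weight cannot collapse because its
  expansion into elements of \<open>Z\<close> has nonnegative coefficients.\<close>

lemma (in mean) ex_simultaneously_near_1:
  fixes Z :: "('a \<Rightarrow> complex) set" and z :: "'i \<Rightarrow> 'a \<Rightarrow> complex"
  assumes Z_mult: "\<And>u v. u \<in> Z \<Longrightarrow> v \<in> Z \<Longrightarrow> (\<lambda>x. u x * v x) \<in> Z"
    and Z_cnj: "\<And>u. u \<in> Z \<Longrightarrow> (\<lambda>x. cnj (u x)) \<in> Z"
    and Z_one: "(\<lambda>x. 1) \<in> Z"
    and Z_norm: "\<And>u x. u \<in> Z \<Longrightarrow> x \<in> C \<Longrightarrow> cmod (u x) = 1"
    and Z_pos: "\<And>u. u \<in> Z \<Longrightarrow> 0 \<le> M (\<lambda>x. Re (u x))"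
    and I: "finite I" and z: "\<And>i. i \<in> I \<Longrightarrow> z i \<in> Z" and e: "0 < e"
  shows "\<exists>x\<in>C. \<forall>i\<in>I. cmod (z i x - 1) < e"
proof -
  \<comment> \<open>Each kernel times its \<open>(cmod (z i x - 1))\<^sup>2\<close> is at most 4,
    and multiplying by a kernel raises the mean at least k-fold. The final estimate is therefore
    \<open>e\<^sup>2 \<le> 4 * card I / k\<close>, which this choice excludes.\<close>
  obtain k :: nat where k: "4 * card I / e\<^sup>2 < k" using reals_Archimedean2 by blast
  have k0: "0 < real k" using k e by (smt (verit) divide_nonneg_nonneg of_nat_0_le_iff zero_le_power2)
  \<comment> \<open>Nonnegative coefficients are expressed without expansions: every product of h
    with a member of \<open>Z\<close> has a real part of nonnegative mean. This survives sums and
    multiplication by members of \<open>Z\<close>, hence by kernels.\<close>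
  define pos where "pos h \<longleftrightarrow> bounded (h ` C) \<and> (\<forall>u\<in>Z. 0 \<le> M (\<lambda>x. Re (h x * u x)))"
    for h :: "'a \<Rightarrow> complex"
  have bZ: "bounded (u ` C)" if "u \<in> Z" for u
    using Z_norm[OF that] by (intro bounded_imageI[of _ _ 1]) simp
  have pos_Re: "0 \<le> M (\<lambda>x. Re (h x))" if "pos h" for h
    using that Z_one unfolding pos_def by fastforce
  have pos_sum: "pos (\<lambda>x. \<Sum>i\<in>J. h i x)" if "\<And>i. i \<in> J \<Longrightarrow> pos (h i)"
    for J :: "nat set" and h
  proof -
    have "M (\<lambda>x. Re ((\<Sum>i\<in>J. h i x) * u x)) = (\<Sum>i\<in>J. M (\<lambda>x. Re (h i x * u x)))" if "u \<in> Z" for u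
    proof -
      have "bounded ((\<lambda>x. Re (h i x * u x)) ` C)" if "i \<in> J" for i
        using \<open>\<And>i. i \<in> J \<Longrightarrow> pos (h i)\<close>[OF that] bZ[OF \<open>u \<in> Z\<close>]
        by (intro bounded_image_Re bounded_image_mult) (auto simp: pos_def)
      then show ?thesis using sum[of J "\<lambda>i x. Re (h i x * u x)"] by (simp add: sum_distrib_right)
    qed
    then show ?thesis using that unfolding pos_def by (auto intro!: bounded_image_sum sum_nonneg)
  qed
  have pos_mult: "pos (\<lambda>x. h x * u x)" if "pos h" "u \<in> Z" for h u
    using that bZ Z_mult[OF that(2)] unfolding pos_def mult.assoc
    by (auto simp del: times_complex.sel intro!: bounded_image_mult)
  have Z_pow: "(\<lambda>x. u x ^ n) \<in> Z" if "u \<in> Z" for u and n :: nat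
    by (induction n) (auto intro: Z_one Z_mult that)
  define w where "w i p q = (\<lambda>x. z i x ^ p * cnj (z i x) ^ q)" for i and p q :: nat
  have wZ: "w i p q \<in> Z" if "i \<in> I" for i p q
    unfolding w_def by (intro Z_mult Z_pow z[OF that] Z_cnj)
  define q where "q i x = (\<Sum>j<k. z i x ^ j) * cnj (\<Sum>j<k. z i x ^ j)" for i x
  have q_expand: "h x * q i x = (\<Sum>p<k. \<Sum>r<k. h x * w i p r x)" for h x i
  proof -
    have "q i x = (\<Sum>p<k. \<Sum>r<k. w i p r x)"
      unfolding q_def w_def cnj_sum complex_cnj_power by (rule sum_product)
    then show ?thesis by (simp add: sum_distrib_left)
  qed
  have q_real: "q i x = complex_of_real ((cmod (\<Sum>j<k. z i x ^ j))\<^sup>2)" for i x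
    unfolding q_def complex_norm_square ..
  have pos_q: "pos (\<lambda>x. h x * q i x)" if "pos h" "i \<in> I" for h i
    unfolding q_expand by (intro pos_sum pos_mult that wZ)
  \<comment> \<open>Of the k * k terms of the expanded kernel only the k diagonal ones are kept.
    There the powers of \<open>z i x\<close> cancel because its modulus is 1, and the remaining
    terms have nonnegative mean.\<close>
  have M_q: "real k * M (\<lambda>x. Re (h x)) \<le> M (\<lambda>x. Re (h x * q i x))" if h: "pos h" and i: "i \<in> I" for h i
  proof -
    have p: "pos (\<lambda>x. h x * w i p r x)" for p r by (intro pos_mult h wZ i)
    have b: "bounded ((\<lambda>x. Re (h x * w i p r x)) ` C)" for p r
      using p[of p r] by (intro bounded_image_Re) (auto simp: pos_def)
    have "M (\<lambda>x. Re (h x)) = M (\<lambda>x. Re (h x * w i p p x))" for p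
    proof (rule cong)
      show "bounded ((\<lambda>x. Re (h x)) ` C)" using h by (intro bounded_image_Re) (auto simp: pos_def)
      show "Re (h x) = Re (h x * w i p p x)" if "x \<in> C" for x
        using Z_norm[OF z[OF i] that] complex_norm_square[of "z i x"]
        by (simp add: w_def flip: power_mult_distrib)
    qed
    then have "real k * M (\<lambda>x. Re (h x)) = (\<Sum>p<k. M (\<lambda>x. Re (h x * w i p p x)))" by simp
    also have "\<dots> \<le> (\<Sum>p<k. \<Sum>r<k. M (\<lambda>x. Re (h x * w i p r x)))"
      by (intro sum_mono member_le_sum[where f = "\<lambda>r. M (\<lambda>x. Re (h x * w i _ r x))"])
        (auto simp del: times_complex.sel intro: pos_Re[OF p])
    also have "\<dots> = M (\<lambda>x. \<Sum>p<k. \<Sum>r<k. Re (h x * w i p r x))"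
      using b by (simp add: sum bounded_image_sum)
    also have "\<dots> = M (\<lambda>x. Re (h x * q i x))" unfolding q_expand by simp
    finally show ?thesis .
  qed
  define R where "R J x = (\<Prod>j\<in>J. q j x)" for J x
  have R_insert: "R (insert i J) = (\<lambda>x. R J x * q i x)" if "finite J" "i \<notin> J" for i J
    using that by (simp add: R_def fun_eq_iff mult.commute)
  have R_real: "R J x = complex_of_real (Re (R J x))" and R_nonneg: "0 \<le> Re (R J x)" for J x
  proof -
    have R_eq: "R J x = complex_of_real (\<Prod>i\<in>J. (cmod (\<Sum>j<k. z i x ^ j))\<^sup>2)"
      unfolding R_def q_real of_real_prod ..
    show "R J x = complex_of_real (Re (R J x))" unfolding R_eq Re_complex_of_real ..
    show "0 \<le> Re (R J x)" unfolding R_eq Re_complex_of_real by (intro prod_nonneg) simp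
  qed
  have R: "pos (R J) \<and> 0 < M (\<lambda>x. Re (R J x))" if "finite J" "J \<subseteq> I" for J
    using that
  proof (induction J rule: finite_induct)
    case empty
    then show ?case using Z_pos Z_one by (auto simp: pos_def R_def const bounded_image_const)
  next
    case (insert i J)
    then have "0 < real k * M (\<lambda>x. Re (R J x))" using k0 by simp
    with insert show ?case using pos_q[of "R J" i] M_q[of "R J" i] by (auto simp: R_insert)
  qed
  have bR: "bounded ((\<lambda>x. Re (R J x)) ` C)" if "finite J" "J \<subseteq> I" for J
    using R[OF that] by (intro bounded_image_Re) (auto simp: pos_def)
  have bd: "bounded ((\<lambda>x. Re (R I x) * (cmod (z i x - 1))\<^sup>2) ` C)" if "i \<in> I" for i
  proof (intro bounded_image_mult bR I order_refl bounded_imageI[of _ _ 4])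
    fix x assume "x \<in> C"
    then have "cmod (z i x - 1) \<le> 2" using norm_triangle_ineq4[of "z i x" 1] Z_norm[OF z[OF that]] by simp
    then show "norm ((cmod (z i x - 1))\<^sup>2) \<le> 4" using power_mono[of "cmod (z i x - 1)" 2 2] by simp
  qed
  \<comment> \<open>The i-th kernel is split off. By the geometric sum its product with
    \<open>(cmod (z i x - 1))\<^sup>2\<close> is \<open>(cmod (z i x ^ k - 1))\<^sup>2\<close>, at
    most 4, and \<open>M_q\<close> compares the remaining product with the full one.\<close>
  have small: "M (\<lambda>x. Re (R I x) * (cmod (z i x - 1))\<^sup>2) \<le> 4 / k * M (\<lambda>x. Re (R I x))" if i: "i \<in> I" for i
  proof -
    let ?J = "I - {i}"
    have J: "finite ?J" "?J \<subseteq> I" "i \<notin> ?J" "I = insert i ?J" using I i by auto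
    have "M (\<lambda>x. Re (R I x) * (cmod (z i x - 1))\<^sup>2) \<le> M (\<lambda>x. 4 * Re (R ?J x))"
    proof (rule mono[OF bd[OF i]])
      show "bounded ((\<lambda>x. 4 * Re (R ?J x)) ` C)"
        by (intro bounded_image_mult bounded_image_const bR J)
      fix x assume x: "x \<in> C"
      have "(\<Sum>j<k. z i x ^ j) * (z i x - 1) = z i x ^ k - 1"
        by (metis mult.commute power_diff_1_eq)
      then have "cmod (\<Sum>j<k. z i x ^ j) * cmod (z i x - 1) = cmod (z i x ^ k - 1)"
        by (metis norm_mult)
      also have "\<dots> \<le> 2"
        using norm_triangle_ineq4[of "z i x ^ k" 1] Z_norm[OF z[OF i] x] by (simp add: norm_power)
      finally have "(cmod (\<Sum>j<k. z i x ^ j) * cmod (z i x - 1))\<^sup>2 \<le> 2\<^sup>2"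
        by (intro power_mono) auto
      then have "Re (q i x) * (cmod (z i x - 1))\<^sup>2 \<le> 4"
        unfolding q_real by (simp add: power_mult_distrib)
      then have "Re (R ?J x) * (Re (q i x) * (cmod (z i x - 1))\<^sup>2) \<le> Re (R ?J x) * 4"
        by (intro mult_left_mono R_nonneg)
      moreover have "Re (R I x) = Re (R ?J x) * Re (q i x)"
        using R_insert[OF J(1,3)] J(4) by (simp add: q_real)
      ultimately show "Re (R I x) * (cmod (z i x - 1))\<^sup>2 \<le> 4 * Re (R ?J x)" by (simp add: ac_simps)
    qed
    also have "\<dots> = 4 * M (\<lambda>x. Re (R ?J x))" by (intro scale bR J)
    also have "\<dots> \<le> 4 / k * M (\<lambda>x. Re (R I x))"
      using M_q[of "R ?J" i] R[OF J(1,2)] R_insert[OF J(1,3)] J(4) i k0 by (simp add: field_simps)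
    finally show ?thesis .
  qed
  show ?thesis
  proof (rule ccontr)
    assume "\<not> ?thesis"
    \<comment> \<open>A Chebyshev estimate with weight \<open>R I\<close>: if at every point some
      \<open>z i x\<close> is far from 1, the sum over i of the weighted squared distances dominates
      \<open>e\<^sup>2\<close> times the weight, whose mean is positive.\<close>
    then have far: "\<exists>i\<in>I. e \<le> cmod (z i x - 1)" if "x \<in> C" for x using that by force
    have "e\<^sup>2 * M (\<lambda>x. Re (R I x)) = M (\<lambda>x. e\<^sup>2 * Re (R I x))"
      using scale[OF bR[OF I order_refl]] by simp
    also have "\<dots> \<le> M (\<lambda>x. \<Sum>i\<in>I. Re (R I x) * (cmod (z i x - 1))\<^sup>2)"
    proof (rule mono)
      show "bounded ((\<lambda>x. e\<^sup>2 * Re (R I x)) ` C)"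
        by (intro bounded_image_mult bounded_image_const bR I order_refl)
      show "bounded ((\<lambda>x. \<Sum>i\<in>I. Re (R I x) * (cmod (z i x - 1))\<^sup>2) ` C)"
        by (intro bounded_image_sum bd)
      fix x assume "x \<in> C"
      then obtain i where i: "i \<in> I" "e \<le> cmod (z i x - 1)" using far by blast
      then have "e\<^sup>2 \<le> (cmod (z i x - 1))\<^sup>2" using e by (intro power_mono) auto
      then have "Re (R I x) * e\<^sup>2 \<le> Re (R I x) * (cmod (z i x - 1))\<^sup>2"
        by (intro mult_left_mono R_nonneg)
      also have "\<dots> \<le> (\<Sum>i\<in>I. Re (R I x) * (cmod (z i x - 1))\<^sup>2)"
        using i(1) I R_nonneg
        by (intro member_le_sum[where f = "\<lambda>i. Re (R I x) * (cmod (z i x - 1))\<^sup>2"]) auto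
      finally show "e\<^sup>2 * Re (R I x) \<le> (\<Sum>i\<in>I. Re (R I x) * (cmod (z i x - 1))\<^sup>2)"
        by (simp add: mult.commute)
    qed
    also have "\<dots> = (\<Sum>i\<in>I. M (\<lambda>x. Re (R I x) * (cmod (z i x - 1))\<^sup>2))" by (intro sum bd)
    also have "\<dots> \<le> (\<Sum>i\<in>I. 4 / k * M (\<lambda>x. Re (R I x)))" by (intro sum_mono small)
    also have "\<dots> = 4 * card I / k * M (\<lambda>x. Re (R I x))" by simp
    finally have "e\<^sup>2 \<le> 4 * card I / k"
      using R[OF I order_refl] by (meson mult_le_cancel_right_pos)
    moreover have "4 * card I / k < e\<^sup>2" using k k0 e by (simp add: field_simps)
    ultimately show False by simp
  qed
qed

text \<open>Twisting by \<open>cnj (\<phi> f)\<close> moves the target value to 1, and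
  multiplicativity of \<phi> keeps the twisted functions closed under products and conjugation.
  Their means are nonnegative: a character that is constantly 1 forces \<open>\<phi> f = 1\<close>
  and has mean 1, while any other character has mean 0 by invariance.\<close>

lemma (in comm_group) characters_approximate:
  fixes \<phi> :: "('a \<Rightarrow> complex) \<Rightarrow> complex" and F :: "('a \<Rightarrow> complex) set"
  assumes F_norm: "\<And>f x. f \<in> F \<Longrightarrow> x \<in> carrier G \<Longrightarrow> cmod (f x) = 1"
    and F_hom: "\<And>f x y. f \<in> F \<Longrightarrow> x \<in> carrier G \<Longrightarrow> y \<in> carrier G \<Longrightarrow> f (x \<otimes> y) = f x * f y"
    and F_one: "restrict (\<lambda>x. 1) (carrier G) \<in> F"
    and F_mult: "\<And>f g. f \<in> F \<Longrightarrow> g \<in> F \<Longrightarrow> restrict (\<lambda>x. f x * g x) (carrier G) \<in> F"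
    and F_cnj: "\<And>f. f \<in> F \<Longrightarrow> restrict (\<lambda>x. cnj (f x)) (carrier G) \<in> F"
    and \<phi>_norm: "\<And>f. f \<in> F \<Longrightarrow> cmod (\<phi> f) = 1"
    and \<phi>_mult: "\<And>f g. f \<in> F \<Longrightarrow> g \<in> F \<Longrightarrow> \<phi> (restrict (\<lambda>x. f x * g x) (carrier G)) = \<phi> f * \<phi> g"
    and I: "finite I" "I \<subseteq> F" and e: "0 < e"
  shows "\<exists>x\<in>carrier G. \<forall>f\<in>I. cmod (f x - \<phi> f) < e"
proof -
  obtain M where M: "invariant_mean G M" using ex_invariant_mean by blast
  interpret comm_group_mean G M by unfold_locales (rule M)
  \<comment> \<open>Only the values on the carrier are prescribed, so that the unrestricted products
    demanded by the previous lemma belong to \<open>Z\<close> as well.\<close>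
  define Z where "Z = {u. \<exists>f\<in>F. \<forall>x\<in>carrier G. u x = cnj (\<phi> f) * f x}"
  have unit: "w * cnj w = 1" if "cmod w = 1" for w using that complex_norm_square[of w] by simp
  have \<phi>_one: "\<phi> (restrict (\<lambda>x. 1) (carrier G)) = 1"
  proof -
    let ?o = "restrict (\<lambda>x. 1) (carrier G) :: 'a \<Rightarrow> complex"
    have "\<phi> ?o * \<phi> ?o = \<phi> ?o"
      using \<phi>_mult[OF F_one F_one] by (metis (no_types, lifting) mult_1 restrict_apply' restrict_ext)
    then show ?thesis using \<phi>_norm[OF F_one] by (metis mult_cancel_left1 norm_zero zero_neq_one)
  qed
  have \<phi>_cnj: "\<phi> (restrict (\<lambda>x. cnj (f x)) (carrier G)) = cnj (\<phi> f)" if f: "f \<in> F" for f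
  proof -
    have "restrict (\<lambda>x. f x * restrict (\<lambda>x. cnj (f x)) (carrier G) x) (carrier G)
        = restrict (\<lambda>x. 1) (carrier G)"
      using unit F_norm[OF f] by (auto simp: restrict_def fun_eq_iff)
    then have "\<phi> f * \<phi> (restrict (\<lambda>x. cnj (f x)) (carrier G)) = 1"
      using \<phi>_mult[OF f F_cnj[OF f]] \<phi>_one by simp
    then have "cnj (\<phi> f) * \<phi> f * \<phi> (restrict (\<lambda>x. cnj (f x)) (carrier G)) = cnj (\<phi> f)"
      by (simp add: mult.assoc)
    then show ?thesis using unit[OF \<phi>_norm[OF f]] by (simp add: mult.commute)
  qed
  have "\<exists>x\<in>carrier G. \<forall>f\<in>I. cmod ((\<lambda>f x. cnj (\<phi> f) * f x) f x - 1) < e"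
  proof (rule ex_simultaneously_near_1[of Z])
    fix u v assume "u \<in> Z" "v \<in> Z"
    then obtain f g where fg: "f \<in> F" "g \<in> F"
      "\<forall>x\<in>carrier G. u x = cnj (\<phi> f) * f x" "\<forall>x\<in>carrier G. v x = cnj (\<phi> g) * g x"
      by (auto simp: Z_def)
    then show "(\<lambda>x. u x * v x) \<in> Z" unfolding Z_def
      by (auto intro!: bexI[OF _ F_mult[OF fg(1,2)]] simp: \<phi>_mult)
  next
    fix u assume "u \<in> Z"
    then obtain f where f: "f \<in> F" "\<forall>x\<in>carrier G. u x = cnj (\<phi> f) * f x" by (auto simp: Z_def)
    then show "(\<lambda>x. cnj (u x)) \<in> Z" unfolding Z_def
      by (auto intro!: bexI[OF _ F_cnj[OF f(1)]] simp: \<phi>_cnj)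
    show "cmod (u x) = 1" if "x \<in> carrier G" for x
      using f that by (simp add: norm_mult F_norm \<phi>_norm)
    have bf: "bounded ((\<lambda>x. Re (c * f x)) ` carrier G)" for c
      using F_norm[OF f(1)]
      by (intro bounded_image_Re bounded_image_mult bounded_image_const bounded_imageI[of _ f 1]) simp
    have "bounded ((\<lambda>x. Re (cnj (\<phi> f) * f x)) ` carrier G)" by (rule bf)
    then have Mu: "M (\<lambda>x. Re (u x)) = M (\<lambda>x. Re (cnj (\<phi> f) * f x))"
      using f(2) by (intro cong[symmetric]) auto
    show "0 \<le> M (\<lambda>x. Re (u x))"
    proof (cases "\<forall>x\<in>carrier G. f x = 1")
      case True
      have "restrict (\<lambda>x. f x * restrict (\<lambda>x. 1) (carrier G) x) (carrier G) = restrict (\<lambda>x. 1) (carrier G)"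
        using True by auto
      then have "\<phi> f = 1" using \<phi>_mult[OF f(1) F_one] \<phi>_one by simp
      then have "M (\<lambda>x. Re (u x)) = M (\<lambda>x. 1)"
        unfolding Mu using True by (intro cong bf) auto
      then show ?thesis by (simp add: const)
    next
      case False
      then obtain a where a: "a \<in> carrier G" "f a \<noteq> 1" by blast
      \<comment> \<open>Because \<open>M\<close> is real, the complex scalar is carried as a
        parameter. Shifting by a gives \<open>m (c * f a) = m c\<close>, so m vanishes at every
        multiple of \<open>f a - 1\<close>, that is, everywhere.\<close>
      define m where "m c = M (\<lambda>x. Re (c * f x))" for c
      have m_shift: "m (c * f a) = m c" for c
      proof -
        have "m c = M (\<lambda>x. Re (c * f (a \<otimes> x)))"
          unfolding m_def by (rule shift[OF a(1) bf, symmetric])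
        also have "\<dots> = M (\<lambda>x. Re (c * f a * f x))"
          using a(1) f(1) by (intro cong[symmetric] bf) (simp add: F_hom mult.assoc)
        finally show ?thesis by (simp add: m_def)
      qed
      have m_diff: "m (c - d) = m c - m d" for c d
        unfolding m_def using diff[OF bf[of c] bf[of d]] by (simp add: left_diff_distrib)
      have "m (c * (f a - 1)) = 0" for c
        using m_diff[of "c * f a" c] m_shift[of c] by (simp add: algebra_simps)
      from this[of "cnj (\<phi> f) / (f a - 1)"] have "m (cnj (\<phi> f)) = 0" using a(2) by simp
      then show ?thesis by (simp add: Mu m_def)
    qed
  next
    show "(\<lambda>x. 1) \<in> Z" unfolding Z_def using \<phi>_one by (auto intro!: bexI[OF _ F_one])
  next
    fix f assume "f \<in> I"
    then show "(\<lambda>x. cnj (\<phi> f) * f x) \<in> Z" using I unfolding Z_def by auto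
  qed (use I e in auto)
  then obtain x where x: "x \<in> carrier G" "\<And>f. f \<in> I \<Longrightarrow> cmod (cnj (\<phi> f) * f x - 1) < e" by auto
  have "cmod (f x - \<phi> f) < e" if f: "f \<in> I" for f
  proof -
    have "f x - \<phi> f = \<phi> f * (cnj (\<phi> f) * f x - 1)"
      using unit[OF \<phi>_norm, of f] I(2) f by (auto simp: right_diff_distrib simp flip: mult.assoc)
    then show ?thesis using x(2)[OF f] \<phi>_norm[of f] I(2) f by (simp add: norm_mult subset_iff)
  qed
  with x(1) show ?thesis by blast
qed

section \<open>Extreme maximisers\<close>

text \<open>Upper semicontinuity is enough: the superlevel sets belonging to finitely many points
  all contain the best of these points, and compactness extends this to arbitrarily many.\<close>

lemma ex_maximiser_compact:
  fixes P :: "'b::topological_space set" and L :: "'b \<Rightarrow> real"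
  assumes "compact P" "P \<noteq> {}" and usc: "\<And>c. closed {x \<in> P. c \<le> L x}"
  shows "\<exists>x\<in>P. \<forall>y\<in>P. L y \<le> L x"
proof -
  have "P \<inter> \<Inter> ((\<lambda>y. {x \<in> P. L y \<le> L x}) ` P) \<noteq> {}"
  proof (rule compact_imp_fip[OF assms(1)])
    show "closed T" if "T \<in> (\<lambda>y. {x \<in> P. L y \<le> L x}) ` P" for T using that usc by auto
    fix Q assume "finite Q" "Q \<subseteq> (\<lambda>y. {x \<in> P. L y \<le> L x}) ` P"
    then obtain A where A: "finite A" "A \<subseteq> P" "Q = (\<lambda>y. {x \<in> P. L y \<le> L x}) ` A"
      by (meson finite_subset_image)
    show "P \<inter> \<Inter> Q \<noteq> {}"
    proof (cases "A = {}")
      case False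
      then have "Max (L ` A) \<in> L ` A" using A(1) by (intro Max_in) auto
      then obtain x where x: "x \<in> A" "Max (L ` A) = L x" by blast
      have "L y \<le> L x" if "y \<in> A" for y
        unfolding x(2)[symmetric] using that A(1) by (intro Max_ge) auto
      with x(1) show ?thesis using A by auto
    qed (use A assms in auto)
  qed
  then show ?thesis by blast
qed

definition convex_comb :: "real \<Rightarrow> ('i \<Rightarrow> complex) \<Rightarrow> ('i \<Rightarrow> complex) \<Rightarrow> 'i \<Rightarrow> complex" where
  "convex_comb t p q = (\<lambda>i. complex_of_real t * p i + (1 - complex_of_real t) * q i)"

text \<open>The closed extreme subsets of Krein-Milman theory; the empty set is excluded so that a
  minimal one still contains a point.\<close>

definition face :: "('i \<Rightarrow> complex) set \<Rightarrow> ('i \<Rightarrow> complex) set \<Rightarrow> bool" where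
  "face P X \<longleftrightarrow> X \<subseteq> P \<and> closed X \<and> X \<noteq> {} \<and>
     (\<forall>p\<in>P. \<forall>q\<in>P. \<forall>t::real. 0 < t \<longrightarrow> t < 1 \<longrightarrow> convex_comb t p q \<in> X \<longrightarrow> p \<in> X \<and> q \<in> X)"

lemma faceD:
  assumes "face P X"
  shows "X \<subseteq> P" "closed X" "X \<noteq> {}"
    and "p \<in> P \<Longrightarrow> q \<in> P \<Longrightarrow> 0 < t \<Longrightarrow> t < 1 \<Longrightarrow> convex_comb t p q \<in> X \<Longrightarrow> p \<in> X \<and> q \<in> X"
  using assms unfolding face_def by simp_all

lemma faceI:
  assumes "X \<subseteq> P" "closed X" "X \<noteq> {}"
    and "\<And>p q t. p \<in> P \<Longrightarrow> q \<in> P \<Longrightarrow> 0 < t \<Longrightarrow> t < 1 \<Longrightarrow> convex_comb t p q \<in> X \<Longrightarrow> p \<in> X \<and> q \<in> X"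
  shows "face P X"
  using assms unfolding face_def by simp

lemma convex_combination_eq_max:
  fixes a b v t :: real
  assumes "0 < t" "t < 1" "a \<le> v" "b \<le> v" "v \<le> t * a + (1 - t) * b"
  shows "v \<le> a" "v \<le> b"
proof -
  have "t * (v - a) \<ge> 0" "(1 - t) * (v - b) \<ge> 0" using assms by auto
  moreover have "t * (v - a) + (1 - t) * (v - b) \<le> 0" using assms(5) by (simp add: algebra_simps)
  ultimately have "t * (v - a) \<le> 0" "(1 - t) * (v - b) \<le> 0" by linarith+
  then show "v \<le> a" "v \<le> b" using assms by (auto simp: mult_le_0_iff)
qed

text \<open>If a convex combination with weights strictly between 0 and 1 attains the maximum, both
  end points do. Affinity is asked for on all of \<open>P\<close> since p and q are known to lie in
  \<open>X\<close> only after the face property has been used.\<close>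

lemma face_maximisers:
  assumes X: "face P X" and "compact P" and usc: "\<And>c. closed {x \<in> X. c \<le> L x}"
    and affine: "\<And>p q t. p \<in> P \<Longrightarrow> q \<in> P \<Longrightarrow> 0 < t \<Longrightarrow> t < 1 \<Longrightarrow>
      L (convex_comb t p q) = t * L p + (1 - t) * L q"
  shows "face P {x \<in> X. \<forall>y\<in>X. L y \<le> L x}" (is "face P ?Y")
proof -
  have "compact X" using X \<open>compact P\<close> unfolding face_def
    by (metis compact_Int_closed inf.absorb_iff2)
  then obtain x where x: "x \<in> X" "\<forall>y\<in>X. L y \<le> L x"
    using ex_maximiser_compact[OF _ _ usc] X unfolding face_def by blast
  then have Y: "?Y = {y \<in> X. L x \<le> L y}" by force
  have "p \<in> ?Y \<and> q \<in> ?Y"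
    if "p \<in> P" "q \<in> P" "0 < t" "t < 1" "convex_comb t p q \<in> ?Y"
    for p q and t :: real
  proof -
    have pq: "p \<in> X" "q \<in> X" using X that unfolding face_def by blast+
    have "L x \<le> t * L p + (1 - t) * L q"
      using that(5) affine[OF that(1-4)] unfolding Y by simp
    then show ?thesis
      using convex_combination_eq_max[OF that(3,4), of "L p" "L x" "L q"] x(2) pq unfolding Y by auto
  qed
  moreover have "closed ?Y" unfolding Y by (rule usc)
  ultimately show ?thesis using X x unfolding face_def by blast
qed

text \<open>Krein-Milman: a minimal closed face is a single point, because the maximisers of some
  real coordinate functional would otherwise form a smaller face. A face of \<open>P\<close> with
  one point is an extreme point of \<open>P\<close> itself, not merely of \<open>X0\<close>.\<close>

lemma face_contains_extreme_point:
  assumes X0: "face P X0" and "compact P"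
  shows "\<exists>x\<in>X0. \<forall>p\<in>P. \<forall>q\<in>P. \<forall>t::real. 0 < t \<longrightarrow> t < 1 \<longrightarrow> x = convex_comb t p q \<longrightarrow> p = x"
proof -
  \<comment> \<open>Complements turn minimal faces into the maximal sets that Zorn's lemma
    supplies.\<close>
  let ?A = "{A. face P (- A) \<and> - A \<subseteq> X0}"
  have "\<exists>A\<in>?A. \<forall>B\<in>?A. A \<subseteq> B \<longrightarrow> B = A"
  proof (rule subset_Zorn_nonempty)
    show "?A \<noteq> {}" using X0 by (auto intro!: exI[of _ "- X0"])
    fix \<C> assume \<C>: "\<C> \<noteq> {}" "subset.chain ?A \<C>"
    then have sub: "\<C> \<subseteq> ?A" by (auto simp: subset.chain_def)
    have compl: "- \<Union> \<C> = \<Inter> (uminus ` \<C>)" by auto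
    have "P \<inter> \<Inter> (uminus ` \<C>) \<noteq> {}"
    proof (rule compact_imp_fip[OF \<open>compact P\<close>])
      show "closed T" if "T \<in> uminus ` \<C>" for T using that sub by (auto simp: face_def)
      fix Q assume "finite Q" "Q \<subseteq> uminus ` \<C>"
      then obtain \<D> where \<D>: "finite \<D>" "\<D> \<subseteq> \<C>" "Q = uminus ` \<D>" by (meson finite_subset_image)
      show "P \<inter> \<Inter> Q \<noteq> {}"
      proof (cases "\<D> = {}")
        case True
        then show ?thesis using X0 \<D> by (auto simp: face_def)
      next
        case False
        have "subset.chain ?A \<D>" using \<C>(2) \<D>(2) unfolding subset.chain_def by blast
        then have "\<Union> \<D> \<in> \<D>" by (rule Union_in_chain[OF \<D>(1) False])
        then have "face P (- \<Union> \<D>)" using \<D>(2) sub by blast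
        moreover have "\<Inter> Q = - \<Union> \<D>" unfolding \<D>(3) by auto
        ultimately show ?thesis using faceD(1,3)[of P "- \<Union> \<D>"] by auto
      qed
    qed
    then have ne: "- \<Union> \<C> \<noteq> {}" unfolding compl by blast
    have f: "face P (- A)" "- A \<subseteq> X0" if "A \<in> \<C>" for A using sub that by auto
    have "closed (- \<Union> \<C>)" unfolding compl using faceD(2)[OF f(1)] by (intro closed_Inter) blast
    moreover have "- \<Union> \<C> \<subseteq> P" using faceD(1)[OF f(1)] \<C>(1) by blast
    moreover have "p \<in> - \<Union> \<C> \<and> q \<in> - \<Union> \<C>"
      if "p \<in> P" "q \<in> P" "0 < t" "t < 1" "convex_comb t p q \<in> - \<Union> \<C>" for p q and t :: real
    proof -
      have "p \<in> - A \<and> q \<in> - A" if "A \<in> \<C>" for A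
      proof -
        have "convex_comb t p q \<in> - A"
          using that \<open>convex_comb t p q \<in> - \<Union> \<C>\<close> by blast
        with faceD(4)[OF f(1)[OF that]] show ?thesis
          using \<open>p \<in> P\<close> \<open>q \<in> P\<close> \<open>0 < t\<close> \<open>t < 1\<close> by blast
      qed
      then show ?thesis by blast
    qed
    ultimately have "face P (- \<Union> \<C>)" using ne by (intro faceI)
    moreover have "- \<Union> \<C> \<subseteq> X0" using f(2) \<C>(1) by blast
    ultimately show "\<Union> \<C> \<in> ?A" by blast
  qed
  then obtain A where A: "face P (- A)" "- A \<subseteq> X0" and "\<forall>B\<in>?A. A \<subseteq> B \<longrightarrow> B = A" by blast
  define X where "X = - A"
  have X: "face P X" "X \<subseteq> X0" using A by (auto simp: X_def)
  have minimal: "Y = X" if "face P Y" "Y \<subseteq> X" for Y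
  proof -
    have "- Y \<in> ?A" "A \<subseteq> - Y" using that X by (auto simp: X_def)
    then have "- Y = A" using \<open>\<forall>B\<in>?A. A \<subseteq> B \<longrightarrow> B = A\<close> by blast
    then show ?thesis by (auto simp: X_def)
  qed
  \<comment> \<open>The factor c selects the coordinate functional: 1 gives the real part and
    \<open>- \<i>\<close> the imaginary part.\<close>
  have const: "Re (c * x i) = Re (c * y i)" if "x \<in> X" "y \<in> X" for x y c i
  proof -
    let ?Y = "{x \<in> X. \<forall>y\<in>X. Re (c * y i) \<le> Re (c * x i)}"
    have "face P ?Y"
    proof (rule face_maximisers[OF X(1) \<open>compact P\<close>])
      fix d
      have "closed {x. d \<le> Re (c * x i)}"
        by (intro closed_Collect_le continuous_intros continuous_on_product_coordinates)
      then show "closed {x \<in> X. d \<le> Re (c * x i)}"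
        using closed_Int[OF faceD(2)[OF X(1)]] by (simp add: Collect_conj_eq)
    qed (simp add: convex_comb_def algebra_simps)
    then have "?Y = X" by (rule minimal) auto
    then show ?thesis using that by (metis (mono_tags, lifting) antisym mem_Collect_eq)
  qed
  have single: "x = y" if "x \<in> X" "y \<in> X" for x y
    using const[OF that, of 1] const[OF that, of "- \<i>"] by (auto simp: complex_eq_iff fun_eq_iff)
  obtain x where "x \<in> X" using X(1) by (auto simp: face_def)
  moreover have "p = x" if "p \<in> P" "q \<in> P" "0 < t" "t < 1" "x = convex_comb t p q"
    for p q and t :: real
    using faceD(4)[OF X(1) that(1-4)] that(5) \<open>x \<in> X\<close> single by blast
  ultimately show ?thesis using X(2) by blast
qed

text \<open>Bauer's maximum principle for affine upper semicontinuous functions; \<open>P\<close>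
  counts as a face of itself.\<close>

lemma ex_extreme_maximiser:
  fixes P :: "('i \<Rightarrow> complex) set"
  assumes "compact P" "closed P" "P \<noteq> {}" and usc: "\<And>c. closed {x \<in> P. c \<le> L x}"
    and affine: "\<And>p q t. p \<in> P \<Longrightarrow> q \<in> P \<Longrightarrow> 0 < t \<Longrightarrow> t < 1 \<Longrightarrow>
      L (convex_comb t p q) = t * L p + (1 - t) * L q"
  shows "\<exists>x\<in>P. (\<forall>y\<in>P. L y \<le> L x) \<and>
    (\<forall>p\<in>P. \<forall>q\<in>P. \<forall>t::real. 0 < t \<longrightarrow> t < 1 \<longrightarrow> x = convex_comb t p q \<longrightarrow> p = x)"
proof -
  have "face P P" using assms by (auto simp: face_def)
  then have "face P {x \<in> P. \<forall>y\<in>P. L y \<le> L x}" using assms by (intro face_maximisers) auto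
  from face_contains_extreme_point[OF this \<open>compact P\<close>] show ?thesis by blast
qed

section \<open>Positive definite functions\<close>

text \<open>The second clause looks at real parts only, so Hermitian symmetry is a clause of its
  own; together they make the quadratic form real and nonnegative. The points \<open>s i\<close> may
  repeat.\<close>

definition positive_definite :: "('a, 'm) monoid_scheme \<Rightarrow> ('a \<Rightarrow> complex) \<Rightarrow> bool" where
  "positive_definite G p \<longleftrightarrow> (\<forall>u\<in>carrier G. p (inv\<^bsub>G\<^esub> u) = cnj (p u)) \<and>
     (\<forall>n s c. (\<forall>i<n. s i \<in> carrier G) \<longrightarrow>
        0 \<le> Re (\<Sum>i<n::nat. \<Sum>j<n. c i * cnj (c j) * p (s i \<otimes>\<^bsub>G\<^esub> inv\<^bsub>G\<^esub> s j)))"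

lemma positive_definiteD:
  assumes "positive_definite G p" "\<And>i. i < n \<Longrightarrow> s i \<in> carrier G"
  shows "0 \<le> Re (\<Sum>i<n::nat. \<Sum>j<n. c i * cnj (c j) * p (s i \<otimes>\<^bsub>G\<^esub> inv\<^bsub>G\<^esub> s j))"
  using assms unfolding positive_definite_def by blast

lemma positive_definite_cnj:
  "positive_definite G p \<Longrightarrow> u \<in> carrier G \<Longrightarrow> p (inv\<^bsub>G\<^esub> u) = cnj (p u)"
  unfolding positive_definite_def by blast

text \<open>Two points suffice, u and the identity, with coefficients 1 and -w where w is the phase
  of \<open>p u\<close>: the real part of the quadratic form is then twice the difference of the two
  sides.\<close>

lemma (in group) positive_definite_bound:
  assumes p: "positive_definite G p" and u: "u \<in> carrier G"
  shows "cmod (p u) \<le> Re (p \<one>)"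
proof (cases "p u = 0")
  case True
  then show ?thesis using positive_definiteD[OF p, of 1 "\<lambda>_. \<one>" "\<lambda>_. 1"] by simp
next
  case False
  define w where "w = sgn (p u)"
  have w: "w * cnj w = 1" using False complex_norm_square[of w] by (simp add: w_def norm_sgn)
  have wu: "cnj w * p u = cmod (p u)"
  proof -
    have "p u = cmod (p u) * w" using False by (simp add: w_def sgn_eq)
    then have "cnj w * p u = cmod (p u) * (w * cnj w)" by (metis mult.assoc mult.commute)
    then show ?thesis using w by simp
  qed
  have wu': "w * cnj (p u) = cmod (p u)"
    using arg_cong[OF wu, of cnj] by (simp add: mult.commute)
  have "0 \<le> Re (\<Sum>i<2::nat. \<Sum>j<2::nat. (if i = 0 then 1 else - w) * cnj (if j = 0 then 1 else - w)
      * p ((if i = 0 then u else \<one>) \<otimes> inv (if j = 0 then u else \<one>)))"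
    using u by (intro positive_definiteD[OF p]) auto
  also have "(\<Sum>i<2::nat. \<Sum>j<2::nat. (if i = 0 then 1 else - w) * cnj (if j = 0 then 1 else - w)
      * p ((if i = 0 then u else \<one>) \<otimes> inv (if j = 0 then u else \<one>)))
      = p \<one> - cnj w * p u - w * cnj (p u) + (w * cnj w) * p \<one>"
    using u by (simp add: numeral_2_eq_2 positive_definite_cnj[OF p])
  also have "Re \<dots> = 2 * Re (p \<one>) - 2 * cmod (p u)" unfolding w wu wu' by simp
  finally show ?thesis by simp
qed

lemma positive_definite_const: "positive_definite G (\<lambda>_. 1)"
proof -
  have "0 \<le> Re (\<Sum>i<n. \<Sum>j<n. c i * cnj (c j))" for n :: nat and c
  proof -
    have "(\<Sum>i<n. \<Sum>j<n. c i * cnj (c j)) = (\<Sum>i<n. c i) * cnj (\<Sum>i<n. c i)"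
      by (simp add: sum_product)
    then show ?thesis unfolding complex_norm_square[symmetric] by simp
  qed
  then show ?thesis by (simp add: positive_definite_def)
qed

lemma positive_definite_cong:
  assumes "positive_definite G p" "group G" "\<And>u. u \<in> carrier G \<Longrightarrow> q u = p u"
  shows "positive_definite G q"
proof -
  interpret group G by fact
  have "(\<Sum>i<n. \<Sum>j<n. c i * cnj (c j) * q (s i \<otimes>\<^bsub>G\<^esub> inv\<^bsub>G\<^esub> s j))
     = (\<Sum>i<n. \<Sum>j<n. c i * cnj (c j) * p (s i \<otimes>\<^bsub>G\<^esub> inv\<^bsub>G\<^esub> s j))"
    if "\<forall>i<n. s i \<in> carrier G" for n :: nat and s c
    using that by (intro sum.cong refl) (simp add: assms(3))
  then show ?thesis using assms(1,3) unfolding positive_definite_def by simp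
qed

lemma positive_definite_scale:
  assumes "positive_definite G p" "0 \<le> r"
  shows "positive_definite G (\<lambda>u. complex_of_real r * p u)"
proof -
  have "(\<Sum>i<n. \<Sum>j<n. c i * cnj (c j) * (complex_of_real r * p (s i \<otimes>\<^bsub>G\<^esub> inv\<^bsub>G\<^esub> s j)))
     = complex_of_real r * (\<Sum>i<n. \<Sum>j<n. c i * cnj (c j) * p (s i \<otimes>\<^bsub>G\<^esub> inv\<^bsub>G\<^esub> s j))" for n :: nat and s c
    by (simp add: sum_distrib_left mult.left_commute)
  then show ?thesis using assms unfolding positive_definite_def by simp
qed

lemma positive_definite_add:
  assumes "positive_definite G p" "positive_definite G q"
  shows "positive_definite G (\<lambda>u. p u + q u)"
proof -
  have "(\<Sum>i<n. \<Sum>j<n. c i * cnj (c j) * (p (s i \<otimes>\<^bsub>G\<^esub> inv\<^bsub>G\<^esub> s j) + q (s i \<otimes>\<^bsub>G\<^esub> inv\<^bsub>G\<^esub> s j)))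
     = (\<Sum>i<n. \<Sum>j<n. c i * cnj (c j) * p (s i \<otimes>\<^bsub>G\<^esub> inv\<^bsub>G\<^esub> s j)) +
       (\<Sum>i<n. \<Sum>j<n. c i * cnj (c j) * q (s i \<otimes>\<^bsub>G\<^esub> inv\<^bsub>G\<^esub> s j))" for n :: nat and s c
    by (simp add: sum.distrib distrib_left)
  then show ?thesis using assms unfolding positive_definite_def by (auto intro: add_nonneg_nonneg)
qed

lemma sum_lessThan_add:
  fixes f :: "nat \<Rightarrow> 'b::comm_monoid_add"
  shows "(\<Sum>i<m + n. f i) = (\<Sum>i<m. f i) + (\<Sum>i<n. f (m + i))"
  by (induction n) (simp_all add: add.assoc)

text \<open>The quadratic form of this function for the points \<open>s i\<close> is that of p for
  twice as many points: \<open>s i\<close> with coefficient \<open>c i\<close>, and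
  \<open>s i \<otimes> inv a\<close> with coefficient \<open>cnj w * c i\<close>. Commutativity lets
  the inner factors cancel.\<close>

lemma (in comm_group) positive_definite_translates:
  assumes p: "positive_definite G p" and a: "a \<in> carrier G" and w: "cmod w = 1"
  shows "positive_definite G (\<lambda>u. 2 * p u + (w * p (u \<otimes> a) + cnj w * p (u \<otimes> inv a)))"
  unfolding positive_definite_def
proof (intro conjI ballI allI impI)
  fix u assume "u \<in> carrier G"
  moreover from this have "inv u \<otimes> a = inv (u \<otimes> inv a)" "inv u \<otimes> inv a = inv (u \<otimes> a)"
    using a by (simp_all add: inv_mult)
  ultimately show "2 * p (inv u) + (w * p (inv u \<otimes> a) + cnj w * p (inv u \<otimes> inv a))
      = cnj (2 * p u + (w * p (u \<otimes> a) + cnj w * p (u \<otimes> inv a)))"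
    using a positive_definite_cnj[OF p] by simp
next
  fix n :: nat and s c assume s: "\<forall>i<n. s i \<in> carrier G"
  define s' where "s' i = (if i < n then s i else s (i - n) \<otimes> inv a)" for i
  define c' where "c' i = (if i < n then c i else cnj w * c (i - n))" for i
  have w1: "w * cnj w = 1" using w complex_norm_square[of w] by simp
  have "0 \<le> Re (\<Sum>i<n + n. \<Sum>j<n + n. c' i * cnj (c' j) * p (s' i \<otimes> inv s' j))"
    using s a by (intro positive_definiteD[OF p]) (auto simp: s'_def)
  also have "(\<Sum>i<n + n. \<Sum>j<n + n. c' i * cnj (c' j) * p (s' i \<otimes> inv s' j))
    = (\<Sum>i<n. \<Sum>j<n. c i * cnj (c j) * p (s i \<otimes> inv s j) + c i * cnj (cnj w * c j) * p (s i \<otimes> inv (s j \<otimes> inv a)))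
    + (\<Sum>i<n. \<Sum>j<n. (cnj w * c i) * cnj (c j) * p (s i \<otimes> inv a \<otimes> inv s j)
         + (cnj w * c i) * cnj (cnj w * c j) * p (s i \<otimes> inv a \<otimes> inv (s j \<otimes> inv a)))"
    unfolding sum_lessThan_add by (simp add: s'_def c'_def sum.distrib)
  also have "\<dots> = (\<Sum>i<n. \<Sum>j<n. c i * cnj (c j) * (2 * p (s i \<otimes> inv s j)
      + (w * p (s i \<otimes> inv s j \<otimes> a) + cnj w * p (s i \<otimes> inv s j \<otimes> inv a))))"
    unfolding sum.distrib[symmetric]
  proof (intro sum.cong refl)
    fix i j assume "i \<in> {..<n}" "j \<in> {..<n}"
    then have "s i \<in> carrier G" "s j \<in> carrier G" using s by auto
    note this
    moreover have swap: "x \<otimes> b \<otimes> (y \<otimes> d) = x \<otimes> y \<otimes> (b \<otimes> d)"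
      if "x \<in> carrier G" "b \<in> carrier G" "y \<in> carrier G" "d \<in> carrier G" for x b y d
      using that by (simp add: m_ac)
    moreover have "inv (s j \<otimes> inv a) = inv s j \<otimes> a"
      using a \<open>s j \<in> carrier G\<close> by (simp add: inv_mult)
    ultimately have eqs: "s i \<otimes> inv (s j \<otimes> inv a) = s i \<otimes> inv s j \<otimes> a"
      "s i \<otimes> inv a \<otimes> inv s j = s i \<otimes> inv s j \<otimes> inv a"
      "s i \<otimes> inv a \<otimes> inv (s j \<otimes> inv a) = s i \<otimes> inv s j"
      using a swap[of "s i" "inv a" "inv s j" a] by (simp_all add: m_assoc m_comm[of "inv a"])
    have "cnj w * c i * cnj (cnj w * c j) = (w * cnj w) * (c i * cnj (c j))" by simp
    then have e: "cnj w * c i * cnj (cnj w * c j) = c i * cnj (c j)" unfolding w1 by simp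
    show "c i * cnj (c j) * p (s i \<otimes> inv s j) + c i * cnj (cnj w * c j) * p (s i \<otimes> inv (s j \<otimes> inv a))
        + (cnj w * c i * cnj (c j) * p (s i \<otimes> inv a \<otimes> inv s j)
         + cnj w * c i * cnj (cnj w * c j) * p (s i \<otimes> inv a \<otimes> inv (s j \<otimes> inv a)))
      = c i * cnj (c j) * (2 * p (s i \<otimes> inv s j)
        + (w * p (s i \<otimes> inv s j \<otimes> a) + cnj w * p (s i \<otimes> inv s j \<otimes> inv a)))"
      unfolding eqs e by (simp add: algebra_simps)
  qed
  finally show "0 \<le> Re (\<Sum>i<n. \<Sum>j<n. c i * cnj (c j) * (2 * p (s i \<otimes> inv s j)
      + (w * p (s i \<otimes> inv s j \<otimes> a) + cnj w * p (s i \<otimes> inv s j \<otimes> inv a))))" .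
qed

text \<open>The bound at every u and the value 0 off the carrier put the set into a product of discs
  and make equality of functions the same as equality on the carrier, as compactness and extremality
  require.\<close>

definition normalized_pd :: "('a, 'm) monoid_scheme \<Rightarrow> ('a \<Rightarrow> complex) set" where
  "normalized_pd G = {p. positive_definite G p \<and> p \<one>\<^bsub>G\<^esub> = 1 \<and> (\<forall>u. cmod (p u) \<le> 1) \<and>
     (\<forall>u. u \<notin> carrier G \<longrightarrow> p u = 0)}"

lemma closed_normalized_pd: "closed (normalized_pd G)"
  unfolding normalized_pd_def positive_definite_def Ball_def
  by (intro closed_Collect_conj closed_Collect_all closed_Collect_premise closed_Collect_eq
      closed_Collect_le continuous_intros continuous_on_product_coordinates)

lemma compact_normalized_pd: "compact (normalized_pd G)"
proof -
  have "compact {p. \<forall>u. p u \<in> cball (0::complex) 1}" by (rule compact_box_fun) simp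
  moreover have "normalized_pd G = {p. \<forall>u. p u \<in> cball 0 1} \<inter> normalized_pd G"
    by (auto simp: normalized_pd_def)
  ultimately show ?thesis using compact_Int_closed closed_normalized_pd by metis
qed

lemma (in group) normalize_positive_definite:
  assumes p: "positive_definite G p" and r: "p \<one> = complex_of_real r" "0 < r"
  shows "(\<lambda>u. if u \<in> carrier G then p u / complex_of_real r else 0) \<in> normalized_pd G" (is "?q \<in> _")
proof -
  have "positive_definite G ?q"
    by (rule positive_definite_cong[OF positive_definite_scale[OF p, of "1 / r"]])
      (use r in \<open>auto simp: group_axioms\<close>)
  moreover have "?q \<one> = 1" using r by simp
  ultimately show ?thesis
    using positive_definite_bound[of ?q] by (auto simp: normalized_pd_def)
qed

text \<open>\<open>x\<close> is a convex combination of the normalisations of \<open>4 x \<plusminus> (w x(\<cdot> a) + cnj w x(\<cdot> a\<^sup>-\<^sup>1))\<close>. The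
  functions with \<open>2\<close> in place of \<open>4\<close> are already positive definite, but may vanish.\<close>

lemma (in comm_group) extreme_normalized_pd_mult:
  assumes x: "x \<in> normalized_pd G"
    and extreme: "\<forall>p\<in>normalized_pd G. \<forall>q\<in>normalized_pd G. \<forall>t::real. 0 < t \<longrightarrow> t < 1 \<longrightarrow>
      x = convex_comb t p q \<longrightarrow> p = x"
    and u: "u \<in> carrier G" and a: "a \<in> carrier G"
  shows "x (u \<otimes> a) = x u * x a"
proof -
  have pd: "positive_definite G x" and x1: "x \<one> = 1" and xn: "\<And>u. cmod (x u) \<le> 1"
    and xo: "\<And>u. u \<notin> carrier G \<Longrightarrow> x u = 0"
    using x by (auto simp: normalized_pd_def)
  \<comment> \<open>Extremality makes the translated part a multiple of \<open>x\<close>. The cases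
    w = 1 and w = \<open>\<i>\<close> then give the sum and the difference of
    \<open>x (u \<otimes> a)\<close> and \<open>x (u \<otimes> inv a)\<close>.\<close>
  have *: "w * x (u \<otimes> a) + cnj w * x (u \<otimes> inv a) = 2 * Re (w * x a) * x u" if w: "cmod w = 1" for w
  proof -
    define r where "r = Re (w * x a)"
    have r: "\<bar>r\<bar> \<le> 1"
      using abs_Re_le_cmod[of "w * x a"] xn[of a] w by (simp add: r_def norm_mult)
    define h where "h w u = w * x (u \<otimes> a) + cnj w * x (u \<otimes> inv a)" for w u
    define q where "q w u = (if u \<in> carrier G then (4 * x u + h w u) / complex_of_real (4 + 2 * Re (w * x a)) else 0)"
      for w u
    have q: "q v \<in> normalized_pd G" if v: "v = w \<or> v = - w" for v
    proof -
      have "positive_definite G (\<lambda>u. complex_of_real 2 * x u + (2 * x u + h v u))"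
        unfolding h_def using v w
        by (intro positive_definite_add positive_definite_scale positive_definite_translates pd a) auto
      then have "positive_definite G (\<lambda>u. 4 * x u + h v u)"
        by (rule positive_definite_cong) (auto simp: group_axioms)
      moreover have "4 * x \<one> + h v \<one> = complex_of_real (4 + 2 * Re (v * x a))"
        using a by (simp add: h_def x1 positive_definite_cnj[OF pd] complex_eq_iff)
      moreover have "0 < 4 + 2 * Re (v * x a)" using v r by (auto simp: r_def)
      ultimately show ?thesis unfolding q_def by (rule normalize_positive_definite)
    qed
    have n: "complex_of_real (4 + 2 * r) \<noteq> 0" "complex_of_real (4 - 2 * r) \<noteq> 0"
      using r unfolding of_real_eq_0_iff by auto
    \<comment> \<open>The weights \<open>(4 + 2 * r) / 8\<close> and \<open>(4 - 2 * r) / 8\<close>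
      undo the two normalisations; the translated parts then cancel.\<close>
    have "x v = complex_of_real ((4 + 2 * r) / 8) * q w v + (1 - complex_of_real ((4 + 2 * r) / 8)) * q (- w) v" for v
    proof (cases "v \<in> carrier G")
      case True
      have 1: "complex_of_real ((4 + 2 * r) / 8) * q w v = (4 * x v + h w v) / 8"
        using n True unfolding q_def r_def[symmetric] by (simp del: of_real_add of_real_mult)
      have cr: "1 - complex_of_real ((4 + 2 * r) / 8) = complex_of_real (4 - 2 * r) / 8"
        by (simp add: field_simps)
      have qw: "q (- w) v = (4 * x v - h w v) / complex_of_real (4 - 2 * r)"
      proof -
        have "Re (- w * x a) = - r" "h (- w) v = - h w v" by (simp_all add: r_def h_def)
        then have "q (- w) v = (4 * x v + - h w v) / complex_of_real (4 + 2 * - r)"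
          using True by (simp only: q_def if_True)
        then show ?thesis by simp
      qed
      have 2: "(1 - complex_of_real ((4 + 2 * r) / 8)) * q (- w) v = (4 * x v - h w v) / 8"
        unfolding cr qw using n(2) by (simp del: of_real_diff of_real_mult)
      show ?thesis unfolding 1 2 by (simp add: field_simps)
    qed (simp add: q_def xo)
    then have "x = convex_comb ((4 + 2 * r) / 8) (q w) (q (- w))"
      unfolding convex_comb_def by blast
    moreover have "0 < (4 + 2 * r) / 8" "(4 + 2 * r) / 8 < 1" using r by auto
    ultimately have "q w = x" using extreme q[of w] q[of "- w"] by blast
    then have "q w u = x u" by simp
    then have "4 * x u + h w u = complex_of_real (4 + 2 * r) * x u"
      using u n unfolding q_def r_def[symmetric] by (simp add: divide_eq_eq mult.commute del: of_real_add of_real_mult)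
    then show ?thesis by (simp add: h_def r_def algebra_simps)
  qed
  have 1: "x (u \<otimes> a) + x (u \<otimes> inv a) = 2 * Re (x a) * x u" using *[of 1] by simp
  have "\<i> * (x (u \<otimes> a) - x (u \<otimes> inv a)) = \<i> * (2 * \<i> * Im (x a) * x u)"
    using *[of \<i>] by (simp add: algebra_simps)
  then have 2: "x (u \<otimes> a) - x (u \<otimes> inv a) = 2 * \<i> * Im (x a) * x u" by (metis complex_i_not_zero mult_left_cancel)
  have "2 * x (u \<otimes> a) = 2 * ((Re (x a) + \<i> * Im (x a)) * x u)"
    using arg_cong2[OF 1 2, of "(+)"] by (simp add: algebra_simps)
  then show ?thesis using complex_eq[of "x a"] by (simp add: mult.commute)
qed

section \<open>Characters as extreme positive definite functions\<close>

context comm_group_mean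
begin

lemma bounded_translate:
  fixes f :: "'a \<Rightarrow> 'c::real_normed_vector"
  assumes "bounded (f ` carrier G)" "s \<in> carrier G"
  shows "bounded ((\<lambda>t. f (s \<otimes> t)) ` carrier G)" "bounded ((\<lambda>t. f (t \<otimes> inv s)) ` carrier G)"
  using assms by (auto intro: bounded_image_compose)

text \<open>Each new point is chosen so that its contribution does not exceed its mean.\<close>

lemma ex_points_small_double_sum:
  assumes b: "bounded (\<eta> ` carrier G)" and bh: "bounded (h ` carrier G)"
    and sym: "\<And>u. u \<in> carrier G \<Longrightarrow> \<eta> (inv u) = \<eta> u" and e: "0 < e"
  shows "\<exists>y. (\<forall>i<n. y i \<in> carrier G) \<and>
    (\<Sum>i<n. \<Sum>j<n. \<eta> (y i \<otimes> inv y j)) + (\<Sum>i<n. h (y i))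
      \<le> real n * \<eta> \<one> + real n * (real n - 1) * M \<eta> + real n * M h + real n * e"
proof (induction n)
  case 0
  then show ?case by simp
next
  case (Suc n)
  then obtain y where y: "\<And>i. i < n \<Longrightarrow> y i \<in> carrier G"
    and IH: "(\<Sum>i<n. \<Sum>j<n. \<eta> (y i \<otimes> inv y j)) + (\<Sum>i<n. h (y i))
      \<le> real n * \<eta> \<one> + real n * (real n - 1) * M \<eta> + real n * M h + real n * e" by blast
  \<comment> \<open>Up to the constant \<open>\<eta> \<one>\<close>, this is what the whole
    expression gains from an additional point v; the factor 2 counts its row and its column, equal
    by symmetry.\<close>
  define g where "g v = 2 * (\<Sum>j<n. \<eta> (v \<otimes> inv y j)) + h v" for v
  have b1: "bounded ((\<lambda>v. \<eta> (v \<otimes> inv y j)) ` carrier G)" if "j < n" for j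
    using bounded_translate(2)[OF b y[OF that]] .
  have b2: "bounded ((\<lambda>v. 2 * (\<Sum>j<n. \<eta> (v \<otimes> inv y j))) ` carrier G)"
    by (intro bounded_image_mult bounded_image_const bounded_image_sum b1) simp
  have bg: "bounded (g ` carrier G)" unfolding g_def by (intro bounded_image_add b2 bh)
  have "M (\<lambda>v. \<eta> (v \<otimes> inv y j)) = M \<eta>" if "j < n" for j
  proof -
    have "M (\<lambda>v. \<eta> (v \<otimes> inv y j)) = M (\<lambda>v. \<eta> (inv y j \<otimes> v))"
      using y[OF that] by (intro cong b1 that) (simp add: m_comm)
    then show ?thesis using shift[OF inv_closed[OF y[OF that]] b] by simp
  qed
  moreover have "M (\<lambda>v. \<Sum>j<n. \<eta> (v \<otimes> inv y j)) = (\<Sum>j<n. M (\<lambda>v. \<eta> (v \<otimes> inv y j)))"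
    using b1 by (intro sum) auto
  moreover have "M (\<lambda>v. 2 * (\<Sum>j<n. \<eta> (v \<otimes> inv y j))) = 2 * M (\<lambda>v. \<Sum>j<n. \<eta> (v \<otimes> inv y j))"
    using b1 by (intro scale bounded_image_sum) auto
  ultimately have Mg: "M g = 2 * (real n * M \<eta>) + M h"
    using add[OF b2 bh] by (simp add: g_def[abs_def])
  obtain v where v: "v \<in> carrier G" "g v \<le> M g + e" using exists_le[OF bg e] by blast
  define y' where "y' i = (if i < n then y i else v)" for i
  have "\<eta> (y j \<otimes> inv v) = \<eta> (v \<otimes> inv y j)" if "j < n" for j
    using sym[of "v \<otimes> inv y j"] v y[OF that] by (simp add: inv_mult m_comm)
  then have "(\<Sum>i<Suc n. \<Sum>j<Suc n. \<eta> (y' i \<otimes> inv y' j)) + (\<Sum>i<Suc n. h (y' i))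
      = (\<Sum>i<n. \<Sum>j<n. \<eta> (y i \<otimes> inv y j)) + (\<Sum>i<n. h (y i)) + \<eta> \<one> + g v"
    using v by (simp add: y'_def g_def sum.distrib)
  also have "\<dots> \<le> real n * \<eta> \<one> + real n * (real n - 1) * M \<eta> + real n * M h + real n * e
      + \<eta> \<one> + (2 * (real n * M \<eta>) + M h + e)"
    using IH v(2) Mg by linarith
  also have "\<dots> = real (Suc n) * \<eta> \<one> + real (Suc n) * (real (Suc n) - 1) * M \<eta> + real (Suc n) * M h + real (Suc n) * e"
    by (simp add: algebra_simps)
  finally have "(\<Sum>i<Suc n. \<Sum>j<Suc n. \<eta> (y' i \<otimes> inv y' j)) + (\<Sum>i<Suc n. h (y' i))
    \<le> real (Suc n) * \<eta> \<one> + real (Suc n) * (real (Suc n) - 1) * M \<eta> + real (Suc n) * M h + real (Suc n) * e" .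
  moreover have "\<forall>i<Suc n. y' i \<in> carrier G" using y v by (auto simp: y'_def)
  ultimately show ?case by blast
qed

lemma positive_definite_bounded: "positive_definite G p \<Longrightarrow> bounded (p ` carrier G)"
  by (rule bounded_imageI[of _ _ "Re (p \<one>)"]) (rule positive_definite_bound)

text \<open>The mean of a positive definite function is the infimum of its averages over finite families
  of differences, which makes it upper semicontinuous for pointwise convergence.\<close>

lemma mean_le_double_average:
  assumes p: "positive_definite G p" and s: "\<And>i. i < n \<Longrightarrow> s i \<in> carrier G"
  shows "real n ^ 2 * M (\<lambda>u. Re (p u)) \<le> (\<Sum>i<n. \<Sum>j<n. Re (p (s i \<otimes> inv s j)))"
proof (cases "n = 0")
  case False
  define \<eta> where "\<eta> u = Re (p u)" for u
  have b: "bounded (\<eta> ` carrier G)"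
    unfolding \<eta>_def by (intro bounded_image_Re positive_definite_bounded p)
  have sym: "\<eta> (inv u) = \<eta> u" if "u \<in> carrier G" for u
    unfolding \<eta>_def using positive_definite_cnj[OF p that] by simp
  define X where "X = (\<Sum>i<n. \<Sum>j<n. \<eta> (s i \<otimes> inv s j))"
  have main: "real n ^ 2 * M \<eta> - X \<le> real n ^ 2 * (\<eta> \<one> + 1 - M \<eta>) / real N" if N: "N > 0" for N :: nat
  proof -
    \<comment> \<open>The given n points and N auxiliary points y are tested together with weights N
      and -n, so that two uniform averages are compared. The function h accounts for the mixed
      terms; its scaling makes them agree with those of the quadratic form after multiplication by
      \<open>real n ^ 2\<close>.\<close>
    define h where "h v = - (2 * real N / real n) * (\<Sum>i<n. \<eta> (v \<otimes> inv s i))" for v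
    have b1: "bounded ((\<lambda>v. \<eta> (v \<otimes> inv s i)) ` carrier G)" if "i < n" for i
      using bounded_translate(2)[OF b s[OF that]] .
    have b2: "bounded ((\<lambda>v. \<Sum>i<n. \<eta> (v \<otimes> inv s i)) ` carrier G)"
      using b1 by (intro bounded_image_sum) auto
    have bh: "bounded (h ` carrier G)"
      unfolding h_def by (intro bounded_image_mult bounded_image_const b2)
    have "M (\<lambda>v. \<eta> (v \<otimes> inv s j)) = M \<eta>" if "j < n" for j
    proof -
      have "M (\<lambda>v. \<eta> (v \<otimes> inv s j)) = M (\<lambda>v. \<eta> (inv s j \<otimes> v))"
        using s[OF that] by (intro cong b1 that) (simp add: m_comm)
      then show ?thesis using shift[OF inv_closed[OF s[OF that]] b] by simp
    qed
    moreover have "M (\<lambda>v. \<Sum>j<n. \<eta> (v \<otimes> inv s j)) = (\<Sum>j<n. M (\<lambda>v. \<eta> (v \<otimes> inv s j)))"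
      using b1 by (intro sum) auto
    moreover have "M h = - (2 * real N / real n) * M (\<lambda>v. \<Sum>i<n. \<eta> (v \<otimes> inv s i))"
      unfolding h_def[abs_def] by (rule scale[OF b2])
    ultimately have "M h = - (2 * real N / real n) * (real n * M \<eta>)" by simp
    then have Mh: "M h = - 2 * real N * M \<eta>" using False by simp
    obtain y where y: "\<And>i. i < N \<Longrightarrow> y i \<in> carrier G"
      and le: "(\<Sum>i<N. \<Sum>j<N. \<eta> (y i \<otimes> inv y j)) + (\<Sum>i<N. h (y i))
        \<le> real N * \<eta> \<one> + real N * (real N - 1) * M \<eta> + real N * M h + real N * 1"
      using ex_points_small_double_sum[OF b bh sym zero_less_one, of N] by blast
    define Y where "Y = (\<Sum>i<N. \<Sum>j<N. \<eta> (y i \<otimes> inv y j))"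
    define Z where "Z = (\<Sum>j<N. \<Sum>i<n. \<eta> (y j \<otimes> inv s i))"
    define s' where "s' i = (if i < n then s i else y (i - n))" for i
    define c' where "c' i = (if i < n then complex_of_real (real N) else - complex_of_real (real n))" for i
    have "0 \<le> Re (\<Sum>i<n + N. \<Sum>j<n + N. c' i * cnj (c' j) * p (s' i \<otimes> inv s' j))"
      using s y by (intro positive_definiteD[OF p]) (auto simp: s'_def)
    also have "\<dots> = real N ^ 2 * X - real N * real n * (\<Sum>i<n. \<Sum>j<N. \<eta> (s i \<otimes> inv y j))
        - real N * real n * Z + real n ^ 2 * Y"
      unfolding sum_lessThan_add
      by (simp add: s'_def c'_def X_def Y_def Z_def \<eta>_def sum.distrib sum_distrib_left power2_eq_square
          sum_negf sum_subtractf mult_ac)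
    also have "(\<Sum>i<n. \<Sum>j<N. \<eta> (s i \<otimes> inv y j)) = Z"
    proof -
      have "(\<Sum>i<n. \<Sum>j<N. \<eta> (s i \<otimes> inv y j)) = (\<Sum>i<n. \<Sum>j<N. \<eta> (y j \<otimes> inv s i))"
      proof (intro sum.cong refl)
        fix i j assume "i \<in> {..<n}" "j \<in> {..<N}"
        then show "\<eta> (s i \<otimes> inv y j) = \<eta> (y j \<otimes> inv s i)"
          using sym[of "y j \<otimes> inv s i"] s y by (simp add: inv_mult m_comm)
      qed
      also have "\<dots> = Z" unfolding Z_def by (rule sum.swap)
      finally show ?thesis .
    qed
    finally have pos: "2 * (real N * real n * Z) \<le> real N ^ 2 * X + real n ^ 2 * Y"
      by (simp add: algebra_simps)
    have hZ: "(\<Sum>i<N. h (y i)) = - (2 * real N / real n) * Z"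
      unfolding h_def Z_def by (simp only: sum_distrib_left)
    have "Y - (2 * real N / real n) * Z \<le> real N * (\<eta> \<one> + 1 - M \<eta>) - real N ^ 2 * M \<eta>"
      using le unfolding Y_def[symmetric] hZ Mh by (simp add: algebra_simps power2_eq_square)
    then have "real n ^ 2 * (Y - (2 * real N / real n) * Z)
        \<le> real n ^ 2 * (real N * (\<eta> \<one> + 1 - M \<eta>) - real N ^ 2 * M \<eta>)"
      by (intro mult_left_mono) auto
    moreover have "real n ^ 2 * (Y - (2 * real N / real n) * Z) = real n ^ 2 * Y - 2 * (real N * real n * Z)"
      using False by (simp add: field_simps power2_eq_square)
    ultimately have "- (real N ^ 2 * X) \<le> real n ^ 2 * (real N * (\<eta> \<one> + 1 - M \<eta>) - real N ^ 2 * M \<eta>)"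
      using pos by linarith
    then have "real N ^ 2 * (real n ^ 2 * M \<eta> - X) \<le> real n ^ 2 * (real N * (\<eta> \<one> + 1 - M \<eta>))"
      unfolding right_diff_distrib by (simp add: mult_ac)
    also have "\<dots> = real N ^ 2 * (real n ^ 2 * (\<eta> \<one> + 1 - M \<eta>) / real N)"
      using N by (simp add: power2_eq_square)
    finally have "real N ^ 2 * (real n ^ 2 * M \<eta> - X) \<le> real N ^ 2 * (real n ^ 2 * (\<eta> \<one> + 1 - M \<eta>) / real N)" .
    then show ?thesis using N by (simp only: mult_le_cancel_left_pos zero_less_power of_nat_0_less_iff)
  qed
  have "(\<lambda>N. real n ^ 2 * (\<eta> \<one> + 1 - M \<eta>) / real N) \<longlonglongrightarrow> 0" by (rule lim_const_over_n)
  then have "real n ^ 2 * M \<eta> - X \<le> 0"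
    by (rule tendsto_lowerbound) (auto intro!: eventually_sequentiallyI[of 1] main)
  then show ?thesis by (simp add: X_def \<eta>_def[abs_def])
qed simp

text \<open>With h = 0 the greedy choice leaves a surplus only from the diagonal and from the slack
  1 per point. It is linear in n, while the tolerance e is multiplied by the square of n.\<close>

lemma ex_double_average_le_mean:
  assumes p: "positive_definite G p" and e: "0 < e"
  shows "\<exists>n s. n > 0 \<and> (\<forall>i<n. s i \<in> carrier G) \<and>
    (\<Sum>i<n. \<Sum>j<n. Re (p (s i \<otimes> inv s j))) \<le> real n ^ 2 * (M (\<lambda>u. Re (p u)) + e)"
proof -
  define \<eta> where "\<eta> u = Re (p u)" for u
  have b: "bounded (\<eta> ` carrier G)"
    unfolding \<eta>_def by (intro bounded_image_Re positive_definite_bounded p)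
  have sym: "\<eta> (inv u) = \<eta> u" if "u \<in> carrier G" for u
    unfolding \<eta>_def using positive_definite_cnj[OF p that] by simp
  obtain k :: nat where k: "(\<eta> \<one> - M \<eta> + 1) / e < real k" using reals_Archimedean2 by blast
  define n where "n = Suc k"
  have n: "\<eta> \<one> - M \<eta> + 1 \<le> real n * e"
    using k e by (simp add: n_def field_simps)
  have b0: "bounded ((\<lambda>_. 0::real) ` carrier G)" by (rule bounded_image_const)
  obtain s where s: "\<forall>i<n. s i \<in> carrier G"
    and le: "(\<Sum>i<n. \<Sum>j<n. \<eta> (s i \<otimes> inv s j)) \<le> real n * \<eta> \<one> + real n * (real n - 1) * M \<eta> + real n * 1"
    using ex_points_small_double_sum[OF b b0 sym zero_less_one, of n] by (auto simp: const)
  have "real n * \<eta> \<one> + real n * (real n - 1) * M \<eta> + real n * 1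
      = real n ^ 2 * M \<eta> + real n * (\<eta> \<one> - M \<eta> + 1)" by (simp add: algebra_simps power2_eq_square)
  also have "\<dots> \<le> real n ^ 2 * M \<eta> + real n * (real n * e)"
    using n by (intro add_left_mono mult_left_mono) auto
  finally have "(\<Sum>i<n. \<Sum>j<n. \<eta> (s i \<otimes> inv s j)) \<le> real n ^ 2 * (M \<eta> + e)"
    using le by (simp add: algebra_simps power2_eq_square)
  then show ?thesis using s unfolding \<eta>_def[abs_def] by (intro exI[of _ n] exI[of _ s]) (simp add: n_def)
qed

text \<open>Each condition on the right is a non-strict inequality in finitely many values of p,
  hence closed in p. This is how superlevel sets of the mean become closed.\<close>

lemma le_mean_iff:
  assumes p: "positive_definite G p"
  shows "c \<le> M (\<lambda>u. Re (p u)) \<longleftrightarrow>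
    (\<forall>n s. (\<forall>i<n. s i \<in> carrier G) \<longrightarrow> real n ^ 2 * c \<le> (\<Sum>i<n. \<Sum>j<n. Re (p (s i \<otimes> inv s j))))"
proof
  assume "c \<le> M (\<lambda>u. Re (p u))"
  then show "\<forall>n s. (\<forall>i<n. s i \<in> carrier G) \<longrightarrow> real n ^ 2 * c \<le> (\<Sum>i<n. \<Sum>j<n. Re (p (s i \<otimes> inv s j)))"
    using mean_le_double_average[OF p] by (meson mult_left_mono order_trans zero_le_power2)
next
  assume *: "\<forall>n s. (\<forall>i<n. s i \<in> carrier G) \<longrightarrow> real n ^ 2 * c \<le> (\<Sum>i<n. \<Sum>j<n. Re (p (s i \<otimes> inv s j)))"
  show "c \<le> M (\<lambda>u. Re (p u))"
  proof (rule field_le_epsilon)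
    fix e :: real assume "0 < e"
    then obtain n s where ns: "n > 0" "\<forall>i<n. s i \<in> carrier G"
      "(\<Sum>i<n. \<Sum>j<n. Re (p (s i \<otimes> inv s j))) \<le> real n ^ 2 * (M (\<lambda>u. Re (p u)) + e)"
      using ex_double_average_le_mean[OF p] by blast
    then have "real n ^ 2 * c \<le> real n ^ 2 * (M (\<lambda>u. Re (p u)) + e)" using * order_trans by blast
    then show "c \<le> M (\<lambda>u. Re (p u)) + e"
      using ns(1) by (simp only: mult_le_cancel_left_pos zero_less_power of_nat_0_less_iff)
  qed
qed

text \<open>The convolution of f with its reflection, formed with \<open>M\<close>; f is real, so no
  conjugate appears.\<close>

definition autocorrelation :: "('a \<Rightarrow> real) \<Rightarrow> 'a \<Rightarrow> real" where
  "autocorrelation f u = M (\<lambda>t. f (u \<otimes> t) * f t)"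

lemma bounded_autocorrelation:
  assumes "bounded (f ` carrier G)"
  shows "bounded (autocorrelation f ` carrier G)"
proof -
  obtain B where B: "\<And>x. x \<in> carrier G \<Longrightarrow> \<bar>f x\<bar> \<le> B" using assms by (auto simp: bounded_iff)
  have "\<bar>autocorrelation f u\<bar> \<le> B * B" if "u \<in> carrier G" for u
    unfolding autocorrelation_def
  proof (intro abs_le bounded_image_mult bounded_translate assms that)
    fix t assume "t \<in> carrier G"
    then show "\<bar>f (u \<otimes> t) * f t\<bar> \<le> B * B"
      using B[of t] B[of "u \<otimes> t"] that unfolding abs_mult by (intro mult_mono) auto
  qed
  then show ?thesis by (intro bounded_imageI[of _ _ "B * B"]) simp
qed

text \<open>Shifting the mean by t exhibits the kernel as a Gram matrix of translates of f.\<close>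

lemma autocorrelation_diff:
  assumes f: "bounded (f ` carrier G)" and s: "s \<in> carrier G" "t \<in> carrier G"
  shows "autocorrelation f (s \<otimes> inv t) = M (\<lambda>r. f (s \<otimes> r) * f (t \<otimes> r))"
proof -
  have st: "s \<otimes> inv t \<in> carrier G" using s by simp
  have b: "bounded ((\<lambda>r. f (s \<otimes> inv t \<otimes> r) * f r) ` carrier G)"
    by (intro bounded_image_mult bounded_translate f st)
  have "autocorrelation f (s \<otimes> inv t) = M (\<lambda>r. f (s \<otimes> inv t \<otimes> (t \<otimes> r)) * f (t \<otimes> r))"
    unfolding autocorrelation_def using shift[OF s(2) b] by simp
  also have "\<dots> = M (\<lambda>r. f (s \<otimes> r) * f (t \<otimes> r))"
  proof (rule cong[OF bounded_translate(1)[OF b s(2)]])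
    fix r assume "r \<in> carrier G"
    then have "s \<otimes> inv t \<otimes> (t \<otimes> r) = s \<otimes> r" using s by (simp add: m_assoc inv_solve_left')
    then show "f (s \<otimes> inv t \<otimes> (t \<otimes> r)) * f (t \<otimes> r) = f (s \<otimes> r) * f (t \<otimes> r)" by simp
  qed
  finally show ?thesis .
qed

text \<open>Schur's product argument in averaged form: the quadratic form is the mean over r of the
  forms of p with coefficients \<open>f (s i \<otimes> r) * c i\<close>.\<close>

lemma positive_definite_autocorrelation_mult:
  assumes f: "bounded (f ` carrier G)" and p: "positive_definite G p"
  shows "positive_definite G (\<lambda>u. complex_of_real (autocorrelation f u) * p u)"
  unfolding positive_definite_def
proof (intro conjI ballI allI impI)
  fix u assume u: "u \<in> carrier G"
  have "autocorrelation f (inv u) = M (\<lambda>r. f (\<one> \<otimes> r) * f (u \<otimes> r))"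
    using autocorrelation_diff[OF f one_closed u] u by simp
  also have "\<dots> = autocorrelation f u"
    unfolding autocorrelation_def
    by (intro cong bounded_image_mult bounded_translate f one_closed u) simp
  finally show "complex_of_real (autocorrelation f (inv u)) * p (inv u)
      = cnj (complex_of_real (autocorrelation f u) * p u)"
    using positive_definite_cnj[OF p u] by simp
next
  fix n :: nat and s c assume s: "\<forall>i<n. s i \<in> carrier G"
  define d where "d i j = c i * cnj (c j) * p (s i \<otimes> inv s j)" for i j
  have b: "bounded ((\<lambda>r. Re (d i j) * (f (s i \<otimes> r) * f (s j \<otimes> r))) ` carrier G)"
    if "i < n" "j < n" for i j
    using s that by (intro bounded_image_mult bounded_image_const bounded_translate f) auto
  have "Re (\<Sum>i<n. \<Sum>j<n. c i * cnj (c j) * (complex_of_real (autocorrelation f (s i \<otimes> inv s j)) * p (s i \<otimes> inv s j)))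
      = (\<Sum>i<n. \<Sum>j<n. Re (d i j) * autocorrelation f (s i \<otimes> inv s j))"
    unfolding Re_sum
  proof (intro sum.cong refl)
    fix i j
    have *: "c i * cnj (c j) * (complex_of_real (autocorrelation f (s i \<otimes> inv s j)) * p (s i \<otimes> inv s j))
        = d i j * complex_of_real (autocorrelation f (s i \<otimes> inv s j))"
      by (simp add: d_def mult_ac)
    show "Re (c i * cnj (c j) * (complex_of_real (autocorrelation f (s i \<otimes> inv s j)) * p (s i \<otimes> inv s j)))
        = Re (d i j) * autocorrelation f (s i \<otimes> inv s j)" unfolding * by simp
  qed
  also have "\<dots> = (\<Sum>i<n. \<Sum>j<n. M (\<lambda>r. Re (d i j) * (f (s i \<otimes> r) * f (s j \<otimes> r))))"
  proof (intro sum.cong refl)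
    fix i j assume "i \<in> {..<n}" "j \<in> {..<n}"
    then have "s i \<in> carrier G" "s j \<in> carrier G" using s by auto
    then show "Re (d i j) * autocorrelation f (s i \<otimes> inv s j) = M (\<lambda>r. Re (d i j) * (f (s i \<otimes> r) * f (s j \<otimes> r)))"
      using autocorrelation_diff[OF f] scale[OF bounded_image_mult[OF bounded_translate(1)[OF f] bounded_translate(1)[OF f]]]
      by simp
  qed
  also have "\<dots> = (\<Sum>i<n. M (\<lambda>r. \<Sum>j<n. Re (d i j) * (f (s i \<otimes> r) * f (s j \<otimes> r))))"
    by (intro sum.cong refl sum[symmetric] b) auto
  also have "\<dots> = M (\<lambda>r. \<Sum>i<n. \<Sum>j<n. Re (d i j) * (f (s i \<otimes> r) * f (s j \<otimes> r)))"
    by (intro sum[symmetric] bounded_image_sum b) auto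
  also have "0 \<le> \<dots>"
  proof (rule lower)
    show "bounded ((\<lambda>r. \<Sum>i<n. \<Sum>j<n. Re (d i j) * (f (s i \<otimes> r) * f (s j \<otimes> r))) ` carrier G)"
      using b by (intro bounded_image_sum) auto
    fix r assume r: "r \<in> carrier G"
    have "(\<Sum>i<n. \<Sum>j<n. Re (d i j) * (f (s i \<otimes> r) * f (s j \<otimes> r)))
      = Re (\<Sum>i<n. \<Sum>j<n. (complex_of_real (f (s i \<otimes> r)) * c i) * cnj (complex_of_real (f (s j \<otimes> r)) * c j)
          * p (s i \<otimes> inv s j))"
      unfolding Re_sum
    proof (intro sum.cong refl)
      fix i j
      have *: "(complex_of_real (f (s i \<otimes> r)) * c i) * cnj (complex_of_real (f (s j \<otimes> r)) * c j) * p (s i \<otimes> inv s j)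
        = d i j * complex_of_real (f (s i \<otimes> r) * f (s j \<otimes> r))" by (simp add: d_def mult_ac)
      show "Re (d i j) * (f (s i \<otimes> r) * f (s j \<otimes> r))
        = Re ((complex_of_real (f (s i \<otimes> r)) * c i) * cnj (complex_of_real (f (s j \<otimes> r)) * c j) * p (s i \<otimes> inv s j))"
        unfolding * by simp
    qed
    also have "\<dots> \<ge> 0" using s by (intro positive_definiteD[OF p]) auto
    finally show "0 \<le> (\<Sum>i<n. \<Sum>j<n. Re (d i j) * (f (s i \<otimes> r) * f (s j \<otimes> r)))" .
  qed
  finally show "0 \<le> Re (\<Sum>i<n. \<Sum>j<n. c i * cnj (c j) *
    (complex_of_real (autocorrelation f (s i \<otimes> inv s j)) * p (s i \<otimes> inv s j)))" .
qed

text \<open>The normalised autocorrelation \<open>p0\<close> competes with value \<open>M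
  (\<lambda>u. autocorrelation f u ^ 2) / autocorrelation f \<one>\<close>, so the extreme maximiser
  has a positive value. Being multiplicative and bounded by 1 both at u and at \<open>inv u\<close>,
  it has modulus 1. Nothing is claimed about continuity at this stage.\<close>

lemma ex_character_autocorrelation:
  assumes f: "bounded (f ` carrier G)"
    and f1: "0 < autocorrelation f \<one>" and f2: "0 < M (\<lambda>u. autocorrelation f u ^ 2)"
  shows "\<exists>x. (\<forall>u\<in>carrier G. \<forall>a\<in>carrier G. x (u \<otimes> a) = x u * x a) \<and>
    (\<forall>u\<in>carrier G. cmod (x u) = 1) \<and> 0 < M (\<lambda>u. autocorrelation f u * Re (x u))"
proof -
  let ?P = "normalized_pd G"
  define L where "L p = M (\<lambda>u. autocorrelation f u * Re (p u))" for p
  have Lp: "L p = M (\<lambda>u. Re (complex_of_real (autocorrelation f u) * p u))" for p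
    by (simp add: L_def)
  have pd: "positive_definite G p" if "p \<in> ?P" for p using that by (simp add: normalized_pd_def)
  have b: "bounded ((\<lambda>u. autocorrelation f u * (c * Re (p u))) ` carrier G)" if "p \<in> ?P" for p c
    using that by (intro bounded_image_mult bounded_image_const bounded_image_Re bounded_autocorrelation f
        positive_definite_bounded pd)
  define p0 where "p0 u = (if u \<in> carrier G then complex_of_real (autocorrelation f u)
      / complex_of_real (autocorrelation f \<one>) else 0)" for u
  have p0: "p0 \<in> ?P"
    unfolding p0_def using positive_definite_autocorrelation_mult[OF f positive_definite_const] f1
    by (intro normalize_positive_definite) auto
  have "\<exists>x\<in>?P. (\<forall>y\<in>?P. L y \<le> L x) \<and>
    (\<forall>p\<in>?P. \<forall>q\<in>?P. \<forall>t::real. 0 < t \<longrightarrow> t < 1 \<longrightarrow> x = convex_comb t p q \<longrightarrow> p = x)"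
  proof (rule ex_extreme_maximiser[OF compact_normalized_pd closed_normalized_pd])
    show "?P \<noteq> {}" using p0 by blast
    fix c
    \<comment> \<open>Semicontinuity is drawn from the positive definiteness of the product with the
      autocorrelation.\<close>
    have "{p \<in> ?P. c \<le> L p} = ?P \<inter> {p. \<forall>n s. (\<forall>i<n. s i \<in> carrier G) \<longrightarrow> real n ^ 2 * c
        \<le> (\<Sum>i<n. \<Sum>j<n. Re (complex_of_real (autocorrelation f (s i \<otimes> inv s j)) * p (s i \<otimes> inv s j)))}"
      unfolding Lp using le_mean_iff[OF positive_definite_autocorrelation_mult[OF f pd]] by blast
    moreover have "closed {p. \<forall>n s. (\<forall>i<n. s i \<in> carrier G) \<longrightarrow> real n ^ 2 * c
        \<le> (\<Sum>i<n. \<Sum>j<n. Re (complex_of_real (autocorrelation f (s i \<otimes> inv s j)) * p (s i \<otimes> inv s j)))}"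
      by (intro closed_Collect_all closed_Collect_premise closed_Collect_le continuous_intros
          continuous_on_product_coordinates)
    ultimately show "closed {p \<in> ?P. c \<le> L p}" by (simp only: closed_Int closed_normalized_pd)
  next
    fix p q and t :: real assume pq: "p \<in> ?P" "q \<in> ?P"
    have "L (convex_comb t p q) = M (\<lambda>u. autocorrelation f u * (t * Re (p u)) + autocorrelation f u * ((1 - t) * Re (q u)))"
      by (simp add: L_def convex_comb_def algebra_simps)
    also have "\<dots> = M (\<lambda>u. autocorrelation f u * (t * Re (p u))) + M (\<lambda>u. autocorrelation f u * ((1 - t) * Re (q u)))"
      by (intro add b pq)
    also have "M (\<lambda>u. autocorrelation f u * (t * Re (p u))) = t * L p"
      unfolding L_def using scale[of "\<lambda>u. autocorrelation f u * Re (p u)" t] b[OF pq(1), of 1]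
      by (simp add: mult.left_commute)
    also have "M (\<lambda>u. autocorrelation f u * ((1 - t) * Re (q u))) = (1 - t) * L q"
      unfolding L_def using scale[of "\<lambda>u. autocorrelation f u * Re (q u)" "1 - t"] b[OF pq(2), of 1]
      by (simp add: mult.left_commute)
    finally show "L (convex_comb t p q) = t * L p + (1 - t) * L q" .
  qed
  then obtain x where x: "x \<in> ?P" "L p0 \<le> L x"
    "\<forall>p\<in>?P. \<forall>q\<in>?P. \<forall>t::real. 0 < t \<longrightarrow> t < 1 \<longrightarrow> x = convex_comb t p q \<longrightarrow> p = x"
    using p0 by blast
  have mult: "x (u \<otimes> a) = x u * x a" if "u \<in> carrier G" "a \<in> carrier G" for u a
    using extreme_normalized_pd_mult[OF x(1) x(3) that] .
  have "cmod (x u) = 1" if u: "u \<in> carrier G" for u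
  proof -
    have "x u * x (inv u) = 1" using mult[OF u inv_closed[OF u]] u x(1) by (simp add: normalized_pd_def)
    then have "cmod (x u) * cmod (x (inv u)) = 1" by (metis norm_mult norm_one)
    moreover have "cmod (x u) \<le> 1" "cmod (x (inv u)) \<le> 1" using x(1) by (auto simp: normalized_pd_def)
    ultimately show ?thesis by (metis antisym mult.right_neutral mult_left_mono norm_ge_zero)
  qed
  moreover have "L p0 = M (\<lambda>u. autocorrelation f u ^ 2) / autocorrelation f \<one>"
  proof -
    have "L p0 = M (\<lambda>u. (1 / autocorrelation f \<one>) * autocorrelation f u ^ 2)"
      unfolding L_def using b[OF p0, of 1] by (intro cong) (auto simp: p0_def power2_eq_square)
    also have "\<dots> = (1 / autocorrelation f \<one>) * M (\<lambda>u. autocorrelation f u ^ 2)"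
      by (intro scale bounded_image_power bounded_autocorrelation f)
    finally show ?thesis by simp
  qed
  ultimately have "(\<forall>u\<in>carrier G. cmod (x u) = 1) \<and> 0 < L p0"
    using divide_pos_pos[OF f2 f1] by metis
  then have "(\<forall>u\<in>carrier G. cmod (x u) = 1) \<and> 0 < L x" using x(2) by linarith
  then show ?thesis using mult unfolding L_def by blast
qed

end

section \<open>Characters of compact abelian groups\<close>

context comm_group_mean
begin

text \<open>Translating a character produces a complex factor, which has to be moved out of the
  mean.\<close>

definition complex_mean :: "('a \<Rightarrow> complex) \<Rightarrow> complex" where
  "complex_mean f = Complex (M (\<lambda>x. Re (f x))) (M (\<lambda>x. Im (f x)))"

lemma complex_mean_diff:
  assumes "bounded (f ` carrier G)" "bounded (g ` carrier G)"
  shows "complex_mean (\<lambda>x. f x - g x) = complex_mean f - complex_mean g"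
  using assms by (simp add: complex_mean_def complex_eq_iff diff bounded_image_Re bounded_image_Im)

lemma complex_mean_scale:
  assumes "bounded (f ` carrier G)"
  shows "complex_mean (\<lambda>x. c * f x) = c * complex_mean f"
proof -
  have b: "bounded ((\<lambda>x. r * Re (f x)) ` carrier G)" "bounded ((\<lambda>x. r * Im (f x)) ` carrier G)" for r
    using assms by (auto intro!: bounded_image_mult bounded_image_const bounded_image_Re bounded_image_Im)
  show ?thesis
    using assms by (simp add: complex_mean_def complex_eq_iff diff[OF b] add[OF b(2) b(1)] scale
        bounded_image_Re bounded_image_Im)
qed

lemma complex_mean_cong:
  assumes "bounded (f ` carrier G)" "\<And>x. x \<in> carrier G \<Longrightarrow> f x = g x"
  shows "complex_mean f = complex_mean g"
proof -
  have "M (\<lambda>x. Re (f x)) = M (\<lambda>x. Re (g x))" "M (\<lambda>x. Im (f x)) = M (\<lambda>x. Im (g x))"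
    using assms by (auto intro!: cong bounded_image_Re bounded_image_Im)
  then show ?thesis by (simp add: complex_mean_def)
qed

lemma complex_mean_shift:
  assumes "a \<in> carrier G" "bounded (f ` carrier G)"
  shows "complex_mean (\<lambda>x. f (a \<otimes> x)) = complex_mean f"
proof -
  have "M (\<lambda>x. Re (f (a \<otimes> x))) = M (\<lambda>x. Re (f x))"
    by (rule shift[OF assms(1) bounded_image_Re[OF assms(2)]])
  moreover have "M (\<lambda>x. Im (f (a \<otimes> x))) = M (\<lambda>x. Im (f x))"
    by (rule shift[OF assms(1) bounded_image_Im[OF assms(2)]])
  ultimately show ?thesis by (simp add: complex_mean_def)
qed

text \<open>The factor 2 stems from estimating real and imaginary parts separately.\<close>

lemma complex_mean_norm_le:
  assumes "bounded (f ` carrier G)" "\<And>x. x \<in> carrier G \<Longrightarrow> cmod (f x) \<le> c"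
  shows "cmod (complex_mean f) \<le> 2 * c"
proof -
  have "\<bar>M (\<lambda>x. Re (f x))\<bar> \<le> c" "\<bar>M (\<lambda>x. Im (f x))\<bar> \<le> c"
    using assms(2) abs_Re_le_cmod abs_Im_le_cmod order_trans
    by (intro abs_le bounded_image_Re bounded_image_Im assms(1); blast)+
  then show ?thesis using cmod_le[of "complex_mean f"] by (simp add: complex_mean_def)
qed

end

section \<open>Continuity in topological groups\<close>

lemma topological_groupD:
  assumes "topological_group G T"
  shows "group G" "topspace T = carrier G" "Hausdorff_space T"
  using assms by (auto simp: topological_group_def)

lemma continuous_map_group_mult:
  assumes "topological_group G T" "continuous_map Z T f" "continuous_map Z T g"
  shows "continuous_map Z T (\<lambda>z. f z \<otimes>\<^bsub>G\<^esub> g z)"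
proof -
  have "continuous_map Z T ((\<lambda>(x, y). x \<otimes>\<^bsub>G\<^esub> y) \<circ> (\<lambda>z. (f z, g z)))"
    using assms by (intro continuous_map_compose[OF continuous_map_pairedI]) (auto simp: topological_group_def)
  then show ?thesis by (simp add: o_def)
qed

lemma continuous_map_group_inv:
  assumes "topological_group G T" "continuous_map Z T f"
  shows "continuous_map Z T (\<lambda>z. inv\<^bsub>G\<^esub> f z)"
  using continuous_map_compose[OF assms(2), of T "\<lambda>x. inv\<^bsub>G\<^esub> x"] assms(1)
  by (simp add: topological_group_def o_def)

lemma continuous_map_translation:
  assumes "topological_group G T" "a \<in> carrier G"
  shows "continuous_map T T (\<lambda>x. a \<otimes>\<^bsub>G\<^esub> x)" "continuous_map T T (\<lambda>x. x \<otimes>\<^bsub>G\<^esub> a)"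
  using assms topological_groupD[OF assms(1)]
  by (auto intro!: continuous_map_group_mult)

lemma continuous_map_bounded_image:
  assumes "compact_space T" "continuous_map T euclidean (f :: _ \<Rightarrow> 'b::metric_space)"
  shows "bounded (f ` topspace T)"
  using image_compactin[of T "topspace T" euclidean f] assms compact_imp_bounded
  by (auto simp: compact_space_def)

text \<open>The tube lemma, applied to the open set of pairs (a, t) where f(at) - f(t) is small and
  to the slice over the identity; only a is restricted.\<close>

lemma compact_group_uniformly_continuous:
  fixes f :: "'a \<Rightarrow> real"
  assumes G: "compact_group G T" and f: "continuous_map T euclidean f" and e: "0 < e"
  shows "\<exists>U. openin T U \<and> \<one>\<^bsub>G\<^esub> \<in> U \<and> (\<forall>a\<in>U. \<forall>t\<in>carrier G. \<bar>f (a \<otimes>\<^bsub>G\<^esub> t) - f t\<bar> < e)"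
proof -
  have T: "topological_group G T" "compact_space T" using G by (auto simp: compact_group_def)
  note T' = topological_groupD[OF T(1)]
  interpret group G by (rule T'(1))
  let ?h = "\<lambda>z. f (fst z \<otimes>\<^bsub>G\<^esub> snd z) - f (snd z)"
  have "continuous_map (prod_topology T T) euclidean (f \<circ> (\<lambda>z. fst z \<otimes>\<^bsub>G\<^esub> snd z))"
    by (intro continuous_map_compose[OF continuous_map_group_mult[OF T(1)] f] continuous_map_fst continuous_map_snd)
  moreover have "continuous_map (prod_topology T T) euclidean (f \<circ> snd)"
    by (intro continuous_map_compose[OF continuous_map_snd f])
  ultimately have h: "continuous_map (prod_topology T T) euclidean ?h"
    by (intro continuous_map_diff) (auto simp: o_def)
  define W where "W = {z \<in> topspace (prod_topology T T). ?h z \<in> {-e<..<e}}"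
  have "openin (prod_topology T T) W"
    unfolding W_def using h by (rule openin_continuous_map_preimage) simp
  moreover have "{\<one>\<^bsub>G\<^esub>} \<times> topspace T \<subseteq> W" using e T' by (auto simp: W_def)
  ultimately obtain U V where UV: "openin T U" "\<one>\<^bsub>G\<^esub> \<in> U" "topspace T \<subseteq> V" "U \<times> V \<subseteq> W"
    using tube_lemma_right[of T T W "topspace T" "\<one>\<^bsub>G\<^esub>"] T(2) T'(2) by (auto simp: compact_space_def)
  have "\<bar>f (a \<otimes>\<^bsub>G\<^esub> t) - f t\<bar> < e" if "a \<in> U" "t \<in> carrier G" for a t
  proof -
    have "(a, t) \<in> W" using UV that T'(2) by auto
    then show ?thesis by (auto simp: W_def)
  qed
  then show ?thesis using UV by blast
qed

lemma continuous_hom_of_continuous_at_one: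
  assumes G: "topological_group G T"
    and mult: "\<And>u a. u \<in> carrier G \<Longrightarrow> a \<in> carrier G \<Longrightarrow> x (u \<otimes>\<^bsub>G\<^esub> a) = x u * x a"
    and norm: "\<And>u. u \<in> carrier G \<Longrightarrow> cmod (x u) = 1"
    and one: "\<And>e. 0 < e \<Longrightarrow> \<exists>U. openin T U \<and> \<one>\<^bsub>G\<^esub> \<in> U \<and> (\<forall>a\<in>U. cmod (x a - 1) < e)"
  shows "restrict x (carrier G) \<in> characters G T"
proof -
  note T = topological_groupD[OF G]
  interpret group G by (rule T(1))
  have "openin T {u \<in> topspace T. x u \<in> W}" if W: "open W" for W
    unfolding openin_subopen[of T "{u \<in> topspace T. x u \<in> W}"]
  proof safe
    fix u assume u: "u \<in> topspace T" "x u \<in> W"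
    then obtain e where e: "0 < e" "ball (x u) e \<subseteq> W" using W openE by blast
    obtain U where U: "openin T U" "\<one>\<^bsub>G\<^esub> \<in> U" "\<forall>a\<in>U. cmod (x a - 1) < e" using one[OF e(1)] by blast
    define V where "V = {v \<in> topspace T. inv\<^bsub>G\<^esub> u \<otimes>\<^bsub>G\<^esub> v \<in> U}"
    have "openin T V" unfolding V_def
      using u T by (intro openin_continuous_map_preimage[OF continuous_map_translation(1)[OF G] U(1)]) auto
    moreover have "u \<in> V" using u U T by (simp add: V_def)
    moreover have "x v \<in> W" if "v \<in> V" for v
    proof -
      have v: "v \<in> carrier G" "cmod (x (inv\<^bsub>G\<^esub> u \<otimes>\<^bsub>G\<^esub> v) - 1) < e" using that U T by (auto simp: V_def)
      have "x v = x (u \<otimes>\<^bsub>G\<^esub> (inv\<^bsub>G\<^esub> u \<otimes>\<^bsub>G\<^esub> v))" using u v T by (simp flip: m_assoc)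
      also have "\<dots> = x u * x (inv\<^bsub>G\<^esub> u \<otimes>\<^bsub>G\<^esub> v)" using u v T by (intro mult) auto
      finally have "x v - x u = x u * (x (inv\<^bsub>G\<^esub> u \<otimes>\<^bsub>G\<^esub> v) - 1)" by (simp add: algebra_simps)
      then have "cmod (x v - x u) = cmod (x (inv\<^bsub>G\<^esub> u \<otimes>\<^bsub>G\<^esub> v) - 1)"
        using norm[of u] u T by (simp add: norm_mult)
      then have "dist (x u) (x v) < e"
        using v by (simp add: dist_norm norm_minus_commute)
      then show ?thesis using e by auto
    qed
    ultimately show "\<exists>V. openin T V \<and> u \<in> V \<and> V \<subseteq> {u \<in> topspace T. x u \<in> W}"
      using openin_subset by blast
  qed
  then have "continuous_map T euclidean x" by (simp add: continuous_map_def)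
  then have "continuous_map T circle_topology (restrict x (carrier G))"
    using norm T(2) by (auto simp: circle_topology_def continuous_map_in_subtopology
        intro: continuous_map_eq)
  moreover have "restrict x (carrier G) \<in> hom G circle_group"
    using mult norm by (auto simp: hom_def circle_group_def)
  ultimately show ?thesis by (simp add: characters_def continuous_hom_def)
qed

locale compact_group_mean = comm_group_mean G M for G (structure) and M +
  fixes T :: "'a topology"
  assumes compact_group: "compact_group G T"
begin

lemma topological_group: "topological_group G T" and compact_space: "compact_space T"
  using compact_group by (auto simp: compact_group_def)

lemma topspace: "topspace T = carrier G"
  using topological_groupD[OF topological_group] by simp

lemma continuous_bounded:
  "continuous_map T euclidean (f :: 'a \<Rightarrow> 'c::metric_space) \<Longrightarrow> bounded (f ` carrier G)"
  using continuous_map_bounded_image[OF compact_space] topspace by metis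

text \<open>Invariance and compactness make the mean faithful enough: finitely many translates of
  \<open>W\<close> cover the group, the sum of the corresponding translates of h is at least c
  everywhere, and each of them has the mean of h.\<close>

lemma mean_positive:
  assumes W: "openin T W" "w \<in> W" and h: "bounded (h ` carrier G)" "\<And>x. x \<in> carrier G \<Longrightarrow> 0 \<le> h x"
    and c: "0 < c" "\<And>x. x \<in> W \<Longrightarrow> c \<le> h x"
  shows "0 < M h"
proof -
  have w: "w \<in> carrier G" using W openin_subset topspace by blast
  define V where "V a = {x \<in> topspace T. a \<otimes> x \<in> W}" for a
  have openV: "openin T (V a)" if "a \<in> carrier G" for a
    unfolding V_def using that
    by (intro openin_continuous_map_preimage[OF continuous_map_translation(1)[OF topological_group] W(1)])
  have cover: "topspace T \<subseteq> \<Union> (V ` carrier G)"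
  proof
    fix x assume x: "x \<in> topspace T"
    then have "x \<in> V (w \<otimes> inv x)" using w W(2) topspace by (simp add: V_def m_assoc)
    then show "x \<in> \<Union> (V ` carrier G)" using x w topspace by blast
  qed
  have "\<exists>\<F>. finite \<F> \<and> \<F> \<subseteq> V ` carrier G \<and> topspace T \<subseteq> \<Union> \<F>"
    using compactinD[OF compact_space[unfolded compact_space_def], of "V ` carrier G"] openV cover
    by blast
  then obtain \<F> where \<F>: "finite \<F>" "\<F> \<subseteq> V ` carrier G" "topspace T \<subseteq> \<Union> \<F>" by blast
  obtain A where A: "A \<subseteq> carrier G" "finite A" "\<F> = V ` A" using finite_subset_image[OF \<F>(1,2)] by blast
  have b: "bounded ((\<lambda>x. h (a \<otimes> x)) ` carrier G)" if "a \<in> A" for a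
    using bounded_translate(1)[OF h(1)] A that by blast
  have "c \<le> M (\<lambda>x. \<Sum>a\<in>A. h (a \<otimes> x))"
  proof (intro lower bounded_image_sum b)
    fix x assume x: "x \<in> carrier G"
    then obtain a where a: "a \<in> A" "a \<otimes> x \<in> W" using A \<F>(3) topspace by (auto simp: V_def)
    then have "c \<le> h (a \<otimes> x)" using c by blast
    also have "\<dots> \<le> (\<Sum>a\<in>A. h (a \<otimes> x))"
      using a A x h(2) by (intro member_le_sum[where f = "\<lambda>a. h (a \<otimes> x)"]) auto
    finally show "c \<le> (\<Sum>a\<in>A. h (a \<otimes> x))" .
  qed
  also have "\<dots> = (\<Sum>a\<in>A. M (\<lambda>x. h (a \<otimes> x)))" by (intro sum b)
  also have "\<dots> = (\<Sum>a\<in>A. M h)" using A by (intro sum.cong refl shift h) auto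
  finally have "0 < card A * M h" using c(1) by simp
  then show ?thesis by (simp add: zero_less_mult_iff)
qed

text \<open>Let c be the nonzero mean of \<theta>x. By invariance c is x(v) times the mean over u of
  \<theta>(vu)x(u), whence (x(v) - 1)c is controlled by the uniform distance of \<theta> from its
  translate by v. Uniform continuity of f makes that distance small for v near the identity,
  although nothing is known about the continuity of x beforehand.\<close>

lemma ex_character_of_function:
  assumes f: "continuous_map T euclidean f" and a: "a \<in> carrier G" "f a \<noteq> 0"
  shows "\<exists>x\<in>characters G T. complex_mean (\<lambda>u. complex_of_real (autocorrelation f u) * x u) \<noteq> 0"
proof -
  note bf = continuous_bounded[OF f]
  obtain B where B: "\<And>x. x \<in> carrier G \<Longrightarrow> \<bar>f x\<bar> \<le> B" using bf by (auto simp: bounded_iff)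
  then have B0: "0 < B" using a by (meson less_le_trans zero_less_abs_iff)
  note ba = bounded_autocorrelation[OF bf]
  have f1: "0 < autocorrelation f \<one>"
  proof -
    define W where "W = {x \<in> topspace T. f x \<in> - cball 0 (\<bar>f a\<bar> / 2)}"
    have "openin T W" unfolding W_def using f by (rule openin_continuous_map_preimage) auto
    moreover have "a \<in> W" using a topspace by (simp add: W_def)
    moreover have "(\<bar>f a\<bar> / 2)\<^sup>2 \<le> f (\<one> \<otimes> x) * f x" if "x \<in> W" for x
    proof -
      have "\<bar>f a\<bar> / 2 \<le> \<bar>f x\<bar>" "x \<in> carrier G" using that topspace by (auto simp: W_def)
      then have "(\<bar>f a\<bar> / 2)\<^sup>2 \<le> \<bar>f x\<bar>\<^sup>2" by (intro power_mono) auto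
      then show ?thesis using \<open>x \<in> carrier G\<close> by (simp add: power2_eq_square)
    qed
    ultimately show ?thesis
      unfolding autocorrelation_def using a(2) bf
      by (intro mean_positive[of W a _ "(\<bar>f a\<bar> / 2)\<^sup>2"] bounded_image_mult bounded_translate) auto
  qed
  have near: "\<exists>U. openin T U \<and> \<one> \<in> U \<and>
    (\<forall>v\<in>U. \<forall>u\<in>carrier G. \<bar>autocorrelation f (v \<otimes> u) - autocorrelation f u\<bar> \<le> e)" if e: "0 < e" for e
  proof -
    obtain U where U: "openin T U" "\<one> \<in> U" "\<forall>v\<in>U. \<forall>t\<in>carrier G. \<bar>f (v \<otimes> t) - f t\<bar> < e / B"
      using compact_group_uniformly_continuous[OF compact_group f, of "e / B"] e B0 by auto
    have "\<bar>autocorrelation f (v \<otimes> u) - autocorrelation f u\<bar> \<le> e" if v: "v \<in> U" and u: "u \<in> carrier G" for v u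
    proof -
      have v': "v \<in> carrier G" using v U(1) openin_subset topspace by blast
      have b: "bounded ((\<lambda>t. f (v \<otimes> u \<otimes> t) * f t) ` carrier G)" "bounded ((\<lambda>t. f (u \<otimes> t) * f t) ` carrier G)"
        using u v' by (auto intro!: bounded_image_mult bounded_translate bf)
      have "autocorrelation f (v \<otimes> u) - autocorrelation f u = M (\<lambda>t. f (v \<otimes> u \<otimes> t) * f t - f (u \<otimes> t) * f t)"
        unfolding autocorrelation_def by (rule diff[OF b, symmetric])
      also have "\<bar>\<dots>\<bar> \<le> e"
      proof (intro abs_le bounded_image_diff b)
        fix t assume t: "t \<in> carrier G"
        have "\<bar>f (v \<otimes> u \<otimes> t) * f t - f (u \<otimes> t) * f t\<bar> = \<bar>f (v \<otimes> (u \<otimes> t)) - f (u \<otimes> t)\<bar> * \<bar>f t\<bar>"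
          using u t v' by (simp add: m_assoc flip: left_diff_distrib abs_mult)
        also have "\<dots> \<le> e / B * B"
          using U(3) v u t B[OF t] e B0 by (intro mult_mono) (auto intro: less_imp_le)
        finally show "\<bar>f (v \<otimes> u \<otimes> t) * f t - f (u \<otimes> t) * f t\<bar> \<le> e" using B0 by simp
      qed
      finally show ?thesis .
    qed
    then show ?thesis using U by blast
  qed
  have f2: "0 < M (\<lambda>u. autocorrelation f u ^ 2)"
  proof -
    let ?r = "autocorrelation f \<one> / 2"
    obtain U where U: "openin T U" "\<one> \<in> U"
      "\<forall>v\<in>U. \<forall>u\<in>carrier G. \<bar>autocorrelation f (v \<otimes> u) - autocorrelation f u\<bar> \<le> ?r"
      using near[of ?r] f1 by auto
    have "?r ^ 2 \<le> autocorrelation f v ^ 2" if "v \<in> U" for v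
    proof -
      have "v \<in> carrier G" using that U(1) openin_subset topspace by blast
      moreover from this have "\<bar>autocorrelation f (v \<otimes> \<one>) - autocorrelation f \<one>\<bar> \<le> ?r"
        using U(3) that one_closed by blast
      ultimately have "\<bar>autocorrelation f v - autocorrelation f \<one>\<bar> \<le> ?r" by simp
      then have "?r \<le> autocorrelation f v" by linarith
      then show ?thesis using f1 by (intro power_mono) auto
    qed
    then show ?thesis
      using f1 by (intro mean_positive[OF U(1,2), of _ "?r ^ 2"] bounded_image_power ba) auto
  qed
  obtain x where mult: "\<And>u a. u \<in> carrier G \<Longrightarrow> a \<in> carrier G \<Longrightarrow> x (u \<otimes> a) = x u * x a"
    and norm: "\<And>u. u \<in> carrier G \<Longrightarrow> cmod (x u) = 1"
    and pos: "0 < M (\<lambda>u. autocorrelation f u * Re (x u))"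
    using ex_character_autocorrelation[OF bf f1 f2] by blast
  have bx: "bounded (x ` carrier G)" using norm by (intro bounded_imageI[of _ _ 1]) simp
  let ?\<theta> = "\<lambda>u. complex_of_real (autocorrelation f u)"
  define c where "c = complex_mean (\<lambda>u. ?\<theta> u * x u)"
  have b: "bounded ((\<lambda>u. ?\<theta> u * x u) ` carrier G)"
    by (intro bounded_image_mult bounded_image_of_real ba bx)
  have "Re c = M (\<lambda>u. autocorrelation f u * Re (x u))" by (simp add: c_def complex_mean_def)
  then have c: "c \<noteq> 0" using pos by auto
  have "restrict x (carrier G) \<in> characters G T"
  proof (rule continuous_hom_of_continuous_at_one[OF topological_group mult norm])
    fix e :: real assume e: "0 < e"
    \<comment> \<open>One factor 2 is lost in \<open>complex_mean_norm_le\<close>, another yields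
      the strict inequality.\<close>
    let ?e = "e * cmod c / 4"
    obtain U where U: "openin T U" "\<one> \<in> U"
      "\<forall>v\<in>U. \<forall>u\<in>carrier G. \<bar>autocorrelation f (v \<otimes> u) - autocorrelation f u\<bar> \<le> ?e"
      using near[of ?e] e c by auto
    have "cmod (x v - 1) < e" if v: "v \<in> U" for v
    proof -
      have v': "v \<in> carrier G" using v U(1) openin_subset topspace by blast
      have b': "bounded ((\<lambda>u. ?\<theta> (v \<otimes> u) * x u) ` carrier G)"
        by (intro bounded_image_mult bounded_image_of_real bounded_translate ba bx v')
      have "c = complex_mean (\<lambda>u. ?\<theta> (v \<otimes> u) * x (v \<otimes> u))"
        unfolding c_def using complex_mean_shift[OF v' b] by simp
      also have "\<dots> = complex_mean (\<lambda>u. x v * (?\<theta> (v \<otimes> u) * x u))"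
        using bounded_translate(1)[OF b v'] v' by (intro complex_mean_cong) (auto simp: mult)
      also have "\<dots> = x v * complex_mean (\<lambda>u. ?\<theta> (v \<otimes> u) * x u)" by (rule complex_mean_scale[OF b'])
      finally have "c - x v * c = x v * (complex_mean (\<lambda>u. ?\<theta> (v \<otimes> u) * x u) - c)"
        by (simp add: right_diff_distrib)
      also have "\<dots> = x v * complex_mean (\<lambda>u. ?\<theta> (v \<otimes> u) * x u - ?\<theta> u * x u)"
        unfolding c_def complex_mean_diff[OF b' b] ..
      finally have "cmod (c - x v * c) = cmod (complex_mean (\<lambda>u. ?\<theta> (v \<otimes> u) * x u - ?\<theta> u * x u))"
        using norm[OF v'] by (simp add: norm_mult)
      also have "\<dots> \<le> 2 * ?e"
      proof (intro complex_mean_norm_le bounded_image_diff b b')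
        fix u assume u: "u \<in> carrier G"
        have "?\<theta> (v \<otimes> u) * x u - ?\<theta> u * x u = complex_of_real (autocorrelation f (v \<otimes> u) - autocorrelation f u) * x u"
          by (simp add: left_diff_distrib)
        then show "cmod (?\<theta> (v \<otimes> u) * x u - ?\<theta> u * x u) \<le> ?e"
          using U(3) v u norm[OF u] by (simp add: norm_mult del: of_real_diff)
      qed
      also have "cmod (c - x v * c) = cmod (x v - 1) * cmod c"
        by (metis left_diff_distrib mult_1 norm_minus_commute norm_mult)
      finally have "cmod (x v - 1) * cmod c \<le> (e / 2) * cmod c" by simp
      then have "cmod (x v - 1) \<le> e / 2" using c by (simp add: mult_le_cancel_right)
      then show ?thesis using e by simp
    qed
    then show "\<exists>U. openin T U \<and> \<one> \<in> U \<and> (\<forall>a\<in>U. cmod (x a - 1) < e)" using U by blast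
  qed
  moreover have "complex_mean (\<lambda>u. ?\<theta> u * restrict x (carrier G) u) = c"
    unfolding c_def by (rule complex_mean_cong[OF b, symmetric]) simp
  ultimately show ?thesis using c by metis
qed

text \<open>Urysohn's lemma gives g with value 0 at the identity and 1 at a. For f(t) = g(t) - g(at)
  the autocorrelation has the form \<theta>(u) = \<alpha>(u) - \<alpha>(au). If x(a) were 1, the
  mean of \<theta>x would be the difference of the means of \<alpha>x and of its translate by a,
  which is 0; so a character that detects \<theta> is not trivial at a.\<close>

lemma ex_separating_character:
  assumes a: "a \<in> carrier G" "a \<noteq> \<one>"
  shows "\<exists>x\<in>characters G T. x a \<noteq> 1"
proof -
  note T = topological_groupD[OF topological_group]
  have "normal_space T"
    using compact_Hausdorff_or_regular_imp_normal_space compact_space T(3) by blast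
  moreover have "closedin T {a}" "closedin T {\<one>}"
    using a T by (auto intro!: closedin_Hausdorff_singleton)
  ultimately obtain g :: "'a \<Rightarrow> real" where g: "continuous_map T (top_of_set {0..1}) g" "g ` {\<one>} \<subseteq> {0}" "g ` {a} \<subseteq> {1}"
    using Urysohn_lemma[of T "{\<one>}" "{a}" 0 1] a by (auto simp: disjnt_def)
  have g': "continuous_map T euclidean g" using g(1) by (simp add: continuous_map_in_subtopology)
  have ga: "continuous_map T euclidean (\<lambda>t. g (a \<otimes> t))"
    using continuous_map_compose[OF continuous_map_translation(1)[OF topological_group a(1)] g']
    by (simp add: o_def)
  define f where "f t = g t - g (a \<otimes> t)" for t
  have f: "continuous_map T euclidean f"
    unfolding f_def by (intro continuous_map_diff g' ga)
  have "f \<one> \<noteq> 0" using g a by (simp add: f_def)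
  then obtain x where x: "x \<in> characters G T"
    "complex_mean (\<lambda>u. complex_of_real (autocorrelation f u) * x u) \<noteq> 0"
    using ex_character_of_function[OF f one_closed] by blast
  have hom: "x (u \<otimes> v) = x u * x v" "cmod (x u) = 1" if "u \<in> carrier G" "v \<in> carrier G" for u v
    using x(1) that by (auto simp: characters_def continuous_hom_def hom_def circle_group_def)
  note bf = continuous_bounded[OF f] and bg = continuous_bounded[OF g']
  have bx: "bounded (x ` carrier G)" using hom by (intro bounded_imageI[of _ _ 1]) simp
  \<comment> \<open>Only the translated factor of the autocorrelation is split into g and its
    translate; the other one remains f.\<close>
  define \<alpha> where "\<alpha> u = M (\<lambda>t. g (u \<otimes> t) * f t)" for u
  have bgf: "bounded ((\<lambda>t. g (u \<otimes> t) * f t) ` carrier G)" if "u \<in> carrier G" for u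
    by (intro bounded_image_mult bounded_translate bf bg that)
  have b\<alpha>: "bounded (\<alpha> ` carrier G)"
  proof -
    obtain B where B: "\<And>x. x \<in> carrier G \<Longrightarrow> \<bar>f x\<bar> \<le> B" using bf by (auto simp: bounded_iff)
    obtain C where C: "\<And>x. x \<in> carrier G \<Longrightarrow> \<bar>g x\<bar> \<le> C" using bg by (auto simp: bounded_iff)
    have "\<bar>\<alpha> u\<bar> \<le> C * B" if "u \<in> carrier G" for u
      unfolding \<alpha>_def
    proof (intro abs_le bgf that)
      fix t assume "t \<in> carrier G"
      then show "\<bar>g (u \<otimes> t) * f t\<bar> \<le> C * B"
        using B[of t] C[of "u \<otimes> t"] that unfolding abs_mult by (intro mult_mono) auto
    qed
    then show ?thesis by (intro bounded_imageI[of _ _ "C * B"]) simp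
  qed
  have ac: "autocorrelation f u = \<alpha> u - \<alpha> (a \<otimes> u)" if u: "u \<in> carrier G" for u
  proof -
    have b: "bounded ((\<lambda>t. g (u \<otimes> t) * f t - g (a \<otimes> u \<otimes> t) * f t) ` carrier G)"
      using u a by (intro bounded_image_diff bgf) auto
    have "autocorrelation f u = M (\<lambda>t. g (u \<otimes> t) * f t - g (a \<otimes> u \<otimes> t) * f t)"
      unfolding autocorrelation_def using u a
      by (intro cong[OF b, symmetric]) (simp add: f_def[of "u \<otimes> _"] m_assoc left_diff_distrib)
    also have "\<dots> = \<alpha> u - \<alpha> (a \<otimes> u)"
      unfolding \<alpha>_def using u a by (intro diff bgf) auto
    finally show ?thesis .
  qed
  have "x a \<noteq> 1"
  proof
    assume xa: "x a = 1"
    have b1: "bounded ((\<lambda>u. complex_of_real (\<alpha> u) * x u) ` carrier G)"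
      by (intro bounded_image_mult bounded_image_of_real b\<alpha> bx)
    note b2 = bounded_translate(1)[OF b1 a(1)]
    have "complex_mean (\<lambda>u. complex_of_real (autocorrelation f u) * x u)
        = complex_mean (\<lambda>u. complex_of_real (\<alpha> u) * x u - complex_of_real (\<alpha> (a \<otimes> u)) * x (a \<otimes> u))"
      using a xa by (intro complex_mean_cong[OF bounded_image_diff[OF b1 b2], symmetric])
        (simp add: ac hom left_diff_distrib)
    also have "\<dots> = 0" unfolding complex_mean_diff[OF b1 b2] using complex_mean_shift[OF a(1) b1] by simp
    finally show False using x(2) by simp
  qed
  then show ?thesis using x(1) by blast
qed

end

theorem compact_abelian_group_separating_character:
  assumes "comm_group G" "compact_group G T" "a \<in> carrier G" "a \<noteq> \<one>\<^bsub>G\<^esub>"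
  shows "\<exists>x\<in>characters G T. x a \<noteq> 1"
proof -
  interpret comm_group G by fact
  obtain M where "invariant_mean G M" using ex_invariant_mean by blast
  then interpret compact_group_mean G M T using assms by unfold_locales auto
  show ?thesis using ex_separating_character assms by blast
qed

section \<open>The dual of a discrete abelian group\<close>

lemma mem_characters_iff:
  assumes "topspace T = carrier G"
  shows "f \<in> characters G T \<longleftrightarrow> f \<in> extensional (carrier G) \<and> continuous_map T euclidean f \<and>
    (\<forall>x\<in>carrier G. cmod (f x) = 1) \<and> (\<forall>x\<in>carrier G. \<forall>y\<in>carrier G. f (x \<otimes>\<^bsub>G\<^esub> y) = f x * f y)"
  using assms by (auto simp: characters_def continuous_hom_def circle_topology_def circle_group_def hom_def
      continuous_map_in_subtopology Pi_iff)

lemma continuous_map_complex_mult: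
  assumes "continuous_map X euclidean f" "continuous_map X euclidean g"
  shows "continuous_map X euclidean (\<lambda>x. f x * g x :: complex)"
proof -
  have 1: "continuous_map (euclidean :: (complex \<times> complex) topology) euclidean (\<lambda>z. fst z * snd z)"
    by (simp add: continuous_map_iff_continuous2 continuous_intros)
  have "continuous_map X (euclidean :: (complex \<times> complex) topology) (\<lambda>x. (f x, g x))"
    using continuous_map_pairedI[OF assms] by simp
  from continuous_map_compose[OF this 1] show ?thesis by (simp add: o_def)
qed

lemma continuous_map_complex_cnj:
  assumes "continuous_map X euclidean f"
  shows "continuous_map X euclidean (\<lambda>x. cnj (f x))"
proof -
  have "continuous_map euclidean euclidean cnj"
    by (simp add: continuous_map_iff_continuous2 continuous_intros)
  from continuous_map_compose[OF assms this] show ?thesis by (simp add: o_def)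
qed

lemma unit_mult_cnj: "cmod w = 1 \<Longrightarrow> w * cnj w = 1"
  using complex_norm_square[of w] by simp

lemma characters_closed:
  assumes "group G" "topspace T = carrier G"
  shows "restrict (\<lambda>x. 1) (carrier G) \<in> characters G T"
    and "f \<in> characters G T \<Longrightarrow> g \<in> characters G T \<Longrightarrow> restrict (\<lambda>x. f x * g x) (carrier G) \<in> characters G T"
    and "f \<in> characters G T \<Longrightarrow> restrict (\<lambda>x. cnj (f x)) (carrier G) \<in> characters G T"
proof -
  interpret group G by fact
  have r: "continuous_map T euclidean (restrict f (carrier G))" if "continuous_map T euclidean f"
    for f :: "_ \<Rightarrow> complex"
    using continuous_map_eq[OF that] assms(2) by simp
  show "restrict (\<lambda>x. 1) (carrier G) \<in> characters G T"
    unfolding mem_characters_iff[OF assms(2)] by (auto intro!: r)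
  show "restrict (\<lambda>x. f x * g x) (carrier G) \<in> characters G T"
    if "f \<in> characters G T" "g \<in> characters G T"
    using that unfolding mem_characters_iff[OF assms(2)]
    by (auto intro!: r continuous_map_complex_mult simp: norm_mult)
  show "restrict (\<lambda>x. cnj (f x)) (carrier G) \<in> characters G T" if "f \<in> characters G T"
    using that unfolding mem_characters_iff[OF assms(2)] by (auto intro!: r continuous_map_complex_cnj)
qed

text \<open>Continuity is vacuous for the discrete topology, so these are all homomorphisms from the
  character group to the circle; the points of the group contribute the evaluations among
  them.\<close>

definition bidual :: "('a, 'm) monoid_scheme \<Rightarrow> 'a topology \<Rightarrow> (('a \<Rightarrow> complex) \<Rightarrow> complex) set" where
  "bidual G T = characters (character_group G T) (discrete_topology (characters G T))"

definition bidual_topology :: "('a, 'm) monoid_scheme \<Rightarrow> 'a topology \<Rightarrow> (('a \<Rightarrow> complex) \<Rightarrow> complex) topology" where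
  "bidual_topology G T = pointwise_topology (character_group G T) (discrete_topology (characters G T))"

lemma mem_bidual_iff:
  "p \<in> bidual G T \<longleftrightarrow> p \<in> extensional (characters G T) \<and> (\<forall>f\<in>characters G T. cmod (p f) = 1) \<and>
    (\<forall>f\<in>characters G T. \<forall>g\<in>characters G T. p (restrict (\<lambda>x. f x * g x) (carrier G)) = p f * p g)"
  unfolding bidual_def by (subst mem_characters_iff) (auto simp: character_group_def)

lemma topspace_bidual: "topspace (bidual_topology G T) = bidual G T"
  unfolding bidual_topology_def pointwise_topology_def bidual_def
  by (auto simp: character_group_def characters_def continuous_hom_def circle_topology_def
      circle_group_def hom_def extensional_def PiE_def)

lemma continuous_map_bidual_eval:
  assumes "f \<in> characters G T"
  shows "continuous_map (bidual_topology G T) euclidean (\<lambda>p. p f)"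
proof -
  have "continuous_map (product_topology (\<lambda>_. circle_topology) (carrier (character_group G T))) circle_topology (\<lambda>p. p f)"
    using assms by (intro continuous_map_product_projection) (simp add: character_group_def)
  then have "continuous_map (bidual_topology G T) circle_topology (\<lambda>p. p f)"
    unfolding bidual_topology_def pointwise_topology_def by (rule continuous_map_from_subtopology)
  then show ?thesis by (simp add: circle_topology_def continuous_map_in_subtopology)
qed

lemma continuous_map_into_bidual:
  assumes "h \<in> topspace X \<rightarrow> bidual G T"
    and "\<And>f. f \<in> characters G T \<Longrightarrow> continuous_map X euclidean (\<lambda>z. h z f)"
  shows "continuous_map X (bidual_topology G T) h"
proof -
  have C: "carrier (character_group G T) = characters G T" by (simp add: character_group_def)
  have "continuous_map X circle_topology (\<lambda>z. h z f)" if "f \<in> characters G T" for f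
    using assms that by (auto simp: circle_topology_def continuous_map_in_subtopology Pi_iff mem_bidual_iff)
  moreover have "h ` topspace X \<subseteq> extensional (characters G T)"
    using assms(1) by (auto simp: mem_bidual_iff)
  ultimately show ?thesis using assms(1)
    unfolding bidual_topology_def pointwise_topology_def bidual_def[symmetric]
    by (auto simp: continuous_map_in_subtopology continuous_map_componentwise C)
qed

lemma Hausdorff_circle: "Hausdorff_space circle_topology"
  unfolding circle_topology_def by (simp add: Hausdorff_space_subtopology)

lemma Hausdorff_bidual: "Hausdorff_space (bidual_topology G T)"
  unfolding bidual_topology_def pointwise_topology_def
  by (intro Hausdorff_space_subtopology) (simp add: Hausdorff_space_product_topology Hausdorff_circle)

text \<open>The homomorphism equations, one for each pair of characters, cut a closed set out of a
  product of circles.\<close>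

lemma compact_bidual:
  assumes "group G" "topspace T = carrier G"
  shows "compact_space (bidual_topology G T)"
proof -
  let ?C = "carrier (character_group G T)" and ?F = "characters G T"
  let ?X = "product_topology (\<lambda>_. circle_topology) ?C"
  have C: "?C = ?F" by (simp add: character_group_def)
  have "compact_space circle_topology"
    using compact_sphere[of "0::complex" 1] unfolding circle_topology_def sphere_def
    by (simp add: compact_space_subtopology dist_norm)
  then have X: "compact_space ?X" by (simp add: compact_space_product_topology)
  have pr: "continuous_map ?X euclidean (\<lambda>p. p f)" if "f \<in> ?F" for f
    using continuous_map_product_projection[of f ?C "\<lambda>_. circle_topology"] that
    by (simp add: C circle_topology_def continuous_map_in_subtopology)
  have "bidual G T = topspace ?X \<inter> (\<Inter>f\<in>?F. \<Inter>g\<in>?F. {p \<in> topspace ?X. p (restrict (\<lambda>x. f x * g x) (carrier G)) = p f * p g})"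
    unfolding set_eq_iff mem_bidual_iff by (auto simp: C circle_topology_def PiE_iff)
  moreover have "closedin ?X {p \<in> topspace ?X. p (restrict (\<lambda>x. f x * g x) (carrier G)) = p f * p g}"
    if "f \<in> ?F" "g \<in> ?F" for f g
    using characters_closed(2)[OF assms that] that
    by (intro closedin_continuous_maps_eq[of euclidean] pr continuous_map_complex_mult) auto
  \<comment> \<open>Keeps the intersections over pairs from being indexed by the empty set.\<close>
  moreover have "?F \<noteq> {}" using characters_closed(1)[OF assms] by blast
  ultimately have "closedin ?X (bidual G T)"
    by (simp only:) (intro closedin_Int closedin_topspace closedin_INT)
  then have "compactin ?X (bidual G T)" using X by (rule closedin_compact_space[rotated])
  then show ?thesis
    unfolding bidual_topology_def pointwise_topology_def bidual_def[symmetric]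
    by (simp add: compact_space_subtopology)
qed

definition evaluation :: "('a, 'm) monoid_scheme \<Rightarrow> 'a topology \<Rightarrow> 'a \<Rightarrow> ('a \<Rightarrow> complex) \<Rightarrow> complex" where
  "evaluation G T a = (\<lambda>f\<in>characters G T. f a)"

lemma evaluation_in_bidual:
  assumes "group G" "topspace T = carrier G" "a \<in> carrier G"
  shows "evaluation G T a \<in> bidual G T"
  using assms characters_closed(2)[OF assms(1,2)]
  by (auto simp: mem_bidual_iff evaluation_def mem_characters_iff[OF assms(2)])

lemma bidual_approximate:
  assumes G: "comm_group G" "topspace T = carrier G" and p: "p \<in> bidual G T"
    and I: "finite I" "I \<subseteq> characters G T" and e: "0 < e"
  shows "\<exists>a\<in>carrier G. \<forall>f\<in>I. cmod (f a - p f) < e"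
proof -
  interpret comm_group G by fact
  show ?thesis
    using p characters_closed[OF is_group G(2)]
    by (intro characters_approximate[OF _ _ _ _ _ _ _ I e]) (auto simp: mem_characters_iff[OF G(2)] mem_bidual_iff)
qed

text \<open>A basic neighbourhood in the product topology restricts finitely many coordinates, so
  \<open>bidual_approximate\<close> reaches it.\<close>

lemma evaluation_dense:
  assumes G: "comm_group G" "topspace T = carrier G"
  shows "bidual_topology G T closure_of (evaluation G T ` carrier G) = bidual G T"
proof
  interpret comm_group G by fact
  show "bidual_topology G T closure_of (evaluation G T ` carrier G) \<subseteq> bidual G T"
    using closure_of_subset_topspace topspace_bidual by metis
  show "bidual G T \<subseteq> bidual_topology G T closure_of (evaluation G T ` carrier G)"
  proof
    fix p assume p: "p \<in> bidual G T"
    have "\<exists>y. y \<in> evaluation G T ` carrier G \<and> y \<in> U" if U: "openin (bidual_topology G T) U" "p \<in> U" for U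
    proof -
      let ?F = "characters G T"
      have C: "carrier (character_group G T) = ?F" by (simp add: character_group_def)
      have "bidual_topology G T = subtopology (product_topology (\<lambda>_. circle_topology) ?F) (bidual G T)"
        unfolding bidual_topology_def pointwise_topology_def bidual_def C ..
      then obtain V where V: "openin (product_topology (\<lambda>_. circle_topology) ?F) V" "U = V \<inter> bidual G T"
        using U(1) by (auto simp: openin_subtopology)
      then obtain W where W: "finite {f \<in> ?F. W f \<noteq> topspace circle_topology}"
        "\<forall>f\<in>?F. openin circle_topology (W f)" "p \<in> PiE ?F W" "PiE ?F W \<subseteq> V"
        using U(2) unfolding openin_product_topology_alt by blast
      let ?I = "{f \<in> ?F. W f \<noteq> topspace circle_topology}"
      have "\<exists>e>0. \<forall>z. cmod z = 1 \<longrightarrow> cmod (z - p f) < e \<longrightarrow> z \<in> W f" if f: "f \<in> ?F" for f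
      proof -
        obtain Q where Q: "open Q" "W f = Q \<inter> {z. cmod z = 1}"
          using W(2) f unfolding circle_topology_def by (metis Int_commute openin_open)
        moreover have "p f \<in> Q" using W(3) f Q by (auto simp: PiE_iff)
        ultimately obtain e where "0 < e" "ball (p f) e \<subseteq> Q" using openE by blast
        then show ?thesis using Q by (intro exI[of _ e]) (auto simp: dist_norm norm_minus_commute subset_iff)
      qed
      then obtain e where e: "\<And>f. f \<in> ?F \<Longrightarrow> 0 < e f"
        "\<And>f z. f \<in> ?F \<Longrightarrow> cmod z = 1 \<Longrightarrow> cmod (z - p f) < e f \<Longrightarrow> z \<in> W f" by metis
      \<comment> \<open>The inserted 1 covers the case in which no coordinate is restricted.\<close>
      define d where "d = Min (insert 1 (e ` ?I))"
      have "0 < d" unfolding d_def using W(1) e(1) by (subst Min_gr_iff) auto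
      then obtain a where a: "a \<in> carrier G" "\<And>f. f \<in> ?I \<Longrightarrow> cmod (f a - p f) < d"
        using bidual_approximate[OF G p W(1), of d] by auto
      have "f a \<in> W f" if f: "f \<in> ?F" for f
      proof -
        have fa: "cmod (f a) = 1" using f a(1) by (simp add: mem_characters_iff[OF G(2)])
        show ?thesis
        proof (cases "f \<in> ?I")
          case True
          then have "d \<le> e f" unfolding d_def using W(1) by (intro Min_le) auto
          then show ?thesis using e(2)[OF f fa] a(2)[OF True] by linarith
        next
          case False
          then show ?thesis using f fa by (simp add: circle_topology_def)
        qed
      qed
      then have "evaluation G T a \<in> PiE ?F W" by (auto simp: evaluation_def)
      then show ?thesis using a(1) W(4) V(2) evaluation_in_bidual[OF is_group G(2) a(1)] by blast
    qed
    then show "p \<in> bidual_topology G T closure_of (evaluation G T ` carrier G)"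
      using p by (auto simp: in_closure_of topspace_bidual)
  qed
qed

section \<open>Factoring through compact groups\<close>

text \<open>Test groups may be noncommutative, but only the closure of the image matters. Closure
  under multiplication and commutativity pass to limits in one variable at a time: first with the
  other variable in the image, then in the closure.\<close>

lemma closure_of_abelian_image:
  assumes A: "comm_group A" and D: "compact_group D V" and g: "g \<in> hom A D"
    and K: "K = V closure_of (g ` carrier A)"
  shows "comm_group (D\<lparr>carrier := K\<rparr>)" "compact_group (D\<lparr>carrier := K\<rparr>) (subtopology V K)"
    "g ` carrier A \<subseteq> K" "K \<subseteq> carrier D"
proof -
  interpret A: comm_group A by fact
  have DV: "topological_group D V" "compact_space V" using D by (auto simp: compact_group_def)
  note T = topological_groupD[OF DV(1)]
  interpret D: group D by (rule T(1))
  interpret g: group_hom A D g by unfold_locales (rule g)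
  let ?S = "g ` carrier A"
  have S: "?S \<subseteq> carrier D" by auto
  show K1: "?S \<subseteq> K" using S T(2) unfolding K by (simp add: closure_of_subset)
  have closedK: "closedin V K" unfolding K by simp
  show K2: "K \<subseteq> carrier D" using closedin_subset[OF closedK] T(2) by simp
  note trans = continuous_map_translation[OF DV(1)]
  have m1: "s \<otimes>\<^bsub>D\<^esub> y \<in> K" if s: "s \<in> ?S" and y: "y \<in> K" for s y
  proof (rule forall_in_closure_of[OF y[unfolded K]])
    show "s \<otimes>\<^bsub>D\<^esub> x \<in> K" if "x \<in> ?S" for x
    proof -
      have "s \<otimes>\<^bsub>D\<^esub> x \<in> ?S" using s that by (auto simp flip: g.hom_mult)
      then show ?thesis using K1 by blast
    qed
    show "closedin V {x \<in> topspace V. s \<otimes>\<^bsub>D\<^esub> x \<in> K}"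
      using s S by (intro closedin_continuous_map_preimage[OF trans(1)] closedK) auto
  qed
  have mK: "x \<otimes>\<^bsub>D\<^esub> y \<in> K" if x: "x \<in> K" and y: "y \<in> K" for x y
  proof (rule forall_in_closure_of[OF x[unfolded K]])
    show "closedin V {x \<in> topspace V. x \<otimes>\<^bsub>D\<^esub> y \<in> K}"
      using y K2 by (intro closedin_continuous_map_preimage[OF trans(2)] closedK) auto
  qed (rule m1[OF _ y])
  have iK: "inv\<^bsub>D\<^esub> x \<in> K" if x: "x \<in> K" for x
  proof (rule forall_in_closure_of[OF x[unfolded K]])
    show "inv\<^bsub>D\<^esub> s \<in> K" if "s \<in> ?S" for s
    proof -
      have "inv\<^bsub>D\<^esub> s \<in> ?S" using that by (auto simp flip: g.hom_inv)
      then show ?thesis using K1 by blast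
    qed
    show "closedin V {x \<in> topspace V. inv\<^bsub>D\<^esub> x \<in> K}"
      by (intro closedin_continuous_map_preimage[OF _ closedK] continuous_map_group_inv[OF DV(1)]) simp
  qed
  have oK: "\<one>\<^bsub>D\<^esub> \<in> K" using K1 g.hom_one A.one_closed by (metis image_subset_iff)
  have sub: "subgroup K D" by (rule D.subgroupI) (use K2 oK mK iK in auto)
  have c1: "s \<otimes>\<^bsub>D\<^esub> y = y \<otimes>\<^bsub>D\<^esub> s" if s: "s \<in> ?S" and y: "y \<in> K" for s y
  proof (rule forall_in_closure_of_eq[OF y[unfolded K] T(3)])
    show "s \<otimes>\<^bsub>D\<^esub> x = x \<otimes>\<^bsub>D\<^esub> s" if "x \<in> ?S" for x
      using s that by (auto simp flip: g.hom_mult simp: A.m_comm)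
  qed (use s S in \<open>auto intro!: trans\<close>)
  have cK: "x \<otimes>\<^bsub>D\<^esub> y = y \<otimes>\<^bsub>D\<^esub> x" if x: "x \<in> K" and y: "y \<in> K" for x y
    by (rule forall_in_closure_of_eq[OF x[unfolded K] T(3)]) (use y K2 c1[OF _ y] in \<open>auto intro!: trans\<close>)
  have gK: "group (D\<lparr>carrier := K\<rparr>)" by (rule D.subgroup_imp_group[OF sub])
  show "comm_group (D\<lparr>carrier := K\<rparr>)"
    by (rule group.group_comm_groupI[OF gK]) (use cK in auto)
  have ts: "topspace (subtopology V K) = K" using K2 T(2) by auto
  have into: "continuous_map Z (subtopology V K) h" if "continuous_map Z V h" "h \<in> topspace Z \<rightarrow> K" for Z h
    using that by (auto simp: continuous_map_in_subtopology)
  have m: "continuous_map (prod_topology (subtopology V K) (subtopology V K)) (subtopology V K) (\<lambda>z. fst z \<otimes>\<^bsub>D\<^esub> snd z)"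
    by (intro into continuous_map_group_mult[OF DV(1)] continuous_map_into_fulltopology[OF continuous_map_fst]
        continuous_map_into_fulltopology[OF continuous_map_snd]) (use ts mK in auto)
  have "continuous_map (subtopology V K) (subtopology V K) (\<lambda>x. inv\<^bsub>D\<^esub> x)"
    by (intro into continuous_map_group_inv[OF DV(1)] continuous_map_from_subtopology) (use ts iK in auto)
  then have "continuous_map (subtopology V K) (subtopology V K) (\<lambda>x. inv\<^bsub>D\<lparr>carrier := K\<rparr>\<^esub> x)"
    by (rule continuous_map_eq) (use ts D.m_inv_consistent[OF sub] in auto)
  then have "topological_group (D\<lparr>carrier := K\<rparr>) (subtopology V K)"
    unfolding topological_group_def using gK ts m Hausdorff_space_subtopology[OF T(3)]
    by (simp add: case_prod_unfold)
  moreover have "compact_space (subtopology V K)"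
    using closedin_compact_space[OF DV(2) closedK] by (rule compact_space_subtopology)
  ultimately show "compact_group (D\<lparr>carrier := K\<rparr>) (subtopology V K)" by (simp add: compact_group_def)
qed

text \<open>A value k exists because p is approximated by points of A, whose images lie in the
  compact group \<open>H\<close>; it is unique because characters separate the points of
  \<open>H\<close>. The homomorphism law is phrased with pointwise products, the form that the group
  of types will have.\<close>

lemma factor_through_bidual:
  assumes A: "comm_group A" "topological_group A TA" and D: "compact_group D V"
    and g: "g \<in> continuous_hom A TA D V"
  shows "\<exists>h. continuous_map (bidual_topology A TA) V h \<and>
    (\<forall>p\<in>bidual A TA. \<forall>q\<in>bidual A TA. h (\<lambda>f\<in>characters A TA. p f * q f) = h p \<otimes>\<^bsub>D\<^esub> h q) \<and>
    (\<forall>a\<in>carrier A. h (evaluation A TA a) = g a)"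
proof -
  interpret A: comm_group A by (rule A(1))
  note TA = topological_groupD[OF A(2)]
  have DV: "topological_group D V" "compact_space V" using D by (auto simp: compact_group_def)
  note T = topological_groupD[OF DV(1)]
  have gh: "g \<in> hom A D" "continuous_map TA V g" using g by (auto simp: continuous_hom_def)
  define K where "K = V closure_of (g ` carrier A)"
  define H where "H = D\<lparr>carrier := K\<rparr>"
  define TH where "TH = subtopology V K"
  note clo = closure_of_abelian_image[OF A(1) D gh(1) K_def]
  have H: "comm_group H" "compact_group H TH" using clo by (simp_all add: H_def TH_def)
  interpret D: group D by (rule T(1))
  interpret H: comm_group H by (rule H(1))
  have Hs: "carrier H = K" "\<And>x y. x \<otimes>\<^bsub>H\<^esub> y = x \<otimes>\<^bsub>D\<^esub> y" by (simp_all add: H_def)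
  have TH: "topspace TH = carrier H" "compact_space TH" "Hausdorff_space TH" "topological_group H TH"
    using H(2) by (auto simp: compact_group_def topological_group_def)
  have gK: "g a \<in> carrier H" if "a \<in> carrier A" for a using clo(3) that Hs by auto
  define r where "r \<psi> = (\<lambda>a\<in>carrier A. \<psi> (g a))" for \<psi> :: "_ \<Rightarrow> complex"
  let ?\<Psi> = "characters H TH"
  note ch = mem_characters_iff[OF TH(1)]
  have gTH: "continuous_map TA TH g"
    unfolding TH_def using gh(2) clo(3) TA(2) by (auto simp: continuous_map_in_subtopology)
  have r: "r \<psi> \<in> characters A TA" if \<psi>: "\<psi> \<in> ?\<Psi>" for \<psi>
    unfolding mem_characters_iff[OF TA(2)]
  proof (intro conjI ballI)
    have "continuous_map TA euclidean (\<psi> \<circ> g)"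
      using gTH \<psi> by (intro continuous_map_compose[of _ TH]) (auto simp: ch)
    then show "continuous_map TA euclidean (r \<psi>)"
      by (rule continuous_map_eq) (simp add: r_def TA(2))
  next
    fix x y assume xy: "x \<in> carrier A" "y \<in> carrier A"
    then have "g (x \<otimes>\<^bsub>A\<^esub> y) = g x \<otimes>\<^bsub>H\<^esub> g y" using gh(1) by (simp add: hom_def Hs)
    then show "r \<psi> (x \<otimes>\<^bsub>A\<^esub> y) = r \<psi> x * r \<psi> y" using xy \<psi> gK by (simp add: r_def ch)
  qed (use \<psi> gK in \<open>auto simp: r_def ch\<close>)
  have ex: "\<exists>k\<in>carrier H. \<forall>\<psi>\<in>?\<Psi>. \<psi> k = p (r \<psi>)" if p: "p \<in> bidual A TA" for p
  proof -
    \<comment> \<open>The exact equations are replaced by closed approximations: any finitely many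
      of these hold at the image of one point of A, while the equations themselves need not.\<close>
    define C where "C = (\<lambda>(\<psi>, n::nat). {k \<in> topspace TH. \<psi> k \<in> cball (p (r \<psi>)) (1 / Suc n)})"
    have "\<Inter> (C ` (?\<Psi> \<times> UNIV)) \<noteq> {}"
    proof (rule TH(2)[unfolded compact_space_fip, rule_format], intro conjI ballI allI impI)
      fix c assume "c \<in> C ` (?\<Psi> \<times> UNIV)"
      then obtain z where "z \<in> ?\<Psi> \<times> (UNIV :: nat set)" "c = C z" by blast
      then obtain \<psi> n where \<psi>: "\<psi> \<in> ?\<Psi>" "c = {k \<in> topspace TH. \<psi> k \<in> cball (p (r \<psi>)) (1 / Suc n)}"
        by (cases z) (auto simp: C_def)
      then have "continuous_map TH euclidean \<psi>" by (simp add: ch)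
      then show "closedin TH c" unfolding \<psi>(2) by (rule closedin_continuous_map_preimage) simp
    next
      fix \<F> assume \<F>: "finite \<F> \<and> \<F> \<subseteq> C ` (?\<Psi> \<times> UNIV)"
      then obtain P where P: "P \<subseteq> ?\<Psi> \<times> UNIV" "finite P" "\<F> = C ` P"
        using finite_subset_image[of \<F> C "?\<Psi> \<times> UNIV"] by blast
      define m where "m = Max (insert 0 (snd ` P))"
      obtain a where a: "a \<in> carrier A" "\<forall>f\<in>(r \<circ> fst) ` P. cmod (f a - p f) < 1 / Suc m"
      proof -
        have 1: "finite ((r \<circ> fst) ` P)" using P(2) by simp
        have 2: "(r \<circ> fst) ` P \<subseteq> characters A TA" using P(1) r by auto
        have 3: "0 < 1 / real (Suc m)" by simp
        show thesis using bidual_approximate[OF A(1) TA(2) p 1 2 3] that by blast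
      qed
      have "g a \<in> C z" if z: "z \<in> P" for z
      proof -
        obtain \<psi> n where zz: "z = (\<psi>, n)" "\<psi> \<in> ?\<Psi>" using P(1) z by (cases z) auto
        have "n \<le> m" unfolding m_def using z zz P(2) by (intro Max_ge) force+
        then have "1 / real (Suc m) \<le> 1 / real (Suc n)" by (intro divide_left_mono) auto
        moreover have "cmod (r \<psi> a - p (r \<psi>)) < 1 / Suc m" using a(2) z zz by force
        ultimately have "dist (p (r \<psi>)) (\<psi> (g a)) \<le> 1 / Suc n"
          using a(1) by (simp add: r_def dist_norm norm_minus_commute)
        then show ?thesis using gK[OF a(1)] TH(1) by (simp add: zz C_def)
      qed
      then show "\<Inter> \<F> \<noteq> {}" using P(3) by blast
    qed
    then obtain k where k: "\<And>\<psi> n. \<psi> \<in> ?\<Psi> \<Longrightarrow> k \<in> C (\<psi>, n)" by blast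
    have "k \<in> carrier H" using k[OF characters_closed(1)[OF H.is_group TH(1)], of 0] TH(1) by (simp add: C_def)
    moreover have "\<psi> k = p (r \<psi>)" if "\<psi> \<in> ?\<Psi>" for \<psi>
    proof -
      have le: "dist (p (r \<psi>)) (\<psi> k) \<le> 1 / Suc n" for n using k[OF that, of n] by (simp add: C_def)
      have "(\<lambda>n. 1 / real (Suc n)) \<longlonglongrightarrow> 0" by (rule LIMSEQ_Suc[OF lim_const_over_n])
      then have "dist (p (r \<psi>)) (\<psi> k) \<le> 0"
        by (rule tendsto_lowerbound) (auto intro!: always_eventually le simp del: of_nat_Suc)
      then show ?thesis by simp
    qed
    ultimately show ?thesis by blast
  qed
  have uniq: "k = k'" if k: "k \<in> carrier H" "k' \<in> carrier H" "\<forall>\<psi>\<in>?\<Psi>. \<psi> k = \<psi> k'" for k k'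
  proof (rule ccontr)
    assume "k \<noteq> k'"
    then have "k \<otimes>\<^bsub>H\<^esub> inv\<^bsub>H\<^esub> k' \<noteq> \<one>\<^bsub>H\<^esub>"
      using k by (metis H.inv_closed H.inv_inv H.inv_equality)
    then obtain \<psi> where \<psi>: "\<psi> \<in> ?\<Psi>" "\<psi> (k \<otimes>\<^bsub>H\<^esub> inv\<^bsub>H\<^esub> k') \<noteq> 1"
      using compact_abelian_group_separating_character[OF H, of "k \<otimes>\<^bsub>H\<^esub> inv\<^bsub>H\<^esub> k'"] k by auto
    have mult: "\<psi> (x \<otimes>\<^bsub>H\<^esub> y) = \<psi> x * \<psi> y" if "x \<in> carrier H" "y \<in> carrier H" for x y
      using \<psi>(1) that by (simp add: ch)
    have "\<psi> k = \<psi> k'" using k(3) \<psi>(1) by blast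
    then have "\<psi> (k \<otimes>\<^bsub>H\<^esub> inv\<^bsub>H\<^esub> k') = \<psi> (k' \<otimes>\<^bsub>H\<^esub> inv\<^bsub>H\<^esub> k')"
      using k(1,2) by (simp only: mult H.inv_closed)
    also have "\<dots> = \<psi> \<one>\<^bsub>H\<^esub>" using k by simp
    also have "\<dots> = 1"
    proof -
      have "\<psi> \<one>\<^bsub>H\<^esub> * \<psi> \<one>\<^bsub>H\<^esub> = \<psi> \<one>\<^bsub>H\<^esub>" "cmod (\<psi> \<one>\<^bsub>H\<^esub>) = 1"
        using \<psi>(1) unfolding ch by (metis H.one_closed H.r_one, blast)
      then show ?thesis by (metis mult_cancel_left1 norm_zero zero_neq_one)
    qed
    finally show False using \<psi> by simp
  qed
  define h where "h p = (THE k. k \<in> carrier H \<and> (\<forall>\<psi>\<in>?\<Psi>. \<psi> k = p (r \<psi>)))" for p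
  have h_eq: "h p = k" if "k \<in> carrier H" "\<forall>\<psi>\<in>?\<Psi>. \<psi> k = p (r \<psi>)" for p k
    unfolding h_def using that uniq by (intro the_equality) auto
  have h: "h p \<in> carrier H" "\<And>\<psi>. \<psi> \<in> ?\<Psi> \<Longrightarrow> \<psi> (h p) = p (r \<psi>)" if "p \<in> bidual A TA" for p
    using ex[OF that] h_eq by metis+
  have "h (\<lambda>f\<in>characters A TA. p f * q f) = h p \<otimes>\<^bsub>D\<^esub> h q" if p: "p \<in> bidual A TA" and q: "q \<in> bidual A TA" for p q
  proof -
    have "h (\<lambda>f\<in>characters A TA. p f * q f) = h p \<otimes>\<^bsub>H\<^esub> h q"
      using h[OF p] h[OF q] r by (intro h_eq) (auto simp: ch)
    then show ?thesis by (simp add: Hs)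
  qed
  moreover have "h (evaluation A TA a) = g a" if "a \<in> carrier A" for a
    using gK[OF that] that r by (intro h_eq) (auto simp: evaluation_def r_def)
  moreover have "continuous_map (bidual_topology A TA) TH h"
    unfolding continuous_map_closedin
  proof (intro conjI allI impI)
    show "h \<in> topspace (bidual_topology A TA) \<rightarrow> topspace TH" using h(1) TH(1) by (auto simp: topspace_bidual)
    fix C assume C: "closedin TH C"
    let ?X = "bidual_topology A TA"
    let ?Gr = "\<lambda>\<psi>. {z \<in> topspace (prod_topology ?X TH). \<psi> (snd z) = fst z (r \<psi>)}"
    have one: "restrict (\<lambda>x. 1) (carrier H) \<in> ?\<Psi>" by (rule characters_closed(1)[OF H.is_group TH(1)])
    have "closedin (prod_topology ?X TH) (?Gr \<psi>)" if \<psi>: "\<psi> \<in> ?\<Psi>" for \<psi>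
    proof (rule closedin_continuous_maps_eq[of euclidean])
      have "continuous_map (prod_topology ?X TH) euclidean (\<psi> \<circ> snd)"
        using \<psi> by (intro continuous_map_compose[OF continuous_map_snd]) (simp add: ch)
      then show "continuous_map (prod_topology ?X TH) euclidean (\<lambda>z. \<psi> (snd z))" by (simp add: o_def)
      have "continuous_map (prod_topology ?X TH) euclidean ((\<lambda>p. p (r \<psi>)) \<circ> fst)"
        by (intro continuous_map_compose[OF continuous_map_fst] continuous_map_bidual_eval r \<psi>)
      then show "continuous_map (prod_topology ?X TH) euclidean (\<lambda>z. fst z (r \<psi>))" by (simp add: o_def)
    qed simp
    then have "closedin (prod_topology ?X TH) (\<Inter>\<psi>\<in>?\<Psi>. ?Gr \<psi>)" using one by (intro closedin_INT) auto
    moreover have "closedin (prod_topology ?X TH) (topspace ?X \<times> C)"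
      using C by (simp add: closedin_prod_Times_iff)
    ultimately have "closedin (prod_topology ?X TH) ((\<Inter>\<psi>\<in>?\<Psi>. ?Gr \<psi>) \<inter> topspace ?X \<times> C)" (is "closedin _ ?Z")
      by (rule closedin_Int)
    \<comment> \<open>The preimage of \<open>C\<close> is the projection of the part of the graph
      over \<open>C\<close>, and projections along a compact factor are closed maps.\<close>
    then have "closedin ?X (fst ` ?Z)"
      using closed_map_fst[OF TH(2), of ?X] unfolding closed_map_def by blast
    moreover have "fst ` ?Z = {p \<in> topspace ?X. h p \<in> C}"
    proof
      show "fst ` ?Z \<subseteq> {p \<in> topspace ?X. h p \<in> C}"
      proof clarify
        fix p k assume pk: "(p, k) \<in> (\<Inter>\<psi>\<in>?\<Psi>. ?Gr \<psi>)" "p \<in> topspace ?X" "k \<in> C"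
        then have "h p = k" using closedin_subset[OF C] TH(1) by (intro h_eq) auto
        then show "fst (p, k) \<in> topspace ?X \<and> h (fst (p, k)) \<in> C" using pk by simp
      qed
      show "{p \<in> topspace ?X. h p \<in> C} \<subseteq> fst ` ?Z"
      proof clarify
        fix p assume p: "p \<in> topspace ?X" "h p \<in> C"
        then have "(p, h p) \<in> ?Z" using h TH(1) by (auto simp: topspace_bidual)
        then show "p \<in> fst ` ?Z" by force
      qed
    qed
    ultimately show "closedin ?X {p \<in> topspace ?X. h p \<in> C}" by simp
  qed
  then have "continuous_map (bidual_topology A TA) V h"
    unfolding TH_def by (rule continuous_map_into_fulltopology)
  ultimately show ?thesis by blast
qed

section \<open>Transfer to the saturated extension\<close>

lemma eval_SupAbs_bounded:
  assumes "univ N \<noteq> {}" "\<And>x. x \<in> univ N \<Longrightarrow> cmod (eval_fm N \<phi> (v(i := x))) \<le> B"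
  shows "cmod (eval_fm N (SupAbs i \<phi>) v) \<le> B"
proof -
  have bdd: "bdd_above ((\<lambda>x. cmod (eval_fm N \<phi> (v(i := x)))) ` univ N)" using assms(2) by (rule bdd_aboveI2)
  obtain x where x: "x \<in> univ N" using assms(1) by blast
  have "0 \<le> (SUP x\<in>univ N. cmod (eval_fm N \<phi> (v(i := x))))"
    by (rule cSUP_upper2[OF bdd x]) simp
  moreover have "(SUP x\<in>univ N. cmod (eval_fm N \<phi> (v(i := x)))) \<le> B"
    using assms by (intro cSUP_least) auto
  ultimately show ?thesis by (simp del: fun_upd_apply)
qed

text \<open>A supremum of reals carries information only for a bounded family. Given a bound, the
  value 0 of this quantifier amounts to a universal statement, which is how identities of A are
  moved to N.\<close>

lemma eval_SupAbs_eq_0_iff: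
  assumes "univ N \<noteq> {}" and B: "\<And>x. x \<in> univ N \<Longrightarrow> cmod (eval_fm N \<phi> (v(i := x))) \<le> B"
  shows "eval_fm N (SupAbs i \<phi>) v = 0 \<longleftrightarrow> (\<forall>x\<in>univ N. eval_fm N \<phi> (v(i := x)) = 0)"
proof
  have bdd: "bdd_above ((\<lambda>x. cmod (eval_fm N \<phi> (v(i := x)))) ` univ N)" using B by (rule bdd_aboveI2)
  assume "eval_fm N (SupAbs i \<phi>) v = 0"
  then have "cmod (eval_fm N \<phi> (v(i := x))) \<le> 0" if "x \<in> univ N" for x
    using cSUP_upper[OF that bdd] by simp
  then show "\<forall>x\<in>univ N. eval_fm N \<phi> (v(i := x)) = 0" by simp
next
  assume "\<forall>x\<in>univ N. eval_fm N \<phi> (v(i := x)) = 0"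
  then show "eval_fm N (SupAbs i \<phi>) v = 0" using assms(1) eval_SupAbs_bounded[of N \<phi> v i 0] by simp
qed

text \<open>The value 0 says that \<phi> is the product of \<psi> and \<rho>. It serves for
  multiplicativity in the element as well as in the predicate symbol.\<close>

definition product_condition :: "('c, 'f) fm \<Rightarrow> ('c, 'f) fm \<Rightarrow> ('c, 'f) fm \<Rightarrow> ('c, 'f) fm" where
  "product_condition \<phi> \<psi> \<rho> = Conn (\<lambda>g. g 0 - g 1 * g 2) [\<phi>, \<psi>, \<rho>]"

lemma eval_product_condition:
  "eval_fm N (product_condition \<phi> \<psi> \<rho>) v = eval_fm N \<phi> v - eval_fm N \<psi> v * eval_fm N \<rho> v"
  by (simp add: product_condition_def)

lemma product_condition_in_formulas:
  assumes "\<phi> \<in> formulas F B" "\<psi> \<in> formulas F B" "\<rho> \<in> formulas F B"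
  shows "product_condition \<phi> \<psi> \<rho> \<in> formulas F B"
proof -
  have p: "continuous_map (product_topology (\<lambda>_. euclidean) {..<3}) euclidean (\<lambda>g. g k)" if "k < 3" for k :: nat
    using that by (intro continuous_map_product_projection) simp
  have "continuous_map (product_topology (\<lambda>_. euclidean) {..<3}) euclidean
      (\<lambda>g. g 0 - g 1 * g (2::nat) :: complex)"
    by (intro continuous_map_diff continuous_map_complex_mult p) auto
  then have "continuous_map (product_topology (\<lambda>_. euclidean) {..<Suc (Suc (Suc 0))}) euclidean
      (\<lambda>g. g 0 - g 1 * g (2::nat) :: complex)"
    by (simp add: numeral_3_eq_3)
  then show ?thesis using assms by (simp add: formulas_def product_condition_def)
qed

locale character_extension =
  fixes A :: "'a monoid" and TA :: "'a topology"
    and N :: "('a, 'a \<Rightarrow> complex) cl_structure" and \<kappa> :: "'k rel" and F S TS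
  assumes comm: "comm_group A" and top: "topological_group A TA"
    and elementary: "elementary_extension (characters A TA) (character_structure A) N"
    and card_order: "Card_order \<kappa>" and inf: "infinite (Field \<kappa>)"
    and saturated: "saturated \<kappa> (characters A TA) N"
  defines F_def: "F \<equiv> characters A TA"
    and S_def: "S \<equiv> type_group F N"
    and TS_def: "TS \<equiv> type_topology F N"
begin

sublocale A: comm_group A by (rule comm)

lemmas topspace_A = topological_groupD(2)[OF top]
lemmas mem_F_iff = mem_characters_iff[OF topspace_A, folded F_def]
lemmas F_closed = characters_closed[OF A.is_group topspace_A, folded F_def]

lemma univ_character_structure: "univ (character_structure A) = carrier A"
  by (simp add: character_structure_def)

lemma carrier_subset: "carrier A \<subseteq> univ N"
  using elementary by (simp add: elementary_extension_def univ_character_structure)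

lemma univ_nonempty: "univ N \<noteq> {}"
  using carrier_subset A.one_closed by blast

lemma N_closed:
  "zero_op N \<in> univ N" "a \<in> univ N \<Longrightarrow> b \<in> univ N \<Longrightarrow> plus_op N a b \<in> univ N"
  using elementary by (auto simp: elementary_extension_def is_structure_def)

lemma transfer:
  assumes "\<phi> \<in> formulas F {}" "range v \<subseteq> carrier A"
  shows "eval_fm N \<phi> v = eval_fm (character_structure A) \<phi> v"
  using elementary assms by (simp add: elementary_extension_def univ_character_structure F_def)

lemma Pred_in_formulas: "f \<in> F \<Longrightarrow> pars_trm t = {} \<Longrightarrow> Pred f t \<in> formulas F {}"
  by (simp add: formulas_def)

lemma SupAbs_in_formulas: "\<phi> \<in> formulas F {} \<Longrightarrow> SupAbs i \<phi> \<in> formulas F {}"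
  by (simp add: formulas_def)

lemma InfAbs_in_formulas: "\<phi> \<in> formulas F {} \<Longrightarrow> InfAbs i \<phi> \<in> formulas F {}"
  by (simp add: formulas_def)

text \<open>The sentences to be transferred have no free variables; a constant valuation in A serves
  to evaluate them.\<close>

abbreviation base :: "nat \<Rightarrow> 'a" where
  "base \<equiv> \<lambda>_. \<one>\<^bsub>A\<^esub>"

lemma base: "range base \<subseteq> carrier A"
  by auto

lemma interp_extends:
  assumes "f \<in> F" "a \<in> carrier A"
  shows "interp N f a = f a"
  using transfer[OF Pred_in_formulas[of f "Var 0"], of "\<lambda>_. a"] assms by (simp add: character_structure_def)

text \<open>Both the supremum and the infimum of the modulus are 1 in A, and both are values of
  sentences.\<close>

lemma interp_norm:
  assumes f: "f \<in> F" and a: "a \<in> univ N"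
  shows "cmod (interp N f a) = 1"
proof (rule antisym)
  let ?\<phi> = "Pred f (Var 0) :: ('a, 'a \<Rightarrow> complex) fm"
  have \<phi>: "?\<phi> \<in> formulas F {}" by (rule Pred_in_formulas[OF f]) simp
  have "bounded (interp N f ` univ N)"
    using elementary f by (simp add: elementary_extension_def is_structure_def F_def)
  then have bdd: "bdd_above ((\<lambda>x. cmod (interp N f x)) ` univ N)"
    by (auto simp: bounded_iff intro: bdd_aboveI)
  have "(SUP x\<in>carrier A. cmod (f x)) = (SUP x\<in>carrier A. 1::real)"
    using f by (intro SUP_cong) (auto simp: mem_F_iff)
  then have sup1: "(SUP x\<in>carrier A. cmod (f x)) = 1" using A.one_closed cSUP_const[of "carrier A" "1::real"] by fastforce
  have "(INF x\<in>carrier A. cmod (f x)) = (INF x\<in>carrier A. 1::real)"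
    using f by (intro INF_cong) (auto simp: mem_F_iff)
  then have inf1: "(INF x\<in>carrier A. cmod (f x)) = 1" using A.one_closed cINF_const[of "carrier A" "1::real"] by fastforce
  have "(SUP x\<in>univ N. cmod (interp N f x)) = 1"
    using transfer[OF SupAbs_in_formulas[OF \<phi>, of 0] base] sup1
    by (simp add: character_structure_def)
  then show "cmod (interp N f a) \<le> 1" using cSUP_upper[OF a bdd] by simp
  have "(INF x\<in>univ N. cmod (interp N f x)) = 1"
    using transfer[OF InfAbs_in_formulas[OF \<phi>, of 0] base] inf1
    by (simp add: character_structure_def)
  moreover have "bdd_below ((\<lambda>x. cmod (interp N f x)) ` univ N)" by (auto intro: bdd_belowI[of _ 0])
  ultimately show "1 \<le> cmod (interp N f a)" using cINF_lower[OF _ a] by metis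
qed

lemma interp_zero:
  assumes "f \<in> F"
  shows "interp N f (zero_op N) = 1"
proof -
  have "f \<one>\<^bsub>A\<^esub> * f \<one>\<^bsub>A\<^esub> = f \<one>\<^bsub>A\<^esub>" "cmod (f \<one>\<^bsub>A\<^esub>) = 1"
    using assms unfolding mem_F_iff by (metis A.one_closed A.r_one, blast intro: A.one_closed)
  then have "f \<one>\<^bsub>A\<^esub> = 1" by (metis mult_cancel_left1 norm_zero zero_neq_one)
  then show ?thesis
    using transfer[OF Pred_in_formulas[of f Zero] base] assms by (simp add: character_structure_def)
qed

lemma norm_product_condition_le:
  assumes "cmod x = 1" "cmod y = 1" "cmod z = 1"
  shows "cmod (x - y * z) \<le> 2"
  using norm_triangle_ineq4[of x "y * z"] assms by (simp add: norm_mult)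

text \<open>Additivity in A says that a sentence with two nested suprema has value 0. To read it in
  N, the inner formula is bounded by 2, which uses \<open>interp_norm\<close> there.\<close>

lemma interp_plus:
  assumes f: "f \<in> F" and ab: "a \<in> univ N" "b \<in> univ N"
  shows "interp N f (plus_op N a b) = interp N f a * interp N f b"
proof -
  define \<phi> where "\<phi> = product_condition (Pred f (Plus (Var 0) (Var 1))) (Pred f (Var 0))
    (Pred f (Var 1) :: ('a, 'a \<Rightarrow> complex) fm)"
  have \<phi>: "\<phi> \<in> formulas F {}"
    unfolding \<phi>_def by (intro product_condition_in_formulas Pred_in_formulas f) auto
  have ev: "eval_fm N' \<phi> v = interp N' f (plus_op N' (v 0) (v 1)) - interp N' f (v 0) * interp N' f (v 1)" for N' v
    by (simp add: \<phi>_def eval_product_condition)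
  have "eval_fm (character_structure A) (SupAbs 0 (SupAbs 1 \<phi>)) base = 0"
  proof -
    have "eval_fm (character_structure A) \<phi> (base(0 := x, 1 := y)) = 0" if "x \<in> carrier A" "y \<in> carrier A" for x y
      using that f by (simp add: ev character_structure_def mem_F_iff)
    then have "eval_fm (character_structure A) (SupAbs 1 \<phi>) (base(0 := x)) = 0" if "x \<in> carrier A" for x
      using that A.one_closed by (subst eval_SupAbs_eq_0_iff[where B = 0]) (auto simp: univ_character_structure)
    then show ?thesis
      using A.one_closed by (subst eval_SupAbs_eq_0_iff[where B = 0]) (auto simp only: univ_character_structure norm_zero)
  qed
  then have 0: "eval_fm N (SupAbs 0 (SupAbs 1 \<phi>)) base = 0"
    using transfer[OF SupAbs_in_formulas[OF SupAbs_in_formulas[OF \<phi>]] base] by metis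
  have B: "cmod (eval_fm N \<phi> (base(0 := x, 1 := y))) \<le> 2" if "x \<in> univ N" "y \<in> univ N" for x y
    using that f by (simp add: ev norm_product_condition_le interp_norm N_closed)
  then have "cmod (eval_fm N (SupAbs 1 \<phi>) (base(0 := x))) \<le> 2" if "x \<in> univ N" for x
    using that univ_nonempty by (intro eval_SupAbs_bounded) auto
  then have "\<forall>x\<in>univ N. eval_fm N (SupAbs 1 \<phi>) (base(0 := x)) = 0"
    using 0 eval_SupAbs_eq_0_iff[OF univ_nonempty, of "SupAbs 1 \<phi>" base 0 2] by blast
  then have "eval_fm N (SupAbs 1 \<phi>) (base(0 := a)) = 0" using ab by blast
  then have "eval_fm N \<phi> (base(0 := a, 1 := b)) = 0"
    using eval_SupAbs_eq_0_iff[OF univ_nonempty, of \<phi> "base(0 := a)" 1 2] B ab by blast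
  then show ?thesis by (simp add: ev)
qed

text \<open>Here the symbol varies instead of the element: this law makes the type of each element
  of N a homomorphism on the group of characters.\<close>

lemma interp_mult:
  assumes fg: "f \<in> F" "g \<in> F" and a: "a \<in> univ N"
  shows "interp N (restrict (\<lambda>x. f x * g x) (carrier A)) a = interp N f a * interp N g a"
proof -
  let ?h = "restrict (\<lambda>x. f x * g x) (carrier A)"
  define \<phi> where "\<phi> = product_condition (Pred ?h (Var 0)) (Pred f (Var 0)) (Pred g (Var 0) :: ('a, 'a \<Rightarrow> complex) fm)"
  have h: "?h \<in> F" by (rule F_closed(2)[OF fg])
  have \<phi>: "\<phi> \<in> formulas F {}"
    unfolding \<phi>_def by (intro product_condition_in_formulas Pred_in_formulas fg h) auto
  have ev: "eval_fm N' \<phi> v = interp N' ?h (v 0) - interp N' f (v 0) * interp N' g (v 0)" for N' v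
    by (simp add: \<phi>_def eval_product_condition)
  have "eval_fm (character_structure A) (SupAbs 0 \<phi>) base = 0"
    using A.one_closed
    by (subst eval_SupAbs_eq_0_iff[where B = 0]) (auto simp: ev character_structure_def)
  then have "eval_fm N (SupAbs 0 \<phi>) base = 0"
    using transfer[OF SupAbs_in_formulas[OF \<phi>] base] by metis
  moreover have "cmod (eval_fm N \<phi> (base(0 := x))) \<le> 2" if "x \<in> univ N" for x
    using that fg h by (simp add: ev norm_product_condition_le interp_norm)
  ultimately have "eval_fm N \<phi> (base(0 := a)) = 0"
    using eval_SupAbs_eq_0_iff[OF univ_nonempty, of \<phi> base 0 2] a by blast
  then show ?thesis by (simp add: ev)
qed

text \<open>Elements of A in general only approximate the values of a homomorphism, so the condition
  that f takes the value z is replaced by these, one for each k. Truncation at 0 turns the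
  inequality into an equation.\<close>

definition near_condition :: "('a \<Rightarrow> complex) \<Rightarrow> complex \<Rightarrow> nat \<Rightarrow> ('a, 'a \<Rightarrow> complex) fm" where
  "near_condition f z k =
     Conn (\<lambda>g. complex_of_real (max 0 (cmod (g 0 - z) - 1 / real (Suc k)))) [Pred f (Var 0)]"

lemma eval_near_condition:
  "eval_fm N (near_condition f z k) v = 0 \<longleftrightarrow> cmod (interp N f (v 0) - z) \<le> 1 / real (Suc k)"
  by (simp add: near_condition_def max_def)

lemma near_condition_in_formulas:
  assumes "f \<in> F"
  shows "near_condition f z k \<in> {\<phi> \<in> formulas F {}. fv \<phi> \<subseteq> {..<1}}"
proof -
  have 1: "continuous_map (product_topology (\<lambda>_. euclidean) {..<Suc 0}) euclidean (\<lambda>g. g 0 :: complex)"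
    by (intro continuous_map_product_projection) simp
  have 2: "continuous_map euclidean euclidean (\<lambda>w. complex_of_real (max 0 (cmod (w - z) - 1 / real (Suc k))))"
    unfolding continuous_map_iff_continuous2 by (intro continuous_intros)
  have "continuous_map (product_topology (\<lambda>_. euclidean) {..<Suc 0}) euclidean
    (\<lambda>g. complex_of_real (max 0 (cmod (g 0 - z) - 1 / real (Suc k))))"
    using continuous_map_compose[OF 1 2] by (simp only: o_def)
  then show ?thesis using assms by (simp add: near_condition_def formulas_def)
qed

text \<open>Finitely many approximate conditions are met by a single element of A, hence in N. They
  contain no parameters, so saturation is applied to the empty parameter set, whose cardinal lies
  below the infinite \<kappa>.\<close>

lemma ex_realization:
  assumes p: "p \<in> bidual A TA"
  shows "\<exists>a\<in>univ N. \<forall>f\<in>F. interp N f a = p f"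
proof -
  let ?c = "\<lambda>(f, k). near_condition f (p f) k"
  let ?\<Gamma> = "?c ` (F \<times> UNIV)"
  have "satisfiable N \<Gamma>0" if \<Gamma>0: "finite \<Gamma>0" "\<Gamma>0 \<subseteq> ?\<Gamma>" for \<Gamma>0
  proof -
    obtain P where P: "P \<subseteq> F \<times> UNIV" "finite P" "\<Gamma>0 = ?c ` P"
      using finite_subset_image[OF \<Gamma>0] by blast
    define m where "m = Max (insert 0 (snd ` P))"
    have "finite (fst ` P)" "fst ` P \<subseteq> characters A TA" "0 < 1 / real (Suc m)" using P by (auto simp: F_def)
    then obtain a where a: "a \<in> carrier A" "\<forall>f\<in>fst ` P. cmod (f a - p f) < 1 / real (Suc m)"
      using bidual_approximate[OF comm topspace_A p] by blast
    have "eval_fm N (?c z) (\<lambda>_. a) = 0" if z: "z \<in> P" for z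
    proof -
      obtain f k where fk: "z = (f, k)" "f \<in> F" using P(1) z by (cases z) auto
      have "snd z \<le> m" unfolding m_def using z P(2) by (intro Max_ge) auto
      then have "1 / real (Suc m) \<le> 1 / real (Suc k)" using fk by (intro divide_left_mono) auto
      moreover have "cmod (f a - p f) < 1 / real (Suc m)" using a(2) z fk by force
      ultimately show ?thesis
        unfolding fk(1) prod.case eval_near_condition interp_extends[OF fk(2) a(1)] by linarith
    qed
    then show ?thesis
      unfolding satisfiable_def P(3) using carrier_subset a(1) by (intro exI[of _ "\<lambda>_. a"]) auto
  qed
  moreover have "|{} :: 'a set| <o \<kappa>"
    using finite_ordLess_infinite[OF _ _ _ inf, of "|{} :: 'a set|"] card_order
    by (auto simp: card_of_Well_order card_of_well_order_on card_order_on_well_order_on Field_card_of)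
  moreover have "?\<Gamma> \<subseteq> {\<phi> \<in> formulas F {}. fv \<phi> \<subseteq> {..<1}}"
    using near_condition_in_formulas by auto
  ultimately have "satisfiable N ?\<Gamma>"
    using saturated[unfolded saturated_def, rule_format, of "{}" ?\<Gamma> 1] unfolding F_def by blast
  then obtain v where v: "range v \<subseteq> univ N" "\<forall>\<phi>\<in>?\<Gamma>. eval_fm N \<phi> v = 0"
    by (auto simp: satisfiable_def)
  have "interp N f (v 0) = p f" if f: "f \<in> F" for f
  proof -
    have "near_condition f (p f) n \<in> ?\<Gamma>" for n using f by force
    then have le: "cmod (interp N f (v 0) - p f) \<le> 1 / real (Suc n)" for n
      using v(2) eval_near_condition by blast
    have "(\<lambda>n. 1 / real (Suc n)) \<longlonglongrightarrow> 0" by (rule LIMSEQ_Suc[OF lim_const_over_n])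
    then have "cmod (interp N f (v 0) - p f) \<le> 0"
      by (rule tendsto_lowerbound) (auto intro!: always_eventually le simp del: of_nat_Suc)
    then show ?thesis by simp
  qed
  then show ?thesis using v(1) by blast
qed

section \<open>The space of types\<close>

text \<open>One inclusion is elementarity, through \<open>interp_norm\<close> and
  \<open>interp_mult\<close>; the other is saturation, through
  \<open>ex_realization\<close>.\<close>

lemma types_eq: "types F N = bidual A TA"
proof
  show "types F N \<subseteq> bidual A TA"
    using F_closed(2)
    by (auto simp: types_def tp_def mem_bidual_iff interp_norm interp_mult simp flip: F_def)
  show "bidual A TA \<subseteq> types F N"
  proof
    fix p assume p: "p \<in> bidual A TA"
    then obtain a where a: "a \<in> univ N" "\<forall>f\<in>F. interp N f a = p f" using ex_realization by blast
    then have "tp F N a = p"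
      using p by (auto simp: tp_def mem_bidual_iff extensional_def fun_eq_iff simp flip: F_def)
    then show "p \<in> types F N" using a(1) by (auto simp: types_def)
  qed
qed

lemma tp_in_types: "a \<in> univ N \<Longrightarrow> tp F N a \<in> types F N"
  by (simp add: types_def)

lemma tp_apply: "f \<in> F \<Longrightarrow> tp F N a f = interp N f a"
  by (simp add: tp_def)

lemma type_eval:
  assumes "f \<in> F" "p \<in> types F N"
  shows "type_eval F N f p = p f"
  unfolding type_eval_def
proof (rule the_equality)
  show "\<exists>a\<in>univ N. tp F N a = p \<and> p f = interp N f a"
    using assms by (auto simp: types_def tp_apply)
  show "z = p f" if "\<exists>a\<in>univ N. tp F N a = p \<and> z = interp N f a" for z
    using that by (auto simp: tp_apply[OF assms(1), symmetric])
qed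

lemma tp_plus:
  assumes "a \<in> univ N" "b \<in> univ N"
  shows "tp F N (plus_op N a b) = (\<lambda>f\<in>F. tp F N a f * tp F N b f)"
  using assms by (auto simp: tp_def interp_plus)

lemma type_plus:
  assumes "p \<in> types F N" "q \<in> types F N"
  shows "type_plus F N p q = (\<lambda>f\<in>F. p f * q f)"
  unfolding type_plus_def
proof (rule the_equality)
  show "\<exists>a\<in>univ N. \<exists>b\<in>univ N. tp F N a = p \<and> tp F N b = q \<and> (\<lambda>f\<in>F. p f * q f) = tp F N (plus_op N a b)"
    using assms tp_plus by (fastforce simp: types_def)
  show "r = (\<lambda>f\<in>F. p f * q f)"
    if "\<exists>a\<in>univ N. \<exists>b\<in>univ N. tp F N a = p \<and> tp F N b = q \<and> r = tp F N (plus_op N a b)" for r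
    using that tp_plus by blast
qed

lemma carrier_S: "carrier S = bidual A TA"
  by (simp add: S_def type_group_def types_eq)

lemma mult_S: "p \<in> bidual A TA \<Longrightarrow> q \<in> bidual A TA \<Longrightarrow> p \<otimes>\<^bsub>S\<^esub> q = (\<lambda>f\<in>F. p f * q f)"
  by (simp add: S_def type_group_def type_plus types_eq)

lemma one_S: "\<one>\<^bsub>S\<^esub> = (\<lambda>f\<in>F. 1)"
  by (auto simp: S_def type_group_def tp_def interp_zero)

text \<open>Both topologies are the coarsest ones making the evaluations continuous, so the identity
  is continuous in either direction.\<close>

lemma TS_eq: "TS = bidual_topology A TA"
proof -
  let ?B = "{{p \<in> types F N. type_eval F N f p \<in> W} |f W. f \<in> F \<and> open W}"
  have B: "{p \<in> bidual A TA. p f \<in> W} \<in> ?B" if "f \<in> F" "open W" for f W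
  proof -
    have "{p \<in> bidual A TA. p f \<in> W} = {p \<in> types F N. type_eval F N f p \<in> W}"
      using that type_eval by (auto simp: types_eq)
    then show ?thesis using that by blast
  qed
  have B': "\<exists>f\<in>F. \<exists>W. open W \<and> U = {p \<in> bidual A TA. p f \<in> W}" if U: "U \<in> ?B" for U
  proof -
    obtain f W where fW: "U = {p \<in> types F N. type_eval F N f p \<in> W}" "f \<in> F" "open W" using U by blast
    then have "U = {p \<in> bidual A TA. p f \<in> W}" using type_eval by (auto simp: types_eq)
    then show ?thesis using fW by blast
  qed
  \<comment> \<open>The space underlying a generated topology is the union of its generators, so one
    character with the whole plane as \<open>W\<close> is needed to reach every type.\<close>
  have topB: "\<Union> ?B = bidual A TA"
  proof
    show "\<Union> ?B \<subseteq> bidual A TA" using B' by blast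
    have "bidual A TA \<in> ?B" using B[OF F_closed(1) open_UNIV] by simp
    then show "bidual A TA \<subseteq> \<Union> ?B" by blast
  qed
  have "continuous_map (bidual_topology A TA) TS id"
    unfolding TS_def type_topology_def
  proof (rule continuous_on_generated_topo)
    show "id ` topspace (bidual_topology A TA) \<subseteq> \<Union> ?B" using topB by (simp add: topspace_bidual)
    fix U assume "U \<in> ?B"
    then obtain f W where U: "f \<in> F" "open W" "U = {p \<in> bidual A TA. p f \<in> W}" using B' by blast
    have "openin (bidual_topology A TA) {p \<in> topspace (bidual_topology A TA). p f \<in> W}"
      using U by (intro openin_continuous_map_preimage[OF continuous_map_bidual_eval]) (auto simp: F_def)
    moreover have "id -` U \<inter> topspace (bidual_topology A TA) = {p \<in> topspace (bidual_topology A TA). p f \<in> W}"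
      using U by (auto simp: topspace_bidual)
    ultimately show "openin (bidual_topology A TA) (id -` U \<inter> topspace (bidual_topology A TA))" by simp
  qed
  moreover have topTS: "topspace TS = bidual A TA"
    unfolding TS_def type_topology_def topology_generated_by_topspace by (rule topB)
  moreover have "continuous_map TS (bidual_topology A TA) id"
  proof (rule continuous_map_into_bidual)
    show "id \<in> topspace TS \<rightarrow> bidual A TA" using topTS by simp
    fix f assume f: "f \<in> characters A TA"
    have "openin TS {p \<in> bidual A TA. p f \<in> W}" if "open W" for W
      unfolding TS_def type_topology_def
      using B[OF f[folded F_def] that] by (rule topology_generated_by_Basis)
    then show "continuous_map TS euclidean (\<lambda>z. id z f)"
      by (simp add: continuous_map_def topTS)
  qed
  moreover have "openin X U" if "continuous_map X Y id" "topspace X = topspace Y" "openin Y U"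
    for X Y :: "(('a \<Rightarrow> complex) \<Rightarrow> complex) topology" and U
  proof -
    have "{x \<in> topspace X. id x \<in> U} = U" using openin_subset[OF that(3)] that(2) by auto
    then show ?thesis using openin_continuous_map_preimage[OF that(1,3)] by simp
  qed
  ultimately have "openin TS U \<longleftrightarrow> openin (bidual_topology A TA) U" for U
    by (metis topspace_bidual)
  then show ?thesis by (simp add: topology_eq)
qed

section \<open>The compact group of types\<close>

lemma bidual_apply_norm: "p \<in> bidual A TA \<Longrightarrow> f \<in> F \<Longrightarrow> cmod (p f) = 1"
  by (simp add: mem_bidual_iff F_def)

lemma bidual_ext: "p \<in> bidual A TA \<Longrightarrow> q \<in> bidual A TA \<Longrightarrow> (\<And>f. f \<in> F \<Longrightarrow> p f = q f) \<Longrightarrow> p = q"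
  unfolding mem_bidual_iff F_def by (meson extensionalityI)

lemma bidual_closed:
  shows "(\<lambda>f\<in>F. 1) \<in> bidual A TA"
    and "p \<in> bidual A TA \<Longrightarrow> q \<in> bidual A TA \<Longrightarrow> (\<lambda>f\<in>F. p f * q f) \<in> bidual A TA"
    and "p \<in> bidual A TA \<Longrightarrow> (\<lambda>f\<in>F. cnj (p f)) \<in> bidual A TA"
  using F_closed(2) by (auto simp: mem_bidual_iff norm_mult simp flip: F_def)

lemma comm_group_S: "comm_group S"
proof (rule comm_groupI)
  fix p q r assume "p \<in> carrier S" "q \<in> carrier S" "r \<in> carrier S"
  then show "p \<otimes>\<^bsub>S\<^esub> q \<otimes>\<^bsub>S\<^esub> r = p \<otimes>\<^bsub>S\<^esub> (q \<otimes>\<^bsub>S\<^esub> r)"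
    by (auto simp: carrier_S mult_S bidual_closed mult.assoc)
next
  fix p assume p: "p \<in> carrier S"
  then show "\<one>\<^bsub>S\<^esub> \<otimes>\<^bsub>S\<^esub> p = p"
    using bidual_closed(2)[OF bidual_closed(1), of p]
    by (intro bidual_ext) (simp_all add: carrier_S one_S mult_S bidual_closed(1))
  have "cnj (p f) * p f = 1" if "f \<in> F" for f
    using unit_mult_cnj[OF bidual_apply_norm] p that by (simp add: carrier_S mult.commute)
  then have "(\<lambda>f\<in>F. cnj (p f)) \<otimes>\<^bsub>S\<^esub> p = \<one>\<^bsub>S\<^esub>"
    using p by (auto simp: carrier_S one_S mult_S bidual_closed)
  then show "\<exists>q\<in>carrier S. q \<otimes>\<^bsub>S\<^esub> p = \<one>\<^bsub>S\<^esub>"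
    using p bidual_closed(3) unfolding carrier_S by blast
qed (simp_all add: carrier_S mult_S one_S bidual_closed mult.commute)

lemma inv_S:
  assumes "p \<in> bidual A TA"
  shows "inv\<^bsub>S\<^esub> p = (\<lambda>f\<in>F. cnj (p f))"
proof -
  interpret S: comm_group S by (rule comm_group_S)
  have "cnj (p f) * p f = 1" if "f \<in> F" for f
    using unit_mult_cnj[OF bidual_apply_norm] assms that by (simp add: mult.commute)
  then have "(\<lambda>f\<in>F. cnj (p f)) \<otimes>\<^bsub>S\<^esub> p = \<one>\<^bsub>S\<^esub>"
    using assms by (auto simp: one_S mult_S bidual_closed)
  then show ?thesis using assms by (intro S.inv_equality) (auto simp: carrier_S bidual_closed)
qed

lemma topspace_TS: "topspace TS = carrier S"
  by (simp add: TS_eq topspace_bidual carrier_S)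

lemma compact_group_S: "compact_group S TS"
proof -
  interpret S: comm_group S by (rule comm_group_S)
  let ?X = "bidual_topology A TA"
  have ev: "continuous_map ?X euclidean (\<lambda>p. p f)" if "f \<in> F" for f
    using that by (intro continuous_map_bidual_eval) (simp add: F_def)
  have "continuous_map (prod_topology ?X ?X) ?X (\<lambda>z. fst z \<otimes>\<^bsub>S\<^esub> snd z)"
  proof (rule continuous_map_into_bidual)
    show "(\<lambda>z. fst z \<otimes>\<^bsub>S\<^esub> snd z) \<in> topspace (prod_topology ?X ?X) \<rightarrow> bidual A TA"
      using S.m_closed by (auto simp: topspace_bidual carrier_S)
    fix f assume "f \<in> characters A TA"
    then have f: "f \<in> F" by (simp add: F_def)
    have "continuous_map (prod_topology ?X ?X) euclidean (\<lambda>z. fst z f * snd z f)"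
      using continuous_map_compose[OF continuous_map_fst ev[OF f], of ?X]
        continuous_map_compose[OF continuous_map_snd ev[OF f], of ?X]
      by (intro continuous_map_complex_mult) (auto simp: o_def)
    then show "continuous_map (prod_topology ?X ?X) euclidean (\<lambda>z. (fst z \<otimes>\<^bsub>S\<^esub> snd z) f)"
      by (rule continuous_map_eq) (auto simp: topspace_bidual mult_S f)
  qed
  moreover have "continuous_map ?X ?X (\<lambda>p. inv\<^bsub>S\<^esub> p)"
  proof (rule continuous_map_into_bidual)
    show "(\<lambda>p. inv\<^bsub>S\<^esub> p) \<in> topspace ?X \<rightarrow> bidual A TA"
      using S.inv_closed by (auto simp: topspace_bidual carrier_S)
    fix f assume "f \<in> characters A TA"
    then have f: "f \<in> F" by (simp add: F_def)
    show "continuous_map ?X euclidean (\<lambda>p. (inv\<^bsub>S\<^esub> p) f)"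
      using continuous_map_complex_cnj[OF ev[OF f]]
      by (rule continuous_map_eq) (auto simp: topspace_bidual inv_S f)
  qed
  ultimately have "topological_group S TS"
    unfolding topological_group_def
    using S.is_group topspace_TS Hausdorff_bidual by (simp add: TS_eq case_prod_unfold)
  then show ?thesis using compact_bidual[OF A.is_group topspace_A] by (simp add: compact_group_def TS_eq)
qed

text \<open>A type is encoded as the function it induces on \<open>F\<close>, so the map is the
  identity on \<open>bidual A TA\<close>; the content lies in \<open>types_eq\<close> and
  \<open>TS_eq\<close>.\<close>

lemma types_iso_dual:
  "(\<lambda>p. \<lambda>f\<in>F. type_eval F N f p) \<in> topological_iso S TS
     (character_group (character_group A TA) (discrete_topology F))
     (pointwise_topology (character_group A TA) (discrete_topology F))"
proof -
  let ?i = "\<lambda>p. \<lambda>f\<in>F. type_eval F N f p"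
  let ?H = "character_group (character_group A TA) (discrete_topology F)"
  have H: "carrier ?H = bidual A TA"
    by (simp add: character_group_def bidual_def F_def)
  have Hm: "p \<otimes>\<^bsub>?H\<^esub> q = (\<lambda>f\<in>F. p f * q f)" for p q
    by (simp add: character_group_def F_def)
  have i: "?i p = p" if "p \<in> bidual A TA" for p
    using that type_eval by (intro ext) (auto simp: mem_bidual_iff types_eq extensional_def simp flip: F_def)
  have "?i \<in> hom S ?H"
    by (intro homI) (auto simp: carrier_S H i mult_S Hm bidual_closed simp del: restrict_apply)
  moreover have "bij_betw ?i (carrier S) (carrier ?H)"
    unfolding carrier_S H using bij_betw_id by (rule bij_betw_cong[THEN iffD1, rotated]) (simp add: i)
  moreover have "homeomorphic_map TS (bidual_topology A TA) ?i"
    by (rule homeomorphic_map_eq[of _ _ id]) (auto simp: TS_eq topspace_bidual i simp del: restrict_apply)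
  ultimately show ?thesis
    by (simp add: topological_iso_def iso_def bidual_topology_def F_def)
qed

section \<open>The universal property\<close>

lemma tp_eq_evaluation: "a \<in> carrier A \<Longrightarrow> tp F N a = evaluation A TA a"
  by (auto simp: tp_def evaluation_def interp_extends simp flip: F_def)

lemma tp_continuous_hom: "tp F N \<in> continuous_hom A TA S TS"
proof -
  have in_S: "tp F N a \<in> bidual A TA" if "a \<in> carrier A" for a
    using tp_in_types carrier_subset that types_eq by blast
  have "tp F N \<in> hom A S"
  proof (rule homI)
    fix a b assume ab: "a \<in> carrier A" "b \<in> carrier A"
    then show "tp F N (a \<otimes>\<^bsub>A\<^esub> b) = tp F N a \<otimes>\<^bsub>S\<^esub> tp F N b"
      using in_S by (auto simp: mult_S tp_def interp_extends mem_F_iff)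
  qed (simp add: carrier_S in_S)
  moreover have "continuous_map TA TS (tp F N)"
    unfolding TS_eq
  proof (rule continuous_map_into_bidual)
    show "tp F N \<in> topspace TA \<rightarrow> bidual A TA" using in_S topspace_A by auto
    fix f assume "f \<in> characters A TA"
    then have "f \<in> F" by (simp add: F_def)
    then have "continuous_map TA euclidean f" by (simp add: mem_F_iff)
    then show "continuous_map TA euclidean (\<lambda>a. tp F N a f)"
      by (rule continuous_map_eq) (simp add: \<open>f \<in> F\<close> tp_apply interp_extends topspace_A)
  qed
  ultimately show ?thesis by (simp add: continuous_hom_def)
qed

text \<open>The types of elements of A are dense. This gives the uniqueness of factorisations below
  and also one of the two inverse laws in the comparison with another compactification.\<close>

lemma eq_on_types:
  assumes "Hausdorff_space V" "continuous_map TS V h" "continuous_map TS V k"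
    and "\<And>a. a \<in> carrier A \<Longrightarrow> h (tp F N a) = k (tp F N a)" and p: "p \<in> carrier S"
  shows "h p = k p"
proof (rule forall_in_closure_of_eq[OF _ assms(1-3)])
  show "p \<in> TS closure_of (evaluation A TA ` carrier A)"
    using p evaluation_dense[OF comm topspace_A] by (simp add: TS_eq carrier_S)
  show "h x = k x" if "x \<in> evaluation A TA ` carrier A" for x
    using that assms(4) by (auto simp flip: tp_eq_evaluation)
qed

text \<open>Existence is \<open>factor_through_bidual\<close>, uniqueness is density; restriction to
  the carrier makes the factor extensional, so that uniqueness is equality of functions.\<close>

lemma bohr: "bohr_compactification TYPE('d) A TA S TS (tp F N)"
  unfolding bohr_compactification_def
proof (intro conjI allI impI compact_group_S tp_continuous_hom)
  fix D :: "'d monoid" and V g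
  assume Dg: "compact_group D V \<and> g \<in> continuous_hom A TA D V"
  then have V: "Hausdorff_space V" by (auto simp: compact_group_def topological_group_def)
  have "topspace V = carrier D" using Dg by (auto simp: compact_group_def topological_group_def)
  obtain h where h: "continuous_map TS V h"
    "\<And>p q. p \<in> bidual A TA \<Longrightarrow> q \<in> bidual A TA \<Longrightarrow> h (\<lambda>f\<in>F. p f * q f) = h p \<otimes>\<^bsub>D\<^esub> h q"
    "\<And>a. a \<in> carrier A \<Longrightarrow> h (tp F N a) = g a"
    using factor_through_bidual[OF comm top, of D V g] Dg tp_eq_evaluation
    unfolding TS_eq F_def by metis
  have h': "h p \<in> carrier D" if "p \<in> carrier S" for p
    using h(1) that topspace_TS \<open>topspace V = carrier D\<close> by (auto simp: continuous_map_def)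
  let ?h = "restrict h (carrier S)"
  have tpS: "tp F N a \<in> carrier S" if "a \<in> carrier A" for a
    using tp_continuous_hom that by (auto simp: continuous_hom_def hom_def)
  interpret S: comm_group S by (rule comm_group_S)
  have "?h \<in> hom S D"
    using h' S.m_closed by (intro homI) (auto simp: mult_S h(2) carrier_S bidual_closed)
  moreover have "continuous_map TS V ?h" using h(1) by (rule continuous_map_eq) (simp add: topspace_TS)
  ultimately have "?h \<in> continuous_hom S TS D V \<inter> extensional (carrier S)"
    by (simp add: continuous_hom_def)
  moreover have "\<forall>a\<in>carrier A. g a = ?h (tp F N a)" using h(3) tpS by simp
  moreover have "k = ?h" if k: "k \<in> continuous_hom S TS D V \<inter> extensional (carrier S)"
    "\<forall>a\<in>carrier A. g a = k (tp F N a)" for k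
  proof (rule extensionalityI)
    show "k \<in> extensional (carrier S)" using k(1) by blast
    fix p assume p: "p \<in> carrier S"
    have "continuous_map TS V k" using k(1) by (simp add: continuous_hom_def)
    moreover have "k (tp F N a) = ?h (tp F N a)" if "a \<in> carrier A" for a
      using k(2) h(3) tpS that by simp
    ultimately show "k p = ?h p" using eq_on_types[OF V _ \<open>continuous_map TS V ?h\<close> _ p] by blast
  qed simp
  ultimately show "\<exists>!h. h \<in> continuous_hom S TS D V \<inter> extensional (carrier S) \<and> (\<forall>a\<in>carrier A. g a = h (tp F N a))"
    by blast
qed

lemma continuous_hom_compose:
  assumes "h \<in> continuous_hom G T H U" "k \<in> continuous_hom H U K W" "topspace T = carrier G" "group G"
  shows "restrict (k \<circ> h) (carrier G) \<in> continuous_hom G T K W \<inter> extensional (carrier G)"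
proof -
  interpret group G by fact
  have "continuous_map T W (k \<circ> h)"
    using assms continuous_map_compose[of T U h W k] by (auto simp: continuous_hom_def)
  then have "continuous_map T W (restrict (k \<circ> h) (carrier G))"
    by (rule continuous_map_eq) (simp add: assms(3))
  then show ?thesis using assms by (auto simp: continuous_hom_def hom_def Pi_iff)
qed

text \<open>The uniqueness argument for universal objects, with the type instances spelled out: the
  first assumption admits \<open>S\<close> as a test group and produces k, the second admits
  \<open>bA\<close> itself and gives \<open>h (k x) = x\<close>. The other composite is the identity
  by density.\<close>

lemma bohr_unique:
  fixes bA :: "'b monoid"
  assumes 1: "bohr_compactification TYPE(('a \<Rightarrow> complex) \<Rightarrow> complex) A TA bA TB \<iota>"
    and 2: "bohr_compactification TYPE('b) A TA bA TB \<iota>"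
  shows "\<exists>h\<in>topological_iso S TS bA TB. \<forall>a\<in>carrier A. h (tp F N a) = \<iota> a"
proof -
  have B: "compact_group bA TB" "\<iota> \<in> continuous_hom A TA bA TB"
    using 2 by (auto simp: bohr_compactification_def)
  then have TB: "topological_group bA TB" by (simp add: compact_group_def)
  note tB = topological_groupD[OF TB]
  interpret bA: group bA by (rule tB(1))
  obtain h where h: "h \<in> continuous_hom S TS bA TB" "\<And>a. a \<in> carrier A \<Longrightarrow> \<iota> a = h (tp F N a)"
    using bohr[where 'd = 'b] B unfolding bohr_compactification_def by blast
  obtain k where k: "k \<in> continuous_hom bA TB S TS" "\<And>a. a \<in> carrier A \<Longrightarrow> tp F N a = k (\<iota> a)"
    using 1 compact_group_S tp_continuous_hom unfolding bohr_compactification_def by blast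
  have hS: "h p \<in> carrier bA" if "p \<in> carrier S" for p using h(1) that by (auto simp: continuous_hom_def hom_def)
  have kB: "k x \<in> carrier S" if "x \<in> carrier bA" for x using k(1) that by (auto simp: continuous_hom_def hom_def)
  have \<iota>B: "\<iota> a \<in> carrier bA" if "a \<in> carrier A" for a using B(2) that by (auto simp: continuous_hom_def hom_def)
  have ch: "continuous_map TS TB h" "continuous_map TB TS k" using h(1) k(1) by (auto simp: continuous_hom_def)
  have kh: "k (h p) = p" if p: "p \<in> carrier S" for p
  proof -
    have "(k \<circ> h) p = id p"
    proof (rule eq_on_types[OF _ _ _ _ p])
      show "Hausdorff_space TS" by (simp add: TS_eq Hausdorff_bidual)
      show "continuous_map TS TS (k \<circ> h)" using ch by (rule continuous_map_compose)
    qed (use h(2) k(2) in auto)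
    then show ?thesis by simp
  qed
  have hk: "h (k x) = x" if x: "x \<in> carrier bA" for x
  proof -
    \<comment> \<open>Both \<open>h \<circ> k\<close> and the identity factor \<iota> through
      itself, so the uniqueness clause with test group \<open>bA\<close> identifies them.\<close>
    let ?P = "\<lambda>h. h \<in> continuous_hom bA TB bA TB \<inter> extensional (carrier bA) \<and> (\<forall>a\<in>carrier A. \<iota> a = h (\<iota> a))"
    have "\<exists>!h. ?P h" using 2 B unfolding bohr_compactification_def by blast
    moreover have "?P (restrict (h \<circ> k) (carrier bA))"
      using continuous_hom_compose[OF k(1) h(1) tB(2,1)] h(2) k(2) \<iota>B by simp
    moreover have "?P (restrict (id \<circ> id) (carrier bA))"
    proof -
      have "id \<in> continuous_hom bA TB bA TB" by (auto simp: continuous_hom_def hom_def)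
      then show ?thesis using continuous_hom_compose[OF _ _ tB(2,1), of id bA TB id bA TB] \<iota>B by simp
    qed
    ultimately have "restrict (h \<circ> k) (carrier bA) = restrict (id \<circ> id) (carrier bA)" by blast
    then have "restrict (h \<circ> k) (carrier bA) x = restrict (id \<circ> id) (carrier bA) x" by simp
    then show ?thesis using x by simp
  qed
  have "bij_betw h (carrier S) (carrier bA)"
    using kh hk hS kB by (intro bij_betw_byWitness[where f' = k]) auto
  moreover have "homeomorphic_map TS TB h"
    using ch kh hk by (intro homeomorphic_maps_map[THEN iffD1, THEN conjunct1, of TS TB h k])
      (auto simp: homeomorphic_maps_def topspace_TS tB)
  ultimately have "h \<in> topological_iso S TS bA TB"
    using h(1) by (simp add: topological_iso_def iso_def continuous_hom_def)
  then show ?thesis using h(2) by auto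
qed

end

theorem theorem3p1:
  fixes A :: "'a monoid" and TA :: "'a topology"
    and N :: "('a, 'a \<Rightarrow> complex) cl_structure" and \<kappa> :: "'k rel"
  defines "F \<equiv> characters A TA"
  defines "\<F> \<equiv> character_group A TA"
  defines "S \<equiv> type_group F N"
  defines "TS \<equiv> type_topology F N"
  assumes "comm_group A" and "topological_group A TA"
    and "elementary_extension F (character_structure A) N"
    and "Card_order \<kappa>" and "infinite (Field \<kappa>)" and "saturated \<kappa> F N"
  shows "(comm_group S \<and> compact_group S TS)
    \<and> (\<lambda>p. \<lambda>f\<in>F. type_eval F N f p) \<in>
        topological_iso S TS
          (character_group \<F> (discrete_topology F)) (pointwise_topology \<F> (discrete_topology F))
    \<and> tp F N \<in> continuous_hom A TA S TS
    \<and> bohr_compactification TYPE('d) A TA S TS (tp F N)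
    \<and> (\<forall>(bA :: 'b monoid) TB \<iota>.
          bohr_compactification TYPE(('a \<Rightarrow> complex) \<Rightarrow> complex) A TA bA TB \<iota> \<and>
          bohr_compactification TYPE('b) A TA bA TB \<iota> \<longrightarrow>
          (\<exists>h\<in>topological_iso S TS bA TB. \<forall>a\<in>carrier A. h (tp F N a) = \<iota> a))"
proof -
  interpret character_extension A TA N \<kappa> F S TS
    using assms(5-10) by (intro character_extension.intro) (simp_all add: F_def S_def TS_def)
  show ?thesis
    unfolding \<F>_def
    using comm_group_S compact_group_S types_iso_dual tp_continuous_hom bohr bohr_unique by blast
qed

end
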